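(* For $\lambda\in\mathbb{C}\setminus\{0,1\}$ and $\mu\in\mathbb{C}$ let \[ q_{\lambda,\mu} = -\frac{dz^2}{4\pi^2} \biggl( \frac{1}{z^2} + \frac{1}{(z-1)^2} + \frac{1}{(z-\lambda)^2} + \frac{\mu -2z}{z(z-1)(z-\lambda)} \biggr) \] on $\mathbb{P}^1=\mathbb{C}\cup\{\infty\}$; it has double poles at $0,1,\lambda,\infty$, each of residue $1$. Suppose $q=q_{\lambda,\mu}$ is a Strebel differential. Then $q$ has either two double zeroes or four simple zeroes. Moreover, $q_{\lambda,\mu}$ is a Strebel differential with two double zeroes if and only if $\lambda\in\mathbb{R}\setminus\{0,1\}$ and \[ \mu=\mu(\lambda)=\begin{cases} 2\lambda+2, & \lambda<0,\\ 2-2\lambda, & 0<\lambda<1,\\ 2\lambda-2, & \lambda>1.\end{cases} \] In this case, for every $\lambda\in\mathbb{R}\setminus\{0,1\}$ the metric ribbon graph of $q_{\lambda,\mu(\lambda)}$ coincides with that of $q_{\lambda_0,\mu(\lambda_0)}$ for some $\lambda_0\in[\tfrac12,1)$, and the metric ribbon graph of $q_{\lambda_0,\mu(\lambda_0)}$ consists of two vertices (the two double zeroes) joined by four edges, whose lengths, in the cyclic order around one vertex, are $\tfrac12+s,\ \tfrac12-s,\ \tfrac12+s,\ \tfrac12-s$, where $s=\frac{\arcsin(2\lambda_0-1)}{\pi}$.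
   Context: A meromorphic quadratic differential $q$ on a compact Riemann surface $X$ is locally $f(z)\,dz^2$; away from its zeros and poles it defines the flat metric $|f(z)|\,|dz|^2$ (the $q$-metric). A horizontal trajectory is a maximal curve $\gamma$ with $f(\gamma(t))\gamma'(t)^2>0$. A double pole $p$ of $q$ has residue $a>0$ if in a local coordinate $z$ with $z(p)=0$, $q=\bigl(-\frac{a^2}{4\pi^2 z^2}+O(z^{-1})\bigr)dz^2$ (equivalently, closed trajectories around $p$ have $q$-length $a$). Given marked points $p_1,\dots,p_n$, a Strebel differential is a meromorphic quadratic differential, holomorphic outside $\{p_i\}$, with a double pole at each $p_i$ of residue $a_i>0$, such that the union of non-closed horizontal trajectories has measure zero and every closed horizontal trajectory is a circle around some $p_i$. The critical graph of a Strebel differential has as vertices the zeroes of $q$ and as edges the critical horizontal trajectories (those ending at zeroes); with edge lengths measured in the $q$-metric and the cyclic ordering of edges at each vertex induced by the orientation of the surface, it is the metric ribbon graph of $q$. *)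

theory Defs
  imports "HOL-Complex_Analysis.Complex_Analysis"
begin

text \<open>A quadratic differential q = f(z) dz^2 on P^1 = C + {infinity} is represented by the
rational function f on C (values of f at its poles are irrelevant). The finite marked points
form a finite set P; the point at infinity is always marked as well. In the coordinate
w = 1/z near infinity, q = f(1/w) w^(-4) dw^2.\<close>

definition double_pole_res :: "(complex \<Rightarrow> complex) \<Rightarrow> complex \<Rightarrow> real \<Rightarrow> bool" where
  "double_pole_res f p a \<longleftrightarrow>
     (\<exists>C. eventually (\<lambda>z. norm (f z + complex_of_real (a\<^sup>2 / (4 * pi\<^sup>2)) / (z - p)\<^sup>2)
                           \<le> C * norm (1 / (z - p))) (at p))"

definition double_pole_res_inf :: "(complex \<Rightarrow> complex) \<Rightarrow> real \<Rightarrow> bool" where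
  "double_pole_res_inf f a \<longleftrightarrow>
     (\<exists>C. eventually (\<lambda>w. norm (f (1 / w) / w ^ 4 + complex_of_real (a\<^sup>2 / (4 * pi\<^sup>2)) / w\<^sup>2)
                           \<le> C * norm (1 / w)) (at 0))"

text \<open>Zeroes of q (all in C, since infinity is a marked pole) and the regular set.\<close>
definition qzeros :: "(complex \<Rightarrow> complex) \<Rightarrow> complex set \<Rightarrow> complex set" where
  "qzeros f P = {z. z \<notin> P \<and> f z = 0}"

definition regset :: "(complex \<Rightarrow> complex) \<Rightarrow> complex set \<Rightarrow> complex set" where
  "regset f P = - P - qzeros f P"

definition horiz_arc :: "(complex \<Rightarrow> complex) \<Rightarrow> complex set \<Rightarrow> (real \<Rightarrow> complex) \<Rightarrow> real set \<Rightarrow> bool" where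
  "horiz_arc f P \<gamma> I \<longleftrightarrow> is_interval I \<and> open I \<and> I \<noteq> {} \<and>
     (\<forall>t\<in>I. \<gamma> t \<in> regset f P \<and>
        (\<exists>g. (\<gamma> has_vector_derivative g) (at t) \<and>
             Im (f (\<gamma> t) * g\<^sup>2) = 0 \<and> 0 < Re (f (\<gamma> t) * g\<^sup>2)))"

definition nat_arc :: "(complex \<Rightarrow> complex) \<Rightarrow> complex set \<Rightarrow> (real \<Rightarrow> complex) \<Rightarrow> real set \<Rightarrow> bool" where
  "nat_arc f P \<gamma> I \<longleftrightarrow> is_interval I \<and> open I \<and> I \<noteq> {} \<and>
     (\<forall>t\<in>I. \<gamma> t \<in> regset f P \<and>
        (\<exists>g. (\<gamma> has_vector_derivative g) (at t) \<and> f (\<gamma> t) * g\<^sup>2 = 1))"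

definition htraj :: "(complex \<Rightarrow> complex) \<Rightarrow> complex set \<Rightarrow> complex set \<Rightarrow> bool" where
  "htraj f P T \<longleftrightarrow> (\<exists>\<gamma> I. horiz_arc f P \<gamma> I \<and> T = \<gamma> ` I \<and>
      (\<forall>\<delta> J. horiz_arc f P \<delta> J \<and> \<delta> ` J \<inter> T \<noteq> {} \<longrightarrow> \<delta> ` J \<subseteq> T))"

definition closed_htraj :: "(complex \<Rightarrow> complex) \<Rightarrow> complex set \<Rightarrow> complex set \<Rightarrow> bool" where
  "closed_htraj f P T \<longleftrightarrow> htraj f P T \<and>
     (\<exists>\<gamma> p. p > 0 \<and> horiz_arc f P \<gamma> UNIV \<and> (\<forall>t. \<gamma> (t + p) = \<gamma> t) \<and> T = range \<gamma>)"

text \<open>A closed trajectory is a circle around a marked point: either around a finite marked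
point z (the loop winds around z and around no other marked point), or around infinity
(the loop winds around every finite marked point).\<close>
definition circle_around_marked :: "(complex \<Rightarrow> complex) \<Rightarrow> complex set \<Rightarrow> complex set \<Rightarrow> bool" where
  "circle_around_marked f P T \<longleftrightarrow>
     (\<exists>\<gamma> p. p > 0 \<and> horiz_arc f P \<gamma> UNIV \<and> (\<forall>t. \<gamma> (t + p) = \<gamma> t) \<and> T = range \<gamma> \<and>
        (let c = (\<lambda>s. \<gamma> (p * s)) in
          (\<exists>z\<in>P. winding_number c z \<noteq> 0 \<and> (\<forall>z'\<in>P - {z}. winding_number c z' = 0))
          \<or> (\<forall>z\<in>P. winding_number c z \<noteq> 0)))"

definition strebel_P1 :: "(complex \<Rightarrow> complex) \<Rightarrow> complex set \<Rightarrow> (complex \<Rightarrow> real) \<Rightarrow> real \<Rightarrow> bool" where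
  "strebel_P1 f P a ainf \<longleftrightarrow>
     finite P \<and> f holomorphic_on (- P) \<and>
     (\<forall>p\<in>P. a p > 0 \<and> double_pole_res f p (a p)) \<and>
     ainf > 0 \<and> double_pole_res_inf f ainf \<and>
     \<Union>{T. htraj f P T \<and> \<not> closed_htraj f P T} \<in> null_sets lebesgue \<and>
     (\<forall>T. closed_htraj f P T \<longrightarrow> circle_around_marked f P T)"

text \<open>Darts (half-edges): a pair (v, d) of a zero v and the unit direction d in which a
critical horizontal trajectory leaves v.\<close>
definition leaves_zero :: "(complex \<Rightarrow> complex) \<Rightarrow> complex set \<Rightarrow> complex \<Rightarrow> complex \<Rightarrow> bool" where
  "leaves_zero f P v d \<longleftrightarrow> v \<in> qzeros f P \<and>
     (\<exists>\<gamma> e. e > 0 \<and> horiz_arc f P \<gamma> {0<..<e} \<and> (\<gamma> \<longlongrightarrow> v) (at_right 0) \<and>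
            ((\<lambda>t. sgn (\<gamma> t - v)) \<longlongrightarrow> d) (at_right 0))"

definition rg_darts :: "(complex \<Rightarrow> complex) \<Rightarrow> complex set \<Rightarrow> (complex \<times> complex) set" where
  "rg_darts f P = {(v, d). leaves_zero f P v d}"

text \<open>Edges: a critical trajectory, parametrized by q-arclength on (0, L), leaving the zero v
in direction d and arriving at the zero v' from direction d'; L is its q-length.\<close>
definition rg_edge :: "(complex \<Rightarrow> complex) \<Rightarrow> complex set \<Rightarrow> complex \<times> complex \<Rightarrow> complex \<times> complex \<Rightarrow> real \<Rightarrow> bool" where
  "rg_edge f P x y L \<longleftrightarrow> x \<in> rg_darts f P \<and> y \<in> rg_darts f P \<and> L > 0 \<and>
     (\<exists>\<gamma>. nat_arc f P \<gamma> {0<..<L} \<and>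
        (\<gamma> \<longlongrightarrow> fst x) (at_right 0) \<and> ((\<lambda>t. sgn (\<gamma> t - fst x)) \<longlongrightarrow> snd x) (at_right 0) \<and>
        (\<gamma> \<longlongrightarrow> fst y) (at_left L) \<and> ((\<lambda>t. sgn (\<gamma> t - fst y)) \<longlongrightarrow> snd y) (at_left L))"

definition ccw_angle :: "complex \<Rightarrow> complex \<Rightarrow> real" where
  "ccw_angle d d' = (let a = Arg (d' / d) in if a \<le> 0 then a + 2 * pi else a)"

definition rg_next :: "(complex \<Rightarrow> complex) \<Rightarrow> complex set \<Rightarrow> complex \<times> complex \<Rightarrow> complex \<times> complex \<Rightarrow> bool" where
  "rg_next f P x y \<longleftrightarrow> x \<in> rg_darts f P \<and> y \<in> rg_darts f P \<and> fst y = fst x \<and>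
     (\<forall>z\<in>rg_darts f P. fst z = fst x \<longrightarrow> ccw_angle (snd x) (snd y) \<le> ccw_angle (snd x) (snd z))"

definition rg_iso :: "(complex \<Rightarrow> complex) \<Rightarrow> complex set \<Rightarrow> (complex \<Rightarrow> complex) \<Rightarrow> complex set \<Rightarrow> bool" where
  "rg_iso f P g Q \<longleftrightarrow> (\<exists>\<phi>. bij_betw \<phi> (rg_darts f P) (rg_darts g Q) \<and>
     (\<forall>x\<in>rg_darts f P. \<forall>y\<in>rg_darts f P. rg_next f P x y \<longleftrightarrow> rg_next g Q (\<phi> x) (\<phi> y)) \<and>
     (\<forall>x\<in>rg_darts f P. \<forall>y\<in>rg_darts f P. \<forall>L. rg_edge f P x y L \<longleftrightarrow> rg_edge g Q (\<phi> x) (\<phi> y) L))"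

definition rg_two_vertices_four_edges ::
  "(complex \<Rightarrow> complex) \<Rightarrow> complex set \<Rightarrow> (nat \<Rightarrow> real) \<Rightarrow> bool" where
  "rg_two_vertices_four_edges f P len \<longleftrightarrow>
     (\<exists>v1 v2 d e. v1 \<noteq> v2 \<and> qzeros f P = {v1, v2} \<and>
        inj_on d {0..<4} \<and> inj_on e {0..<4} \<and>
        {x \<in> rg_darts f P. fst x = v1} = (\<lambda>i. (v1, d i)) ` {0..<4} \<and>
        {x \<in> rg_darts f P. fst x = v2} = (\<lambda>i. (v2, e i)) ` {0..<4} \<and>
        (\<forall>i<4. rg_next f P (v1, d i) (v1, d ((i + 1) mod 4))) \<and>
        (\<forall>i<4. \<forall>y L. rg_edge f P (v1, d i) y L \<longleftrightarrow> (y = (v2, e i) \<and> L = len i)) \<and>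
        (\<forall>i<4. \<forall>y L. rg_edge f P (v2, e i) y L \<longleftrightarrow> (y = (v1, d i) \<and> L = len i)))"

definition qlm :: "complex \<Rightarrow> complex \<Rightarrow> complex \<Rightarrow> complex" where
  "qlm lam mu z = - (1 / (4 * complex_of_real pi ^ 2)) *
      (1 / z\<^sup>2 + 1 / (z - 1)\<^sup>2 + 1 / (z - lam)\<^sup>2 + (mu - 2 * z) / (z * (z - 1) * (z - lam)))"

definition marked :: "complex \<Rightarrow> complex set" where
  "marked lam = {0, 1, lam}"

definition strebel_lm :: "complex \<Rightarrow> complex \<Rightarrow> bool" where
  "strebel_lm lam mu \<longleftrightarrow> strebel_P1 (qlm lam mu) (marked lam) (\<lambda>_. 1) 1"

definition two_double_zeros :: "(complex \<Rightarrow> complex) \<Rightarrow> complex set \<Rightarrow> bool" where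
  "two_double_zeros f P \<longleftrightarrow> card (qzeros f P) = 2 \<and> (\<forall>z\<in>qzeros f P. zorder f z = 2)"

definition four_simple_zeros :: "(complex \<Rightarrow> complex) \<Rightarrow> complex set \<Rightarrow> bool" where
  "four_simple_zeros f P \<longleftrightarrow> card (qzeros f P) = 4 \<and> (\<forall>z\<in>qzeros f P. zorder f z = 1)"

definition mu_of :: "real \<Rightarrow> real" where
  "mu_of l = (if l < 0 then 2 * l + 2 else if l < 1 then 2 - 2 * l else 2 * l - 2)"

end

theory Submission
  imports Defs "HOL-Computational_Algebra.Fundamental_Theorem_Algebra"
begin

text \<open>
  A multiple root of the numerator of q forces mu to be one of three values, and then
  q = (R' / (2 pi i R))^2 dz^2 with R = (z - a)(z - b) / (z - c), {a, b, c} = {0, 1, lam}: horizontal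
  arcs are the arcs along which the modulus of R is constant. With v1, v2 the critical values of R and
  U = (z - z1) / (z - z2), one has U^2 = (R - v1) / (R - v2), so R is a square in Moebius coordinates.
  If v1 and v2 have different moduli, an intermediate level set of |R| is a single closed trajectory
  separating {a, b} from {c, infinity}; hence a Strebel differential has |v1| = |v2|, which means that c
  lies on the open segment between a and b. Conversely, if it does, a rotation V of U turns the
  critical level set into the two coordinate axes, whose four half axes are the edges of
  the critical graph and whose four quadrants are punctured discs swept out by closed trajectories. Edge
  lengths are read off from the argument of R.
\<close>

section \<open>Zeros of the quadratic differential\<close>

text \<open>The form \<open>om z\<close> dz with \<open>om\<close> = R' / R has a simple pole at
  each of the four marked points, and its residue there is 1 or -1 because the double pole of q has
  residue 1. These residues add up to 0, so two are 1 and two are -1: exactly one finite marked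
  point c carries the same sign as infinity. Its three possible positions are the origin of the
  three exceptional values of mu. Trajectories are defined by quantifying over all horizontal arcs,
  so maximality, closedness and uniqueness would normally call for flows. They are replaced by two
  devices. Level curves are lifted explicitly through one square root, as R has degree two;
  arbitrary arcs are controlled by what is conserved along them, namely the modulus of R and the
  branch of V. The two situations differ by monodromy. A circle about 0 in the R-plane that encloses
  one critical value lifts to a single curve covering it twice; a circle that encloses none or both
  lifts to two curves.\<close>

definition qnum :: "complex \<Rightarrow> complex \<Rightarrow> complex \<Rightarrow> complex" where
  "qnum lam mu z = (z\<^sup>2 - lam)\<^sup>2 + (mu - 2 * lam - 2) * (z * (z - 1) * (z - lam))"

lemma qlm_eq_qnum:
  assumes "z \<noteq> 0" "z \<noteq> 1" "z \<noteq> lam"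
  shows "qlm lam mu z = - (1 / (4 * complex_of_real pi ^ 2)) * (qnum lam mu z / (z * (z - 1) * (z - lam))\<^sup>2)"
proof -
  have nz: "z \<noteq> 0" "z - 1 \<noteq> 0" "z - lam \<noteq> 0" using assms by auto
  have "1 / z\<^sup>2 + 1 / (z - 1)\<^sup>2 + 1 / (z - lam)\<^sup>2 + (mu - 2 * z) / (z * (z - 1) * (z - lam))
      = qnum lam mu z / (z * (z - 1) * (z - lam))\<^sup>2"
    using nz by (simp add: divide_simps qnum_def) algebra
  then show ?thesis unfolding qlm_def by simp
qed

lemma qzeros_qlm:
  assumes "lam \<noteq> 0" "lam \<noteq> 1"
  shows "qzeros (qlm lam mu) (marked lam) = {z. qnum lam mu z = 0}"
proof -
  have "qnum lam mu z \<noteq> 0" if "z \<in> marked lam" for z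
    using that assms by (auto simp: marked_def qnum_def power2_eq_square)
  moreover have "qlm lam mu z = 0 \<longleftrightarrow> qnum lam mu z = 0" if "z \<notin> marked lam" for z
    using that qlm_eq_qnum[of z lam mu] by (auto simp: marked_def)
  ultimately show ?thesis by (auto simp: qzeros_def)
qed

lemma zorder_qlm:
  assumes "lam \<noteq> 0" "lam \<noteq> 1" "n > 0"
    and "\<And>z. qnum lam mu z = (z - z0) ^ n * g z" "g z0 \<noteq> 0" "g holomorphic_on UNIV"
  shows "zorder (qlm lam mu) z0 = int n"
proof -
  have z0: "z0 \<notin> marked lam"
    using assms qzeros_qlm[OF assms(1,2), of mu] by (auto simp: qzeros_def)
  let ?h = "\<lambda>z. - (1 / (4 * complex_of_real pi ^ 2)) * (g z / (z * (z - 1) * (z - lam))\<^sup>2)"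
  show ?thesis
  proof (rule zorder_eqI)
    show "open (- marked lam)" by (auto simp: marked_def)
    show "z0 \<in> - marked lam" using z0 by auto
    show "?h holomorphic_on - marked lam"
      using assms(6) by (intro holomorphic_intros) (auto simp: marked_def intro: holomorphic_on_subset)
    show "?h z0 \<noteq> 0" using z0 assms by (auto simp: marked_def)
    show "qlm lam mu w = ?h w * (w - z0) powi int n" if "w \<in> - marked lam" "w \<noteq> z0" for w
      using that qlm_eq_qnum[of w lam mu] assms by (auto simp: marked_def)
  qed
qed

text \<open>Both equations are linear in \<open>nu\<close>. Eliminating it leaves a product of three
  quadratics in z; each is the equation (z - c)^2 = (c - a)(c - b) for one choice of c in {a, b, c}
  = {0, 1, lam}, and substituting it back pins down \<open>nu\<close>.\<close>

lemma qnum_double_root: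
  assumes "lam \<noteq> 0" "lam \<noteq> 1" and "qnum lam mu z = 0"
    and "4 * z * (z\<^sup>2 - lam) + (mu - 2 * lam - 2) * (3 * z\<^sup>2 - 2 * (1 + lam) * z + lam) = 0"
  shows "mu \<in> {2 * lam + 2, 2 - 2 * lam, 2 * lam - 2}"
proof -
  define nu where "nu = mu - 2 * lam - 2"
  define D where "D = z * (z - 1) * (z - lam)"
  have nz: "z \<noteq> 0" "z \<noteq> 1" "z \<noteq> lam"
    using assms by (auto simp: qnum_def power2_eq_square)
  then have D: "D \<noteq> 0" by (auto simp: D_def)
  have 1: "(z\<^sup>2 - lam)\<^sup>2 + nu * D = 0" using assms(3) by (simp add: qnum_def nu_def D_def)
  have 2: "4 * z * (z\<^sup>2 - lam) + nu * (3 * z\<^sup>2 - 2 * (1 + lam) * z + lam) = 0"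
    using assms(4) by (simp add: nu_def)
  have "(z\<^sup>2 - lam) * ((z\<^sup>2 - 2 * z + lam) * (z\<^sup>2 - 2 * lam * z + lam)) = 0"
    using 1 2 unfolding D_def by algebra
  then consider "z\<^sup>2 = lam" | "z\<^sup>2 - 2 * z + lam = 0" | "z\<^sup>2 - 2 * lam * z + lam = 0"
    by auto
  then have "nu = 0 \<or> nu = -4 \<or> nu = -4 * lam"
  proof cases
    case 1
    then show ?thesis using D \<open>(z\<^sup>2 - lam)\<^sup>2 + nu * D = 0\<close> by auto
  next
    case 2
    have "(nu + 4) * D = 0" using 1 2 unfolding D_def by algebra
    then show ?thesis using D by (auto simp: add_eq_0_iff2)
  next
    case 3
    have "(nu + 4 * lam) * D = 0" using 1 3 unfolding D_def by algebra
    then show ?thesis using D by (auto simp: add_eq_0_iff2)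
  qed
  then show ?thesis by (auto simp: nu_def algebra_simps)
qed

text \<open>Away from the exceptional values the quartic is squarefree, so the fundamental theorem
  of algebra provides four distinct roots.\<close>

lemma four_simple_zeros_qlm:
  assumes "lam \<noteq> 0" "lam \<noteq> 1" and mu: "mu \<notin> {2 * lam + 2, 2 - 2 * lam, 2 * lam - 2}"
  shows "four_simple_zeros (qlm lam mu) (marked lam)"
proof -
  define nu where "nu = mu - 2 * lam - 2"
  define p where "p = [: lam\<^sup>2, lam * nu, - 2 * lam - nu * (1 + lam), nu, 1 :]"
  have p: "poly p z = qnum lam mu z" for z
    by (simp add: p_def qnum_def nu_def algebra_simps power2_eq_square)
  have dp: "poly (pderiv p) z = 4 * z * (z\<^sup>2 - lam) + nu * (3 * z\<^sup>2 - 2 * (1 + lam) * z + lam)" for z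
    by (simp add: p_def pderiv_pCons algebra_simps power2_eq_square)
  have sf: "rsquarefree p"
    unfolding rsquarefree_roots using qnum_double_root[OF assms(1,2), of mu] mu
    by (auto simp: p dp nu_def)
  have deg: "degree p = 4" and p0: "p \<noteq> 0" by (auto simp: p_def)
  have qz: "qzeros (qlm lam mu) (marked lam) = {z. poly p z = 0}"
    using qzeros_qlm[OF assms(1,2)] by (simp add: p)
  have "card {z. poly p z = 0} = 4"
  proof -
    have "proots p = mset_set {z. poly p z = 0}"
    proof (rule multiset_eqI)
      fix z
      show "count (proots p) z = count (mset_set {z. poly p z = 0}) z"
        using sf p0 poly_roots_finite[OF p0]
        by (cases "poly p z = 0") (auto simp: rsquarefree_root_order order_0I)
    qed
    then show ?thesis using size_proots_complex[of p] deg by simp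
  qed
  moreover have "zorder (qlm lam mu) z = 1" if "poly p z = 0" for z
  proof -
    obtain q where q: "p = [:-z, 1:] * q" using \<open>poly p z = 0\<close> poly_eq_0_iff_dvd by (metis dvdE)
    \<comment> \<open>The product rule at the root leaves only the cofactor, so simplicity of the
      root is nonvanishing of the cofactor.\<close>
    have "poly (pderiv p) z = poly q z" unfolding q by (simp add: pderiv_diff pderiv_smult pderiv_pCons)
    moreover have "poly (pderiv p) z \<noteq> 0" using sf that by (auto simp: rsquarefree_roots)
    ultimately have "poly q z \<noteq> 0" by simp
    moreover have "qnum lam mu w = (w - z) ^ 1 * poly q w" for w
      by (simp add: p[symmetric] q algebra_simps)
    moreover have "poly q holomorphic_on UNIV"
      unfolding holomorphic_on_def field_differentiable_def using poly_DERIV by blast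
    ultimately show ?thesis
      using zorder_qlm[OF assms(1,2), of 1 mu z "poly q"] by auto
  qed
  ultimately show ?thesis by (auto simp: four_simple_zeros_def qz)
qed

lemma two_double_zeros_qlm:
  assumes "lam \<noteq> 0" "lam \<noteq> 1" and "z1 \<noteq> z2"
    and q: "\<And>z. qnum lam mu z = ((z - z1) * (z - z2))\<^sup>2"
  shows "two_double_zeros (qlm lam mu) (marked lam)"
proof -
  have qz: "qzeros (qlm lam mu) (marked lam) = {z1, z2}"
    using qzeros_qlm[OF assms(1,2)] q by auto
  have "zorder (qlm lam mu) z1 = int 2"
    by (rule zorder_qlm[OF assms(1,2), where g="\<lambda>z. (z - z2)\<^sup>2"])
      (use assms in \<open>auto simp: power_mult_distrib intro!: holomorphic_intros\<close>)
  moreover have "zorder (qlm lam mu) z2 = int 2"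
    by (rule zorder_qlm[OF assms(1,2), where g="\<lambda>z. (z - z1)\<^sup>2"])
      (use assms in \<open>auto simp: power_mult_distrib intro!: holomorphic_intros\<close>)
  ultimately show ?thesis using assms(3) by (auto simp: two_double_zeros_def qz)
qed

section \<open>Differentials with two double zeros\<close>

text \<open>Linearizes positivity of q on a tangent vector: q is a negative constant times a square,
  and a square is a negative real exactly when its root is imaginary and nonzero.\<close>

lemma neg_square_pos_iff:
  fixes X :: complex
  shows "Im (X\<^sup>2) = 0 \<and> Re (X\<^sup>2) < 0 \<longleftrightarrow> (\<exists>h::real. h \<noteq> 0 \<and> X = \<i> * of_real h)"
proof
  assume "Im (X\<^sup>2) = 0 \<and> Re (X\<^sup>2) < 0"
  then have "Re X * Im X = 0" "(Re X)\<^sup>2 < (Im X)\<^sup>2"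
    by (auto simp: power2_eq_square)
  moreover have "\<not> (Re X)\<^sup>2 < 0" by (simp add: not_less)
  ultimately have "Re X = 0" "Im X \<noteq> 0" by auto
  then have "X = \<i> * of_real (Im X)" by (simp add: complex_eq_iff)
  with \<open>Im X \<noteq> 0\<close> show "\<exists>h::real. h \<noteq> 0 \<and> X = \<i> * of_real h" by blast
next
  assume "\<exists>h::real. h \<noteq> 0 \<and> X = \<i> * of_real h"
  then show "Im (X\<^sup>2) = 0 \<and> Re (X\<^sup>2) < 0"
    by (auto simp: power2_eq_square) (metis mult_eq_0_iff not_real_square_gt_zero)
qed

lemma horiz_arc_continuous: "horiz_arc f P \<gamma> I \<Longrightarrow> continuous_on I \<gamma>"
  unfolding horiz_arc_def
  by (intro continuous_at_imp_continuous_on) (auto intro: has_vector_derivative_continuous)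

text \<open>Vanishing winding numbers are obtained by exhibiting an explicit ray from the point to
  infinity that misses the curve.\<close>

lemma winding_zero_outside:
  assumes "path \<gamma>" "pathfinish \<gamma> = pathstart \<gamma>" "connected S" "\<not> bounded S" "z \<in> S" "S \<inter> path_image \<gamma> = {}"
  shows "winding_number \<gamma> z = 0"
proof (rule winding_number_zero_in_outside[OF assms(1,2)])
  have "S \<subseteq> connected_component_set (- path_image \<gamma>) z"
    using assms by (intro connected_component_maximal) auto
  then show "z \<in> outside (path_image \<gamma>)"
    using assms(4-6) by (auto simp: outside_def intro: bounded_subset)
qed

text \<open>The square root of q has residues of one sign at a and b and of the other sign at c and
  infinity. The root k is a parameter rather than a chosen value, so that the same data can be
  instantiated with k and with -k, which exchanges the two zeros.\<close>

locale double_zero_qd =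
  fixes a b c k :: complex and f :: "complex \<Rightarrow> complex" and P :: "complex set"
  assumes ab: "a \<noteq> b" and ac: "a \<noteq> c" and bc: "b \<noteq> c"
    and k_sq: "k\<^sup>2 = (c - a) * (c - b)"
    and P_def: "P = {a, b, c}"
    and f_eq: "\<And>z. z \<notin> P \<Longrightarrow>
      f z = - (1 / (4 * complex_of_real pi ^ 2)) * (1 / (z - a) + 1 / (z - b) - 1 / (z - c))\<^sup>2"
begin

section \<open>The degree two map R and the Moebius coordinate that makes it a square\<close>

definition om :: "complex \<Rightarrow> complex" where
  "om z = 1 / (z - a) + 1 / (z - b) - 1 / (z - c)"

definition R :: "complex \<Rightarrow> complex" where
  "R z = (z - a) * (z - b) / (z - c)"

definition z1 where "z1 = c + k"
definition z2 where "z2 = c - k"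
definition v1 where "v1 = 2 * c - a - b + 2 * k"
definition v2 where "v2 = 2 * c - a - b - 2 * k"

lemma k_nz: "k \<noteq> 0"
  using k_sq ac bc by auto

lemma z1_ne_z2: "z1 \<noteq> z2"
  using k_nz by (simp add: z1_def z2_def)

lemma v1_ne_v2: "v1 \<noteq> v2"
  using k_nz by (simp add: v1_def v2_def)

lemma v2_nz: "v2 \<noteq> 0"
proof -
  have "v1 * v2 = (a - b)\<^sup>2" using k_sq unfolding v1_def v2_def by algebra
  then show ?thesis using ab by auto
qed

lemma z12_notin: "z1 \<notin> P" "z2 \<notin> P"
proof -
  have *: "c + s \<notin> P" if "s\<^sup>2 = (c - a) * (c - b)" for s
  proof
    assume "c + s \<in> P"
    then consider "s = a - c" | "s = b - c" | "s = 0" by (auto simp: P_def algebra_simps)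
    then show False
    proof cases
      case 1
      then have "(c - a) * (a - b) = 0" using that by algebra
      then show False using ab ac by auto
    next
      case 2
      then have "(c - b) * (a - b) = 0" using that by algebra
      then show False using ab bc by auto
    next
      case 3
      then show False using that ac bc by auto
    qed
  qed
  show "z1 \<notin> P" using *[of k] k_sq by (simp add: z1_def)
  show "z2 \<notin> P" using *[of "-k"] k_sq by (simp add: z2_def)
qed

lemma om_eq:
  assumes "z \<notin> P"
  shows "om z = (z - z1) * (z - z2) / ((z - a) * (z - b) * (z - c))"
proof -
  have nz: "z - a \<noteq> 0" "z - b \<noteq> 0" "z - c \<noteq> 0" using assms by (auto simp: P_def)
  have "(z - z1) * (z - z2) = (z - b) * (z - c) + (z - a) * (z - c) - (z - a) * (z - b)"
    using k_sq unfolding z1_def z2_def by algebra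
  then show ?thesis using nz by (simp add: om_def divide_simps) (simp add: algebra_simps)
qed

lemma f_om: "z \<notin> P \<Longrightarrow> f z * g\<^sup>2 = of_real (1 / (4 * pi\<^sup>2)) * - (om z * g)\<^sup>2"
  by (simp add: f_eq om_def power_mult_distrib)

lemma qzeros_eq: "qzeros f P = {z1, z2}"
proof -
  have "f z = 0 \<longleftrightarrow> z = z1 \<or> z = z2" if "z \<notin> P" for z
    using f_om[OF that, of 1] om_eq[OF that] that by (auto simp: P_def)
  then show ?thesis using z12_notin by (auto simp: qzeros_def)
qed

lemma regset_eq: "regset f P = - {a, b, c, z1, z2}"
  using qzeros_eq by (auto simp: regset_def P_def)

lemma R_z1: "R z1 = v1" and R_z2: "R z2 = v2"
proof -
  have *: "(c + s - a) * (c + s - b) = (2 * c - a - b + 2 * s) * s" if "s\<^sup>2 = (c - a) * (c - b)" for s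
    using that by algebra
  show "R z1 = v1" using *[OF k_sq] k_nz by (simp add: R_def z1_def v1_def)
  show "R z2 = v2" using *[of "-k"] k_sq k_nz by (simp add: R_def z2_def v2_def)
qed

text \<open>R has degree two, so the fibre over a critical value is the critical point counted
  twice; after clearing the denominator the difference is a perfect square.\<close>

lemma R_minus_v1: "z \<noteq> c \<Longrightarrow> R z - v1 = (z - z1)\<^sup>2 / (z - c)"
  and R_minus_v2: "z \<noteq> c \<Longrightarrow> R z - v2 = (z - z2)\<^sup>2 / (z - c)"
proof -
  assume z: "z \<noteq> c"
  have "(z - a) * (z - b) - v1 * (z - c) = (z - z1)\<^sup>2"
       "(z - a) * (z - b) - v2 * (z - c) = (z - z2)\<^sup>2"
    using k_sq unfolding z1_def v1_def z2_def v2_def by algebra+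
  then show "R z - v1 = (z - z1)\<^sup>2 / (z - c)" "R z - v2 = (z - z2)\<^sup>2 / (z - c)"
    using z by (simp_all add: R_def field_simps)
qed

lemma R_eq_v1_iff: "z \<noteq> c \<Longrightarrow> R z = v1 \<longleftrightarrow> z = z1"
  and R_eq_v2_iff: "z \<noteq> c \<Longrightarrow> R z = v2 \<longleftrightarrow> z = z2"
  using R_minus_v1[of z] R_minus_v2[of z] by auto

lemma R_eq_0_iff: "z \<noteq> c \<Longrightarrow> R z = 0 \<longleftrightarrow> z = a \<or> z = b"
  by (simp add: R_def)

definition U :: "complex \<Rightarrow> complex" where "U z = (z - z1) / (z - z2)"

lemma U_sq: "z \<noteq> c \<Longrightarrow> (U z)\<^sup>2 = (R z - v1) / (R z - v2)"
  by (simp add: U_def R_minus_v1 R_minus_v2 power_divide)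

text \<open>The inverse Moebius map of \<open>U\<close>. The points u = 1 and u = -1 stand for
  infinity and c, the two poles of R; hence the side conditions that exclude them.\<close>

definition of_U :: "complex \<Rightarrow> complex" where "of_U u = c + k * (1 + u) / (1 - u)"

lemma of_U_U: "z \<noteq> z2 \<Longrightarrow> of_U (U z) = z"
  using k_nz by (auto simp: of_U_def U_def z1_def z2_def divide_simps)

lemma of_U_minus_z1: "u \<noteq> 1 \<Longrightarrow> of_U u - z1 = 2 * k * u / (1 - u)"
  and of_U_minus_z2: "u \<noteq> 1 \<Longrightarrow> of_U u - z2 = 2 * k / (1 - u)"
  by (auto simp: of_U_def z1_def z2_def field_simps)

lemma U_of_U: "u \<noteq> 1 \<Longrightarrow> U (of_U u) = u"
  using k_nz by (simp add: U_def of_U_minus_z1 of_U_minus_z2)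

text \<open>Either square root u yields a point of the fibre over w. The Moebius transform of a
  finite w is never 1, which keeps \<open>of_U u\<close> away from infinity and from c.\<close>

lemma of_U_level:
  assumes u: "u\<^sup>2 = (w - v1) / (w - v2)" and w: "w \<noteq> v1" "w \<noteq> v2"
  shows "u \<noteq> 1" "u \<noteq> -1" "of_U u \<noteq> c" "R (of_U u) = w"
proof -
  have "u\<^sup>2 \<noteq> 1"
  proof
    assume "u\<^sup>2 = 1"
    then have "w - v1 = w - v2" using u w by (simp add: field_simps)
    then show False using v1_ne_v2 by simp
  qed
  then show u1: "u \<noteq> 1" and u2: "u \<noteq> -1" by auto
  have "1 - u \<noteq> 0" "1 + u \<noteq> 0" using u1 u2 by (auto simp: add_eq_0_iff)
  then show c: "of_U u \<noteq> c" using k_nz by (auto simp: of_U_def)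
  have z2: "of_U u \<noteq> z2" using of_U_minus_z2[OF u1] k_nz u1 by auto
  then have "R (of_U u) \<noteq> v2" using R_eq_v2_iff[OF c] by auto
  moreover have "(w - v1) / (w - v2) = (R (of_U u) - v1) / (R (of_U u) - v2)"
    using U_sq[OF c] U_of_U[OF u1] u by simp
  ultimately have "(w - v1) * (R (of_U u) - v2) = (R (of_U u) - v1) * (w - v2)"
    using w by (simp add: frac_eq_eq)
  then have "(v1 - v2) * (R (of_U u) - w) = 0" by algebra
  then show "R (of_U u) = w" using v1_ne_v2 by auto
qed

lemma of_U_regset:
  assumes u: "u\<^sup>2 = (w - v1) / (w - v2)" and w: "w \<noteq> v1" "w \<noteq> v2" "w \<noteq> 0"
  shows "of_U u \<in> regset f P"
  using of_U_level[OF u w(1,2)] w R_eq_0_iff[of "of_U u"] R_eq_v1_iff[of "of_U u"]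
    R_eq_v2_iff[of "of_U u"] by (auto simp: regset_eq)

section \<open>Horizontal arcs as level arcs of the modulus of R\<close>

lemma R_deriv:
  assumes "z \<notin> P"
  shows "(R has_field_derivative R z * om z) (at z)"
proof -
  have nz: "z - a \<noteq> 0" "z - b \<noteq> 0" "z - c \<noteq> 0" using assms by (auto simp: P_def)
  have "((\<lambda>z. (z - a) * (z - b) / (z - c)) has_field_derivative R z * om z) (at z)"
    apply (rule derivative_eq_intros refl | use nz in force)+
    using nz by (simp add: R_def om_def divide_simps)
  then show ?thesis by (simp add: R_def[abs_def])
qed

text \<open>\<open>om\<close> is the logarithmic derivative of R, so along a horizontal arc the
  argument of R moves at the nonzero speed h while its modulus is stationary.\<close>

lemma horiz_arc_iff:
  "horiz_arc f P \<gamma> I \<longleftrightarrow> is_interval I \<and> open I \<and> I \<noteq> {} \<and>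
     (\<forall>t\<in>I. \<gamma> t \<in> regset f P \<and>
        (\<exists>g h. (\<gamma> has_vector_derivative g) (at t) \<and> h \<noteq> 0 \<and> om (\<gamma> t) * g = \<i> * complex_of_real h))"
proof -
  have "Im (f z * g\<^sup>2) = 0 \<and> 0 < Re (f z * g\<^sup>2) \<longleftrightarrow> (\<exists>h. h \<noteq> 0 \<and> om z * g = \<i> * complex_of_real h)"
    if "z \<in> regset f P" for z g
  proof -
    have "z \<notin> P" using that by (auto simp: regset_def)
    have "Im (of_real r * - X) = 0 \<and> 0 < Re (of_real r * - X) \<longleftrightarrow> Im X = 0 \<and> Re X < 0"
      if "r > 0" for r :: real and X
      using that by (auto simp: mult_less_0_iff)
    from this[of "1 / (4 * pi\<^sup>2)"] show ?thesis
      unfolding f_om[OF \<open>z \<notin> P\<close>] neg_square_pos_iff[symmetric] by simp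
  qed
  then show ?thesis unfolding horiz_arc_def by blast
qed

text \<open>Unit speed in the q-metric is speed 2 pi for the argument of R, so q-length is change of
  argument divided by 2 pi. The sign of h stays open, because g enters the definition
  squared.\<close>

lemma nat_arc_iff:
  "nat_arc f P \<gamma> I \<longleftrightarrow> is_interval I \<and> open I \<and> I \<noteq> {} \<and>
     (\<forall>t\<in>I. \<gamma> t \<in> regset f P \<and>
        (\<exists>g h. (\<gamma> has_vector_derivative g) (at t) \<and> \<bar>h\<bar> = 2 * pi \<and> om (\<gamma> t) * g = \<i> * complex_of_real h))"
proof -
  have "f z * g\<^sup>2 = 1 \<longleftrightarrow> (\<exists>h. \<bar>h\<bar> = 2 * pi \<and> om z * g = \<i> * complex_of_real h)"
    if "z \<in> regset f P" for z g
  proof -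
    have "z \<notin> P" using that by (auto simp: regset_def)
    have "of_real r * - X = 1 \<longleftrightarrow> X = - of_real (1 / r)" if "r > 0" for r :: real and X :: complex
      using that by (auto simp: field_simps minus_equation_iff[of _ 1])
    from this[of "1 / (4 * pi\<^sup>2)"]
    have "f z * g\<^sup>2 = 1 \<longleftrightarrow> (om z * g)\<^sup>2 = (\<i> * of_real (2 * pi))\<^sup>2"
      unfolding f_om[OF \<open>z \<notin> P\<close>] by (simp add: power_mult_distrib)
    also have "\<dots> \<longleftrightarrow> om z * g = \<i> * of_real (2 * pi) \<or> om z * g = \<i> * of_real (- 2 * pi)"
      by (simp add: power2_eq_iff)
    also have "\<dots> \<longleftrightarrow> (\<exists>h. \<bar>h\<bar> = 2 * pi \<and> om z * g = \<i> * complex_of_real h)"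
    proof
      assume "om z * g = \<i> * of_real (2 * pi) \<or> om z * g = \<i> * of_real (- 2 * pi)"
      then show "\<exists>h. \<bar>h\<bar> = 2 * pi \<and> om z * g = \<i> * complex_of_real h"
        by (metis abs_minus_cancel abs_of_nonneg mult_minus_left pi_ge_zero zero_le_mult_iff zero_le_numeral)
    next
      assume "\<exists>h. \<bar>h\<bar> = 2 * pi \<and> om z * g = \<i> * complex_of_real h"
      then obtain h where "\<bar>h\<bar> = 2 * pi" "om z * g = \<i> * complex_of_real h" by blast
      moreover from this(1) have "h = 2 * pi \<or> h = - 2 * pi" by linarith
      ultimately show "om z * g = \<i> * of_real (2 * pi) \<or> om z * g = \<i> * of_real (- 2 * pi)"
        by blast
    qed
    finally show ?thesis .
  qed
  then show ?thesis unfolding nat_arc_def by blast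
qed

lemma nat_imp_horiz: "nat_arc f P \<gamma> I \<Longrightarrow> horiz_arc f P \<gamma> I"
  unfolding nat_arc_iff horiz_arc_iff using pi_gt_zero by force

lemma R_comp_deriv:
  assumes "(\<gamma> has_vector_derivative g) (at t)" "\<gamma> t \<in> regset f P"
  shows "((\<lambda>t. R (\<gamma> t)) has_vector_derivative R (\<gamma> t) * (om (\<gamma> t) * g)) (at t)"
  using field_vector_diff_chain_at[OF assms(1) R_deriv[of "\<gamma> t"]] assms(2)
  by (auto simp: regset_def o_def mult_ac)

text \<open>The derivative of the lift is never computed. Differentiability comes from the chain
  rule; then R (of_U (u s)) = w s is differentiated, and comparison with the known derivative of w
  determines the product of \<open>om\<close> and g.\<close>

lemma lift_deriv:
  assumes S: "open S" "t \<in> S"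
    and u: "\<And>s. s \<in> S \<Longrightarrow> (u s)\<^sup>2 = (w s - v1) / (w s - v2)"
    and w: "\<And>s. s \<in> S \<Longrightarrow> w s \<notin> {v1, v2, 0}"
    and du: "u differentiable at t"
    and dw: "(w has_vector_derivative w t * (\<i> * of_real h)) (at t)"
  shows "\<exists>g. ((\<lambda>s. of_U (u s)) has_vector_derivative g) (at t) \<and> om (of_U (u t)) * g = \<i> * of_real h"
proof -
  let ?\<gamma> = "\<lambda>s. of_U (u s)"
  have u1: "1 - u t \<noteq> 0" using of_U_level(1)[OF u[OF S(2)]] w[OF S(2)] by auto
  obtain u' where u': "(u has_vector_derivative u') (at t)"
    using du by (auto simp: vector_derivative_works)
  obtain D where D: "(of_U has_field_derivative D) (at (u t))"
  proof -
    have "of_U field_differentiable (at (u t))"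
      unfolding of_U_def[abs_def] using u1 by (intro derivative_intros) auto
    then show ?thesis using that by (auto simp: field_differentiable_def)
  qed
  from field_vector_diff_chain_at[OF u' D] obtain g where g: "(?\<gamma> has_vector_derivative g) (at t)"
    by (auto simp: o_def)
  have reg: "?\<gamma> t \<in> regset f P" using of_U_regset[OF u[OF S(2)]] w[OF S(2)] by auto
  have Rw: "R (?\<gamma> s) = w s" if "s \<in> S" for s
    using of_U_level(4)[OF u[OF that]] w[OF that] by auto
  have "((\<lambda>t. R (?\<gamma> t)) has_vector_derivative R (?\<gamma> t) * (om (?\<gamma> t) * g)) (at t)"
    by (rule R_comp_deriv[OF g reg])
  moreover have "((\<lambda>t. R (?\<gamma> t)) has_vector_derivative w t * (\<i> * of_real h)) (at t)"
    by (rule has_vector_derivative_transform_within_open[OF dw S(1,2)]) (simp add: Rw)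
  ultimately have "w t * (om (?\<gamma> t) * g) = w t * (\<i> * of_real h)"
    using vector_derivative_unique_at Rw[OF S(2)] by metis
  then have "om (?\<gamma> t) * g = \<i> * of_real h" using w[OF S(2)] by auto
  with g show ?thesis by blast
qed

text \<open>The velocity of R is R times an imaginary number, hence orthogonal to R, and the squared
  modulus has derivative 0.\<close>

lemma horiz_arc_norm_R:
  assumes "horiz_arc f P \<gamma> I" "s \<in> I" "t \<in> I"
  shows "norm (R (\<gamma> s)) = norm (R (\<gamma> t))"
proof -
  have "((\<lambda>t. (norm (R (\<gamma> t)))\<^sup>2) has_real_derivative 0) (at t within I)" if t: "t \<in> I" for t
  proof -
    obtain g h where g: "(\<gamma> has_vector_derivative g) (at t)" "om (\<gamma> t) * g = \<i> * of_real h"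
      and reg: "\<gamma> t \<in> regset f P"
      using assms(1) t unfolding horiz_arc_iff by blast
    from R_comp_deriv[OF g(1) reg] g(2)
    have d: "((\<lambda>t. R (\<gamma> t)) has_vector_derivative R (\<gamma> t) * (\<i> * of_real h)) (at t)" by simp
    have "((\<lambda>t. R (\<gamma> t) \<bullet> R (\<gamma> t)) has_derivative (\<lambda>s.
        R (\<gamma> t) \<bullet> (s *\<^sub>R (R (\<gamma> t) * (\<i> * of_real h))) + (s *\<^sub>R (R (\<gamma> t) * (\<i> * of_real h))) \<bullet> R (\<gamma> t))) (at t)"
      using d unfolding has_vector_derivative_def by (intro has_derivative_inner) auto
    also have "(\<lambda>s. R (\<gamma> t) \<bullet> (s *\<^sub>R (R (\<gamma> t) * (\<i> * of_real h))) + (s *\<^sub>R (R (\<gamma> t) * (\<i> * of_real h))) \<bullet> R (\<gamma> t)) = (\<lambda>s. 0 * s)"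
      by (auto simp: inner_complex_def algebra_simps)
    finally show ?thesis
      unfolding has_field_derivative_def dot_square_norm by (rule has_derivative_at_withinI)
  qed
  moreover have "convex I" using assms(1) by (simp add: horiz_arc_def is_interval_convex)
  ultimately have "(norm (R (\<gamma> s)))\<^sup>2 = (norm (R (\<gamma> t)))\<^sup>2"
    using has_field_derivative_zero_constant[of I "\<lambda>t. (norm (R (\<gamma> t)))\<^sup>2"] assms(2,3)
    by (metis (mono_tags, lifting))
  then show ?thesis by simp
qed

text \<open>Maximality without continuation of solutions: an arc that meets T keeps both the modulus
  of R and the invariant \<open>Q\<close>, so it cannot leave T. \<open>Q\<close> singles out one
  component when the level set has several.\<close>

lemma htraj_level_component:
  assumes "horiz_arc f P \<delta> UNIV" and T: "T = {z \<in> regset f P. norm (R z) = \<rho> \<and> Q z}" "range \<delta> = T"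
    and Q: "\<And>\<gamma> I s t. horiz_arc f P \<gamma> I \<Longrightarrow> s \<in> I \<Longrightarrow> t \<in> I \<Longrightarrow> norm (R (\<gamma> s)) = \<rho> \<Longrightarrow> Q (\<gamma> s) \<Longrightarrow> Q (\<gamma> t)"
  shows "htraj f P T"
  unfolding htraj_def
proof (intro exI conjI allI impI)
  show "horiz_arc f P \<delta> UNIV" "T = range \<delta>" using assms by auto
  fix \<gamma> I assume *: "horiz_arc f P \<gamma> I \<and> \<gamma> ` I \<inter> T \<noteq> {}"
  then obtain s where s: "s \<in> I" "\<gamma> s \<in> T" by auto
  show "\<gamma> ` I \<subseteq> T"
  proof
    fix z assume "z \<in> \<gamma> ` I"
    then obtain t where t: "t \<in> I" "z = \<gamma> t" by auto
    have "norm (R (\<gamma> t)) = \<rho>" using horiz_arc_norm_R[OF _ s(1) t(1)] * s(2) T(1) by auto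
    moreover have "Q (\<gamma> t)" using Q[OF _ s(1) t(1)] * s(2) T(1) by auto
    moreover have "\<gamma> t \<in> regset f P" using * t(1) by (auto simp: horiz_arc_def)
    ultimately show "z \<in> T" using T(1) t(2) by auto
  qed
qed

end

section \<open>Annuli obstructing the Strebel property\<close>

lemma one_minus_notin_nonpos: "norm x < 1 \<Longrightarrow> 1 - x \<notin> \<real>\<^sub>\<le>\<^sub>0" for x :: complex
  using complex_Re_le_cmod[of x] by (auto simp: complex_nonpos_Reals_iff)

context double_zero_qd
begin

text \<open>The circle of radius r encloses exactly one branch value of the square root. The root
  therefore changes sign after one turn, so both preimages of each point lie on one curve, which
  closes up after two turns and fills the level set.\<close>

lemma annulus_closed_htraj:
  assumes r: "norm v1 < r" "r < norm v2"
  shows "closed_htraj f P {z \<in> regset f P. norm (R z) = r}"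
proof -
  \<comment> \<open>Here (w - v1) / (w - v2) is split as - (w / v2) times (1 - v1 / w) / (1 - w /
    v2). The last two factors lie within distance 1 of 1, where \<open>csqrt\<close> is holomorphic,
    and the root of w becomes an exponential of half the angle. The variable is complex so that
    differentiability follows from holomorphy.\<close>
  define h where "h = (\<lambda>\<zeta>. csqrt (- of_real r / v2) * exp (\<i> * \<zeta> / 2) *
      csqrt (1 - v1 / of_real r * exp (- \<i> * \<zeta>)) / csqrt (1 - of_real r / v2 * exp (\<i> * \<zeta>)))"
  define u where "u = (\<lambda>t::real. h (of_real t))"
  define w where "w = (\<lambda>t::real. of_real r * exp (\<i> * of_real t))"
  define \<delta> where "\<delta> = (\<lambda>t. of_U (u t))"
  define T where "T = {z \<in> regset f P. norm (R z) = r}"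
  have r0: "r > 0" using r(1) norm_ge_zero[of v1] by linarith
  have nw: "norm (w t) = r" for t using r0 by (simp add: w_def norm_mult)
  have w: "w t \<notin> {v1, v2, 0}" for t using nw[of t] r r0 by auto
  have n1: "norm (v1 / of_real r * exp (- \<i> * of_real t)) < 1" for t
    using r r0 by (simp add: norm_mult norm_divide)
  have n2: "norm (of_real r / v2 * exp (\<i> * of_real t)) < 1" for t
    using r r0 v2_nz by (simp add: norm_mult norm_divide divide_less_eq)
  have u_sq: "(u t)\<^sup>2 = (w t - v1) / (w t - v2)" for t
  proof -
    have e: "(exp (\<i> * of_real t / 2))\<^sup>2 = exp (\<i> * of_real t)"
      by (simp add: exp_double[symmetric])
    have "(u t)\<^sup>2 = (- of_real r / v2) * exp (\<i> * of_real t) *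
        (1 - v1 / of_real r * exp (- \<i> * of_real t)) / (1 - of_real r / v2 * exp (\<i> * of_real t))"
      by (simp add: u_def h_def power_mult_distrib power_divide e)
    also have "\<dots> = (- of_real r * exp (\<i> * of_real t) + v1) / (v2 * (1 - of_real r / v2 * exp (\<i> * of_real t)))"
    proof -
      have "- of_real r / v2 * exp (\<i> * of_real t) * (1 - v1 / of_real r * exp (- \<i> * of_real t))
          = (- of_real r * exp (\<i> * of_real t) + v1) / v2"
        using r0 v2_nz by (simp add: field_simps exp_minus)
      then show ?thesis by simp
    qed
    also have "\<dots> = (v1 - w t) / (v2 - w t)"
      using v2_nz by (simp add: w_def algebra_simps)
    also have "\<dots> = (w t - v1) / (w t - v2)"
      by (metis minus_diff_eq minus_divide_divide)
    finally show ?thesis .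
  qed
  have du: "u differentiable at t" for t
  proof -
    have "h field_differentiable at (of_real t)"
    proof -
      have *: "(\<lambda>\<zeta>. csqrt (1 - x * exp (y * \<zeta>))) field_differentiable at (of_real t)"
        if "norm (x * exp (y * of_real t)) < 1" for x y
      proof -
        have "(\<lambda>\<zeta>. 1 - x * exp (y * \<zeta>)) field_differentiable at (of_real t)"
          by (rule holomorphic_on_imp_differentiable_at[of _ UNIV]) (auto intro!: holomorphic_intros)
        from field_differentiable_compose[OF this field_differentiable_at_csqrt] show ?thesis
          using one_minus_notin_nonpos[OF that] by (simp add: o_def)
      qed
      have e: "(\<lambda>\<zeta>. csqrt (- of_real r / v2) * exp (\<i> * \<zeta> / 2)) field_differentiable at (of_real t)"
        by (rule holomorphic_on_imp_differentiable_at[of _ UNIV]) (auto intro!: holomorphic_intros)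
      have "csqrt (1 - of_real r / v2 * exp (\<i> * of_real t)) \<noteq> 0" using n2[of t] by auto
      then show ?thesis
        unfolding h_def
        by (intro field_differentiable_divide field_differentiable_mult e * n1 n2)
    qed
    then obtain D where "(h has_field_derivative D) (at (of_real t))"
      by (auto simp: field_differentiable_def)
    then have "(u has_vector_derivative D) (at t)"
      unfolding u_def by (rule has_vector_derivative_real_field)
    then show ?thesis by (rule differentiableI_vector)
  qed
  have dw: "(w has_vector_derivative w t * (\<i> * of_real 1)) (at t)" for t
  proof -
    have "((\<lambda>\<zeta>. of_real r * exp (\<i> * \<zeta>)) has_field_derivative of_real r * exp (\<i> * of_real t) * (\<i> * of_real 1)) (at (of_real t))"
      by (rule derivative_eq_intros refl | simp)+
    then show ?thesis unfolding w_def by (rule has_vector_derivative_real_field)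
  qed
  have R\<delta>: "R (\<delta> t) = w t" for t using of_U_level(4)[OF u_sq] w by (auto simp: \<delta>_def)
  have reg: "\<delta> t \<in> regset f P" for t using of_U_regset[OF u_sq] w by (auto simp: \<delta>_def)
  have arc: "horiz_arc f P \<delta> UNIV"
    unfolding horiz_arc_iff
  proof (intro conjI ballI)
    fix t
    show "\<exists>g h. (\<delta> has_vector_derivative g) (at t) \<and> h \<noteq> 0 \<and> om (\<delta> t) * g = \<i> * complex_of_real h"
    proof -
      obtain g where "(\<delta> has_vector_derivative g) (at t)" "om (\<delta> t) * g = \<i> * complex_of_real 1"
        using lift_deriv[of UNIV t u w 1, OF _ _ u_sq w du dw] unfolding \<delta>_def by auto
      then show ?thesis using one_neq_zero by blast
    qed
  qed (use reg in auto)
  \<comment> \<open>A full turn is felt only by the half-angle exponential.\<close>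
  have u_shift: "u (t + 2 * pi) = - u t" for t
  proof -
    have "exp (\<i> * of_real (t + 2 * pi) / 2) = - exp (\<i> * of_real t / 2)"
      by (simp add: exp_add ring_distribs add_divide_distrib)
    moreover have "exp (\<i> * of_real (t + 2 * pi)) = exp (\<i> * of_real t)"
      "exp (- \<i> * of_real (t + 2 * pi)) = exp (- \<i> * of_real t)"
      using exp_two_pi_i by (simp_all add: exp_add exp_diff ring_distribs mult_ac)
    ultimately show ?thesis by (simp add: u_def h_def)
  qed
  have per: "\<delta> (t + 4 * pi) = \<delta> t" for t
    using u_shift[of "t + 2 * pi"] u_shift[of t] by (simp add: \<delta>_def add.assoc)
  have range: "range \<delta> = T"
  proof
    show "range \<delta> \<subseteq> T" using reg nw R\<delta> by (auto simp: T_def)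
    show "T \<subseteq> range \<delta>"
    proof
      fix z assume z: "z \<in> T"
      then have zr: "z \<noteq> c" "z \<noteq> z2" "norm (R z) = r" by (auto simp: T_def regset_eq)
      define t where "t = Arg (R z)"
      have "R z = w t" using zr(3) r0 Arg_eq[of "R z"] by (auto simp: w_def t_def)
      then have "(U z)\<^sup>2 = (u t)\<^sup>2" using U_sq[OF zr(1)] u_sq by simp
      then have "U z = u t \<or> U z = u (t + 2 * pi)" by (simp add: power2_eq_iff u_shift)
      then have "z = \<delta> t \<or> z = \<delta> (t + 2 * pi)" using of_U_U[OF zr(2)] by (auto simp: \<delta>_def)
      then show "z \<in> range \<delta>" by auto
    qed
  qed
  have "htraj f P T"
    by (rule htraj_level_component[OF arc _ range, where Q="\<lambda>_. True"]) (auto simp: T_def)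
  then have "closed_htraj f P T"
    unfolding closed_htraj_def using arc per range
    by (intro conjI exI[of _ \<delta>] exI[of _ "4 * pi"]) auto
  then show ?thesis by (simp add: T_def)
qed

text \<open>Two facts on winding numbers suffice: the value at c is 0, and the values at a and b
  agree. Then exactly one nonzero value is impossible, and so are three nonzero values, which
  excludes a circle around a finite marked point as well as one around infinity.\<close>

lemma not_strebel_if_norm_less:
  assumes less: "norm v1 < norm v2"
  shows "\<not> strebel_P1 f P \<alpha> \<beta>"
proof
  assume "strebel_P1 f P \<alpha> \<beta>"
  define r where "r = (norm v1 + norm v2) / 2"
  have r: "norm v1 < r" "r < norm v2" using less by (auto simp: r_def)
  have "circle_around_marked f P {z \<in> regset f P. norm (R z) = r}"
    using \<open>strebel_P1 f P \<alpha> \<beta>\<close> annulus_closed_htraj[OF r] by (auto simp: strebel_P1_def)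
  then obtain \<gamma> p where \<gamma>: "p > 0" "horiz_arc f P \<gamma> UNIV" "\<And>t. \<gamma> (t + p) = \<gamma> t"
    "{z \<in> regset f P. norm (R z) = r} = range \<gamma>"
    and w: "(\<exists>z\<in>P. winding_number (\<lambda>s. \<gamma> (p * s)) z \<noteq> 0 \<and>
              (\<forall>z'\<in>P - {z}. winding_number (\<lambda>s. \<gamma> (p * s)) z' = 0))
          \<or> (\<forall>z\<in>P. winding_number (\<lambda>s. \<gamma> (p * s)) z \<noteq> 0)"
    unfolding circle_around_marked_def Let_def by auto
  define \<kappa> where "\<kappa> = (\<lambda>s. \<gamma> (p * s))"
  have pk: "path \<kappa>"
    unfolding path_def \<kappa>_def
    by (rule continuous_on_compose2[OF horiz_arc_continuous[OF \<gamma>(2)]]) (auto intro!: continuous_intros)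
  have ck: "pathfinish \<kappa> = pathstart \<kappa>"
    using \<gamma>(3)[of 0] by (simp add: \<kappa>_def pathfinish_def pathstart_def)
  have im: "z \<noteq> c \<and> norm (R z) = r" if "z \<in> path_image \<kappa>" for z
    using that \<gamma>(4) by (auto simp: \<kappa>_def path_image_def regset_eq)

  have wc: "winding_number \<kappa> c = 0"
  proof (rule winding_zero_outside[OF pk ck])
    \<comment> \<open>The ray from c through \<open>z2\<close>, which is reached at s = 1. On it R =
      v2 - x k with x = s + 1 / s - 2 \<ge> 0, so R stays on the half-line that starts at
      \<open>v2\<close> in direction -k.\<close>
    let ?S = "(\<lambda>s. c - of_real s * k) ` {0..}"
    show "connected ?S" by (intro connected_continuous_image continuous_intros) auto
    show "c \<in> ?S" by (auto intro!: image_eqI[of _ _ 0])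
    show "\<not> bounded ?S"
    proof
      assume "bounded ?S"
      then obtain B where B: "norm (c - of_real s * k) \<le> B" if "s \<ge> 0" for s
        by (auto simp: bounded_iff)
      define s where "s = (\<bar>B\<bar> + norm c + 1) / norm k"
      have s: "s \<ge> 0" by (simp add: s_def)
      have "norm (of_real s * k) = \<bar>B\<bar> + norm c + 1"
        using k_nz s by (simp only: norm_mult norm_of_real) (simp add: s_def)
      moreover have "norm (of_real s * k) \<le> norm (c - of_real s * k) + norm c"
        by (metis add.commute norm_minus_commute norm_triangle_sub)
      ultimately show False using B[OF s] by linarith
    qed
    \<comment> \<open>Since v1 = v2 + 4 k has the smaller modulus, k points against v2; moving from
      v2 in direction -k then only increases the modulus.\<close>
    have neg: "Re (v2 * cnj k) < 0"
    proof -
      have "(norm v1)\<^sup>2 < (norm v2)\<^sup>2" using less by (simp add: power_strict_mono)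
      moreover have "(norm v1)\<^sup>2 = (norm v2)\<^sup>2 + 8 * Re (v2 * cnj k) + 16 * (norm k)\<^sup>2"
      proof -
        have "v1 = v2 + 4 * k" by (simp add: v1_def v2_def)
        then show ?thesis by (simp only: cmod_power2) (simp add: power2_eq_square algebra_simps)
      qed
      ultimately show ?thesis using zero_le_power2[of "norm k"] by linarith
    qed
    have "norm (R (c - of_real s * k)) > r" if s: "s > 0" for s
    proof -
      define x where "x = s + 1 / s - 2"
      have x: "x = (s - 1)\<^sup>2 / s" using s by (simp add: x_def field_simps power2_eq_square)
      then have x0: "x \<ge> 0" using s by simp
      have eqR: "R (c - of_real s * k) = v2 - of_real x * k"
      proof -
        define \<sigma> \<xi> where "\<sigma> = complex_of_real s" and "\<xi> = complex_of_real x"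
        have "x * s = (s - 1)\<^sup>2" using s by (simp add: x)
        then have \<xi>: "\<xi> * \<sigma> = (\<sigma> - 1)\<^sup>2"
          unfolding \<xi>_def \<sigma>_def by (metis of_real_1 of_real_diff of_real_mult of_real_power)
        have "(c - \<sigma> * k - a) * (c - \<sigma> * k - b) = \<sigma>\<^sup>2 * k\<^sup>2 - \<sigma> * k * (2 * c - a - b) + (c - a) * (c - b)"
          by (simp add: algebra_simps power2_eq_square)
        also have "\<dots> = - \<sigma> * k * v2 + (\<xi> * \<sigma>) * k\<^sup>2"
          unfolding \<xi> v2_def k_sq[symmetric] by (simp add: algebra_simps power2_eq_square)
        also have "\<dots> = (v2 - \<xi> * k) * (- \<sigma> * k)"
          by (simp add: algebra_simps power2_eq_square)
        finally have "(c - of_real s * k - a) * (c - of_real s * k - b) = (v2 - of_real x * k) * (- of_real s * k)"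
          unfolding \<sigma>_def \<xi>_def .
        then show ?thesis using s k_nz by (simp add: R_def)
      qed
      have eqN: "(norm (v2 - of_real x * k))\<^sup>2 = (norm v2)\<^sup>2 - 2 * (x * Re (v2 * cnj k)) + x\<^sup>2 * (norm k)\<^sup>2"
        by (simp only: cmod_power2) (simp add: power2_eq_square algebra_simps)
      have "x * Re (v2 * cnj k) \<le> 0" using x0 neg by (simp add: mult_nonneg_nonpos)
      moreover have "x\<^sup>2 * (norm k)\<^sup>2 \<ge> 0" by simp
      ultimately have "(norm v2)\<^sup>2 \<le> (norm (R (c - of_real s * k)))\<^sup>2"
        unfolding eqR eqN by linarith
      then have "norm v2 \<le> norm (R (c - of_real s * k))" by (rule power2_le_imp_le) simp
      then show ?thesis using r by simp
    qed
    then show "?S \<inter> path_image \<kappa> = {}"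
      using im by (force simp: less_le)
  qed

  have wab: "winding_number \<kappa> a = winding_number \<kappa> b"
  proof (rule winding_number_eq[OF pk ck])
    \<comment> \<open>The points a and b form the fibre of R over 0 and are therefore opposite in
      the coordinate \<open>U\<close>. The connecting path is the segment between them through u =
      0, that is, through \<open>z1\<close>.\<close>
    let ?S = "(\<lambda>t. of_U (of_real t * U a)) ` {-1..1}"
    have sq: "(U a)\<^sup>2 = v1 / v2" "(U b)\<^sup>2 = v1 / v2"
      using U_sq[of a] U_sq[of b] ac bc by (auto simp: R_def)
    have ne: "a \<noteq> z2" "b \<noteq> z2" using z12_notin by (auto simp: P_def)
    have "U a \<noteq> U b" using of_U_U[OF ne(1)] of_U_U[OF ne(2)] ab by metis
    then have Ub: "U b = - U a" using sq by (metis power2_eq_iff)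
    have nu: "norm ((of_real t * U a)\<^sup>2) = t\<^sup>2 * norm (v1 / v2)" for t :: real
      by (simp only: power_mult_distrib sq norm_mult norm_power norm_of_real power2_abs)
    have small: "norm ((of_real t * U a)\<^sup>2) < 1" and u1: "of_real t * U a \<noteq> 1" and u2: "of_real t * U a \<noteq> -1"
      if t: "t \<in> {-1..1}" for t :: real
    proof -
      have "t\<^sup>2 \<le> 1" using t abs_square_le_1[of t] by auto
      moreover have "norm (v1 / v2) < 1" using less v2_nz by (simp add: norm_divide)
      ultimately have "t\<^sup>2 * norm (v1 / v2) < 1"
        by (meson le_less_trans mult_left_le_one_le norm_ge_zero zero_le_power2)
      then show "norm ((of_real t * U a)\<^sup>2) < 1"
        unfolding nu .
      then show "of_real t * U a \<noteq> 1" "of_real t * U a \<noteq> -1" by auto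
    qed
    show "connected ?S"
      unfolding of_U_def using u1
      by (intro connected_continuous_image continuous_intros) auto
    show "a \<in> ?S" using of_U_U[OF ne(1)] by (auto intro!: image_eqI[of _ _ 1])
    show "b \<in> ?S" using of_U_U[OF ne(2)] Ub by (auto intro!: image_eqI[of _ _ "-1"])
    have "norm (R (of_U (of_real t * U a))) < r" if t: "t \<in> {-1..1}" for t
    proof -
      define u where "u = of_real t * U a"
      define z where "z = of_U u"
      have u: "u \<noteq> 1" "u \<noteq> -1" "norm (u\<^sup>2) < 1" using u1[OF t] u2[OF t] small[OF t] by (auto simp: u_def)
      have zc: "z \<noteq> c" "z \<noteq> z2"
        using of_U_minus_z2[OF u(1)] k_nz u by (auto simp: z_def of_U_def add_eq_0_iff)
      have "R z - v2 \<noteq> 0" using R_eq_v2_iff[OF zc(1)] zc by simp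
      then have "u\<^sup>2 * (R z - v2) = R z - v1"
        using U_sq[OF zc(1)] U_of_U[OF u(1)] by (simp add: z_def)
      moreover have "u\<^sup>2 * v2 = of_real (t\<^sup>2) * v1"
        using sq v2_nz by (simp add: u_def power_mult_distrib)
      \<comment> \<open>In terms of u, R is (v1 - u^2 v2) / (1 - u^2), and u^2 v2 = t^2 v1 on the
        segment. Because the modulus of u^2 is at most t^2, the denominator is at least 1 - t^2, so
        R stays in the disc of radius \<open>norm v1\<close>.\<close>
      ultimately have "R z * (1 - u\<^sup>2) = v1 * of_real (1 - t\<^sup>2)"
        by (simp add: algebra_simps)
      then have "norm (R z) * norm (1 - u\<^sup>2) = norm v1 * \<bar>1 - t\<^sup>2\<bar>"
        by (metis norm_mult norm_of_real)
      also have "\<dots> \<le> norm v1 * norm (1 - u\<^sup>2)"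
      proof (rule mult_left_mono)
        have "norm (u\<^sup>2) = t\<^sup>2 * norm (v1 / v2)"
          unfolding u_def by (rule nu)
        also have "\<dots> \<le> t\<^sup>2 * 1" using less v2_nz by (intro mult_left_mono) (auto simp: norm_divide)
        finally have "1 - t\<^sup>2 \<le> 1 - norm (u\<^sup>2)" by simp
        also have "\<dots> \<le> norm (1 - u\<^sup>2)" by (metis norm_one norm_triangle_ineq2)
        finally show "\<bar>1 - t\<^sup>2\<bar> \<le> norm (1 - u\<^sup>2)"
          using t abs_square_le_1[of t] by auto
      qed auto
      finally have *: "norm (R z) * norm (1 - u\<^sup>2) \<le> norm v1 * norm (1 - u\<^sup>2)" .
      have "u\<^sup>2 \<noteq> 1" using u(3) by (metis less_irrefl norm_one)
      then have "norm (R z) \<le> norm v1" using mult_right_le_imp_le[OF *] by simp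
      then show ?thesis using r by (simp add: z_def u_def)
    qed
    then show "?S \<inter> path_image \<kappa> = {}" using im by force
  qed
  show False using w wc wab ab ac bc unfolding \<kappa>_def[symmetric] P_def by auto
qed

lemma strebel_imp_norm_eq:
  assumes "strebel_P1 f P \<alpha> \<beta>"
  shows "norm v1 = norm v2"
proof -
  \<comment> \<open>Changing the sign of k exchanges the critical values, so the strict inequality
    is excluded in both directions.\<close>
  interpret m: double_zero_qd a b c "-k" f P
    using ab ac bc k_sq P_def f_eq by unfold_locales auto
  have "m.v1 = v2" "m.v2 = v1" by (simp_all add: m.v1_def m.v2_def v1_def v2_def)
  then show ?thesis
    using not_strebel_if_norm_less m.not_strebel_if_norm_less assms by (metis linorder_neqE_linordered_idom)
qed

text \<open>With X = c - a and Y = c - b, equal critical moduli mean that X + Y is perpendicular to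
  k. Squaring (X + Y) \<open>cnj k\<close> eliminates the root and leaves a condition on X
  \<open>cnj Y\<close>, which is a negative real exactly when c lies on the open segment between a
  and b.\<close>

lemma strebel_imp_between:
  assumes "strebel_P1 f P \<alpha> \<beta>"
  shows "Im ((c - a) * cnj (c - b)) = 0" "Re ((c - a) * cnj (c - b)) < 0"
proof -
  define X Y \<rho> where "X = c - a" and "Y = c - b" and "\<rho> = X * cnj Y"
  have nz: "norm X > 0" "norm Y > 0" using ac bc by (auto simp: X_def Y_def)
  have Re0: "Re ((X + Y) * cnj k) = 0"
  proof -
    have v: "v1 = X + Y + 2 * k" "v2 = X + Y - 2 * k" by (auto simp: v1_def v2_def X_def Y_def)
    have "(norm v1)\<^sup>2 - (norm v2)\<^sup>2 = 8 * Re ((X + Y) * cnj k)"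
      unfolding v cmod_power2 by (simp add: power2_eq_square algebra_simps)
    then show ?thesis using strebel_imp_norm_eq[OF assms] by simp
  qed
  define Z where "Z = (X + Y) * cnj k"
  have "Z\<^sup>2 = (X + Y)\<^sup>2 * cnj (X * Y)"
    using k_sq by (simp add: Z_def power_mult_distrib X_def Y_def flip: complex_cnj_power)
  also have "\<dots> = (X * cnj X) * \<rho> + (Y * cnj Y) * cnj \<rho> + 2 * (X * cnj X) * (Y * cnj Y)"
    unfolding \<rho>_def by (simp add: power2_eq_square algebra_simps)
  finally have Z2: "Z\<^sup>2 = of_real ((norm X)\<^sup>2) * \<rho> + of_real ((norm Y)\<^sup>2) * cnj \<rho> + of_real (2 * (norm X)\<^sup>2 * (norm Y)\<^sup>2)"
    unfolding complex_norm_square[symmetric] by (simp add: mult_ac)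
  have "Im (Z\<^sup>2) = 0" "Re (Z\<^sup>2) \<le> 0" using Re0 by (auto simp: Z_def[symmetric] power2_eq_square)
  then have 1: "((norm X)\<^sup>2 - (norm Y)\<^sup>2) * Im \<rho> = 0"
    and 2: "((norm X)\<^sup>2 + (norm Y)\<^sup>2) * Re \<rho> + 2 * (norm X)\<^sup>2 * (norm Y)\<^sup>2 \<le> 0"
    unfolding Z2 by (auto simp: algebra_simps)
  have "((norm X)\<^sup>2 + (norm Y)\<^sup>2) * Re \<rho> < 0"
    using 2 nz by (smt (verit) mult_pos_pos zero_less_power)
  then have neg: "Re \<rho> < 0" by (simp add: mult_less_0_iff add_pos_pos nz) (smt (verit) zero_le_power2)
  \<comment> \<open>If c is equidistant from a and b, the imaginary part carries no information. The
    inequality for the real part then makes -Re \<rho> at least the modulus of \<rho>, which again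
    forces \<rho> to be real.\<close>
  have "Im \<rho> = 0"
  proof (rule ccontr)
    assume im: "Im \<rho> \<noteq> 0"
    then have e: "(norm X)\<^sup>2 = (norm Y)\<^sup>2" using 1 by simp
    have "2 * (norm X)\<^sup>2 * (Re \<rho> + (norm X)\<^sup>2) \<le> 0" using 2 unfolding e[symmetric] by (simp add: algebra_simps)
    then have "(norm X)\<^sup>2 \<le> - Re \<rho>" using nz by (simp add: mult_le_0_iff)
    moreover have "norm \<rho> = (norm X)\<^sup>2" using power2_eq_imp_eq[OF e] by (simp add: \<rho>_def norm_mult power2_eq_square)
    ultimately have "norm \<rho> \<le> - Re \<rho>" by simp
    then have "(norm \<rho>)\<^sup>2 \<le> (- Re \<rho>)\<^sup>2" by (rule power_mono) simp
    then show False using im by (simp add: cmod_power2)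
  qed
  then show "Im ((c - a) * cnj (c - b)) = 0" "Re ((c - a) * cnj (c - b)) < 0"
    using neg by (auto simp: \<rho>_def X_def Y_def)
qed

end

section \<open>Double poles and winding numbers\<close>

text \<open>Squaring s / (z - p) + e leaves the leading coefficient s^2 = 1, and the cross term and
  e^2 amount to a bounded function times 1 / (z - p). Both signs of s occur: at c it is -1.\<close>

lemma double_pole_res_one:
  assumes "e \<midarrow>p\<rightarrow> l" and "s\<^sup>2 = 1"
    and "eventually (\<lambda>z. f z = - (1 / (4 * complex_of_real pi ^ 2)) * (s / (z - p) + e z)\<^sup>2) (at p)"
  shows "double_pole_res f p 1"
proof -
  define G where "G = (\<lambda>z. (1 / (4 * complex_of_real pi ^ 2)) * (2 * s * e z + (e z)\<^sup>2 * (z - p)))"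
  define L where "L = (1 / (4 * complex_of_real pi ^ 2)) * (2 * s * l + l\<^sup>2 * (p - p))"
  define B where "B = norm L + 1"
  have "(G \<longlongrightarrow> L) (at p)"
    unfolding G_def L_def by (intro tendsto_intros assms(1))
  from order_tendstoD(2)[OF tendsto_norm[OF this], of B]
  have B: "eventually (\<lambda>z. norm (G z) \<le> B) (at p)"
    by (auto simp: B_def elim: eventually_mono)
  have "eventually (\<lambda>z. z \<noteq> p) (at p)" by (simp add: eventually_at_filter)
  with B assms(3) have "eventually (\<lambda>z. norm (f z + complex_of_real (1\<^sup>2 / (4 * pi\<^sup>2)) / (z - p)\<^sup>2)
                           \<le> B * norm (1 / (z - p))) (at p)"
  proof eventually_elim
    case (elim z)
    have *: "(s / (z - p) + e z)\<^sup>2 = 1 / (z - p)\<^sup>2 + (2 * s * e z + (e z)\<^sup>2 * (z - p)) / (z - p)"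
    proof -
      define y where "y = 1 / (z - p)"
      have "y * (z - p) = 1" using elim(3) by (simp add: y_def)
      then have "(s * y + e z)\<^sup>2 = y\<^sup>2 + (2 * s * e z + (e z)\<^sup>2 * (z - p)) * y"
        using assms(2) by algebra
      then show ?thesis by (simp add: y_def power_divide)
    qed
    then have "f z + complex_of_real (1\<^sup>2 / (4 * pi\<^sup>2)) / (z - p)\<^sup>2 = - (G z * (1 / (z - p)))"
    proof -
      have "- q * X + q / (z - p)\<^sup>2 = - (q * Y * (1 / (z - p)))"
        if "X = 1 / (z - p)\<^sup>2 + Y / (z - p)" for q X Y
        unfolding that by (simp add: ring_distribs)
      from this[OF *, of "1 / (4 * complex_of_real pi ^ 2)"] show ?thesis
        unfolding elim(2) G_def by simp
    qed
    then have "norm (f z + complex_of_real (1\<^sup>2 / (4 * pi\<^sup>2)) / (z - p)\<^sup>2) = norm (G z) * norm (1 / (z - p))"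
      by (simp only: norm_minus_cancel norm_mult)
    also have "\<dots> \<le> B * norm (1 / (z - p))" by (rule mult_right_mono[OF elim(1)]) simp
    finally show ?case .
  qed
  then show ?thesis unfolding double_pole_res_def by blast
qed

context double_zero_qd
begin

lemma eventually_f: "eventually (\<lambda>z. f z =
    - (1 / (4 * complex_of_real pi ^ 2)) * (1 / (z - a) + 1 / (z - b) - 1 / (z - c))\<^sup>2) (at p)"
proof -
  have "finite P" by (simp add: P_def)
  then have "eventually (\<lambda>z. z \<notin> P) (at p)"
    using islimpt_finite[of P p] by (auto simp: islimpt_iff_eventually)
  then show ?thesis by (rule eventually_mono) (rule f_eq)
qed

lemma double_pole_res_P:
  assumes "p \<in> P"
  shows "double_pole_res f p 1"
proof -
  have "double_pole_res f a 1"
  proof (rule double_pole_res_one)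
    show "(\<lambda>z. 1 / (z - b) - 1 / (z - c)) \<midarrow>a\<rightarrow> 1 / (a - b) - 1 / (a - c)"
      using ab ac by (intro tendsto_intros) auto
    show "\<forall>\<^sub>F z in at a. f z = - (1 / (4 * (complex_of_real pi)\<^sup>2)) * (1 / (z - a) + (1 / (z - b) - 1 / (z - c)))\<^sup>2"
      using eventually_f by eventually_elim (simp add: algebra_simps)
  qed simp
  moreover have "double_pole_res f b 1"
  proof (rule double_pole_res_one)
    show "(\<lambda>z. 1 / (z - a) - 1 / (z - c)) \<midarrow>b\<rightarrow> 1 / (b - a) - 1 / (b - c)"
      using ab bc by (intro tendsto_intros) auto
    show "\<forall>\<^sub>F z in at b. f z = - (1 / (4 * (complex_of_real pi)\<^sup>2)) * (1 / (z - b) + (1 / (z - a) - 1 / (z - c)))\<^sup>2"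
      using eventually_f by eventually_elim (simp add: algebra_simps)
  qed simp
  moreover have "double_pole_res f c 1"
  proof (rule double_pole_res_one)
    show "(\<lambda>z. 1 / (z - a) + 1 / (z - b)) \<midarrow>c\<rightarrow> 1 / (c - a) + 1 / (c - b)"
      using ac bc by (intro tendsto_intros) auto
    show "\<forall>\<^sub>F z in at c. f z = - (1 / (4 * (complex_of_real pi)\<^sup>2)) * ((-1) / (z - c) + (1 / (z - a) + 1 / (z - b)))\<^sup>2"
      using eventually_f by eventually_elim (simp add: algebra_simps)
  qed simp
  ultimately show ?thesis using assms by (auto simp: P_def)
qed

lemma double_pole_res_infinity: "double_pole_res_inf f 1"
proof -
  \<comment> \<open>If one of a, b, c is 0, its reciprocal is 0 by convention and merely repeats the
    excluded point.\<close>
  have fin: "finite {0, 1 / a, 1 / b, 1 / c}" by simp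
  have "\<forall>\<^sub>F w in at 0. w \<notin> {0, 1 / a, 1 / b, 1 / c}"
    using islimpt_finite[OF fin, of 0] by (auto simp: islimpt_iff_eventually)
  \<comment> \<open>Each summand 1 / (1 / w - x) is w + x w^2 / (1 - x w). The leading terms add up
    to w + w - w = w, and division by w^2 turns them into the simple pole 1 / w.\<close>
  then have ev: "\<forall>\<^sub>F w in at 0. f (1 / w) / w ^ 4 = - (1 / (4 * (complex_of_real pi)\<^sup>2)) *
      (1 / (w - 0) + (a / (1 - a * w) + b / (1 - b * w) - c / (1 - c * w)))\<^sup>2"
  proof eventually_elim
    case (elim w)
    have "1 - x * w \<noteq> 0" if "w \<noteq> 1 / x" for x
      using that by (auto simp: eq_divide_eq mult.commute split: if_splits)
    then have w: "w \<noteq> 0" and nz: "1 - a * w \<noteq> 0" "1 - b * w \<noteq> 0" "1 - c * w \<noteq> 0"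
      using elim by auto
    have *: "1 / (1 / w - x) = w / (1 - x * w)" "x / (1 - x * w) = (1 / (1 - x * w) - 1) / w"
      if "1 - x * w \<noteq> 0" for x
    proof -
      have "1 / w - x = (1 - x * w) / w" using w by (simp add: field_simps)
      then show "1 / (1 / w - x) = w / (1 - x * w)" by simp
      show "x / (1 - x * w) = (1 / (1 - x * w) - 1) / w"
        using w that by (simp add: divide_simps)
    qed
    have P: "1 / w \<notin> P" using w nz by (auto simp: P_def field_simps)
    have "1 / (w - 0) + (a / (1 - a * w) + b / (1 - b * w) - c / (1 - c * w))
        = (1 / (1 / w - a) + 1 / (1 / w - b) - 1 / (1 / w - c)) / w\<^sup>2"
      unfolding *[OF nz(1)] *[OF nz(2)] *[OF nz(3)] using w by (simp add: field_simps power2_eq_square)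
    then have "(1 / (w - 0) + (a / (1 - a * w) + b / (1 - b * w) - c / (1 - c * w)))\<^sup>2
        = (1 / (1 / w - a) + 1 / (1 / w - b) - 1 / (1 / w - c))\<^sup>2 / w ^ 4"
      by (simp add: power_divide flip: power_mult)
    then show ?case using f_eq[OF P] by simp
  qed
  have "double_pole_res (\<lambda>w. f (1 / w) / w ^ 4) 0 1"
  proof (rule double_pole_res_one[OF _ _ ev])
    show "(\<lambda>w. a / (1 - a * w) + b / (1 - b * w) - c / (1 - c * w)) \<midarrow>0\<rightarrow>
        a / (1 - a * 0) + b / (1 - b * 0) - c / (1 - c * 0)"
      by (intro tendsto_intros) simp_all
  qed simp
  then show ?thesis by (simp add: double_pole_res_def double_pole_res_inf_def)
qed

lemma f_holomorphic: "f holomorphic_on (- P)"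
proof (rule holomorphic_transform)
  show "(\<lambda>z. - (1 / (4 * complex_of_real pi ^ 2)) * (1 / (z - a) + 1 / (z - b) - 1 / (z - c))\<^sup>2)
      holomorphic_on (- P)"
    by (intro holomorphic_intros) (auto simp: P_def)
qed (simp add: f_eq)

text \<open>The argument principle for R: its image runs once around 0, so the integral of the
  logarithmic derivative \<open>om\<close> is 2 pi i, while the residues of \<open>om\<close> at a,
  b, c are 1, 1, -1.\<close>

lemma winding_sum:
  assumes arc: "horiz_arc f P \<delta> UNIV" and per: "\<And>t. \<delta> (t + 2 * pi) = \<delta> t"
    and R: "\<And>t. R (\<delta> t) = of_real \<rho> * exp (\<i> * of_real t)" and \<rho>: "\<rho> > 0"
  defines "\<kappa> \<equiv> \<lambda>s. \<delta> (2 * pi * s)"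
  shows "valid_path \<kappa>" "pathfinish \<kappa> = pathstart \<kappa>"
    and "winding_number \<kappa> a + winding_number \<kappa> b - winding_number \<kappa> c = 1"
proof -
  have reg: "\<delta> t \<in> regset f P" for t using arc by (auto simp: horiz_arc_iff)
  have om_nz: "om (\<delta> t) \<noteq> 0" for t
  proof -
    obtain g h where "h \<noteq> 0" "om (\<delta> t) * g = \<i> * complex_of_real h"
      using arc unfolding horiz_arc_iff by blast
    then show ?thesis by auto
  qed
  \<comment> \<open>A horizontal arc is only assumed differentiable pointwise. Solving for the
    velocity shows that it is \<i> / \<open>om\<close>, hence continuous, as contour integration
    requires.\<close>
  have d: "(\<delta> has_vector_derivative \<i> / om (\<delta> t)) (at t)" for t
  proof -
    obtain g where g: "(\<delta> has_vector_derivative g) (at t)" using arc by (auto simp: horiz_arc_iff)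
    have "((\<lambda>\<zeta>. of_real \<rho> * exp (\<i> * \<zeta>)) has_field_derivative of_real \<rho> * exp (\<i> * of_real t) * \<i>) (at (of_real t))"
      by (rule derivative_eq_intros refl | simp)+
    then have "((\<lambda>t. R (\<delta> t)) has_vector_derivative R (\<delta> t) * \<i>) (at t)"
      unfolding R by (rule has_vector_derivative_real_field)
    from vector_derivative_unique_at[OF R_comp_deriv[OF g reg] this]
    have "R (\<delta> t) * (om (\<delta> t) * g) = R (\<delta> t) * \<i>" .
    moreover have "R (\<delta> t) \<noteq> 0" using R[of t] \<rho> by simp
    ultimately have "om (\<delta> t) * g = \<i>" by simp
    then have "g = \<i> / om (\<delta> t)" using om_nz[of t] by (simp add: field_simps)
    then show ?thesis using g by simp
  qed
  have dk: "(\<kappa> has_vector_derivative (2 * pi) *\<^sub>R (\<i> / om (\<kappa> s))) (at s)" for s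
  proof -
    have "((\<lambda>s. 2 * pi * s) has_vector_derivative 2 * pi) (at s)"
      by (auto intro!: derivative_eq_intros simp: has_real_derivative_iff_has_vector_derivative[symmetric])
    from vector_diff_chain_at[OF this d] show ?thesis by (simp add: \<kappa>_def o_def)
  qed
  have ck: "continuous_on UNIV \<kappa>"
    using dk by (intro continuous_at_imp_continuous_on) (auto intro: has_vector_derivative_continuous)
  have nz: "\<kappa> s \<noteq> a" "\<kappa> s \<noteq> b" "\<kappa> s \<noteq> c" for s
    using reg[of "2 * pi * s"] by (auto simp: \<kappa>_def regset_eq)
  have cd: "continuous_on UNIV (\<lambda>s. (2 * pi) *\<^sub>R (\<i> / om (\<kappa> s)))"
    using om_nz nz unfolding om_def[abs_def] by (intro continuous_intros ck) (auto simp: \<kappa>_def om_def)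
  show vp: "valid_path \<kappa>"
    unfolding valid_path_def
    by (rule C1_differentiable_imp_piecewise)
      (auto simp: C1_differentiable_on_def intro!: exI[of _ "\<lambda>s. (2 * pi) *\<^sub>R (\<i> / om (\<kappa> s))"]
        dk continuous_on_subset[OF cd])
  show "pathfinish \<kappa> = pathstart \<kappa>"
    using per[of 0] by (simp add: \<kappa>_def pathfinish_def pathstart_def)
  have im: "a \<notin> path_image \<kappa>" "b \<notin> path_image \<kappa>" "c \<notin> path_image \<kappa>"
    using nz by (auto simp: path_image_def)
  have "((\<lambda>z. 1 / (z - a) + 1 / (z - b) - 1 / (z - c)) has_contour_integral
      (2 * pi * \<i> * winding_number \<kappa> a + 2 * pi * \<i> * winding_number \<kappa> b - 2 * pi * \<i> * winding_number \<kappa> c)) \<kappa>"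
    by (intro has_contour_integral_add has_contour_integral_diff has_contour_integral_winding_number vp im)
  moreover have "(om has_contour_integral 2 * pi * \<i>) \<kappa>"
  proof -
    have "((\<lambda>x. complex_of_real (2 * pi) * \<i>) has_integral complex_of_real (2 * pi) * \<i>) {0..1::real}"
      using has_integral_const_real[of "complex_of_real (2 * pi) * \<i>" 0 1] by simp
    moreover have "om (\<kappa> s) * vector_derivative \<kappa> (at s) = complex_of_real (2 * pi) * \<i>" for s
      using vector_derivative_at[OF dk[of s]] om_nz[of "2 * pi * s"]
      by (simp add: \<kappa>_def scaleR_conv_of_real)
    ultimately show ?thesis unfolding has_contour_integral by simp
  qed
  ultimately have "2 * pi * \<i> * winding_number \<kappa> a + 2 * pi * \<i> * winding_number \<kappa> b - 2 * pi * \<i> * winding_number \<kappa> c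
      = 2 * pi * \<i>"
    unfolding om_def[abs_def] by (rule has_contour_integral_unique)
  then have "(2 * pi * \<i>) * (winding_number \<kappa> a + winding_number \<kappa> b - winding_number \<kappa> c) = (2 * pi * \<i>) * 1"
    by (simp add: algebra_simps)
  then show "winding_number \<kappa> a + winding_number \<kappa> b - winding_number \<kappa> c = 1"
    by (simp only: mult_cancel_left) simp
qed

end

section \<open>Real marked points: level curves\<close>

locale collinear_qd =
  fixes ra rc rb :: real and f :: "complex \<Rightarrow> complex" and P :: "complex set"
  assumes ac_less: "ra < rc" and cb_less: "rc < rb"
    and P_eq: "P = {of_real ra, of_real rb, of_real rc}"
    and f_formula: "\<And>z. z \<notin> P \<Longrightarrow> f z = - (1 / (4 * complex_of_real pi ^ 2)) *
      (1 / (z - of_real ra) + 1 / (z - of_real rb) - 1 / (z - of_real rc))\<^sup>2"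
begin

definition A where "A = rc - ra"
definition B where "B = rb - rc"
definition S where "S = rb - ra"
text \<open>The argument of the critical value \<open>v1\<close>, whose real part is A - B and whose
  modulus is S.\<close>

definition phi where "phi = arccos ((A - B) / S)"

lemma pos: "A > 0" "B > 0" "S > 0" and S_eq: "S = A + B"
  using ac_less cb_less by (auto simp: A_def B_def S_def)

text \<open>Now (c - a)(c - b) = - A B is negative, so k is imaginary and the two zeros are complex
  conjugate, with \<open>z1\<close> in the upper half plane.\<close>

sublocale double_zero_qd "of_real ra" "of_real rb" "of_real rc" "\<i> * of_real (sqrt (A * B))" f P
proof
  have "(\<i> * complex_of_real (sqrt (A * B)))\<^sup>2 = of_real (- ((sqrt (A * B))\<^sup>2))"
    by (simp add: power_mult_distrib)
  also have "\<dots> = of_real (- (A * B))" using pos by simp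
  finally show "(\<i> * complex_of_real (sqrt (A * B)))\<^sup>2 = (of_real rc - of_real ra) * (of_real rc - of_real rb)"
    by (simp add: A_def B_def algebra_simps)
qed (use ac_less cb_less P_eq f_formula in auto)

section \<open>Critical values on one circle, and the quadrants of V\<close>

lemma cos_phi: "cos phi = (A - B) / S" and phi_bounds: "0 < phi" "phi < pi"
proof -
  have "-1 < (A - B) / S" "(A - B) / S < 1" using pos S_eq by (auto simp: field_simps)
  then show "cos phi = (A - B) / S" "0 < phi" "phi < pi"
    using arccos_lt_bounded[of "(A - B) / S"] by (auto simp: phi_def)
qed

lemma sin_phi_pos: "sin phi > 0"
  using phi_bounds by (rule sin_gt_zero)

lemma cos_half: "cos (phi / 2) = sqrt (A / S)" and sin_half: "sin (phi / 2) = sqrt (B / S)"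
proof -
  have *: "cos (phi / 2) > 0" "sin (phi / 2) > 0"
    using phi_bounds by (auto intro!: cos_gt_zero sin_gt_zero)
  have "(cos (phi / 2))\<^sup>2 = A / S"
    using cos_double_cos[of "phi / 2"] pos S_eq by (simp add: cos_phi field_simps)
  then show "cos (phi / 2) = sqrt (A / S)" using * by (metis less_imp_le real_sqrt_unique)
  have "(sin (phi / 2))\<^sup>2 = B / S"
    using cos_double_sin[of "phi / 2"] pos S_eq by (simp add: cos_phi field_simps)
  then show "sin (phi / 2) = sqrt (B / S)" using * by (metis less_imp_le real_sqrt_unique)
qed

lemma sin_phi: "S * sin phi = 2 * sqrt (A * B)"
proof -
  have "sin phi = 2 * sin (phi / 2) * cos (phi / 2)" using sin_double[of "phi / 2"] by simp
  also have "\<dots> = 2 * sqrt (A * B) / S"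
    using pos by (simp add: cos_half sin_half real_sqrt_mult real_sqrt_divide)
  finally show ?thesis using pos by simp
qed

lemma v1_eq: "v1 = of_real S * cis phi" and v2_eq: "v2 = of_real S * cis (- phi)"
proof -
  have "S * cos phi = A - B" using pos by (simp add: cos_phi)
  moreover have "2 * rc - ra - rb = A - B" by (simp add: A_def B_def)
  ultimately show "v1 = of_real S * cis phi" "v2 = of_real S * cis (- phi)"
    unfolding v1_def v2_def using sin_phi by (simp_all add: complex_eq_iff)
qed

lemma norm_v: "norm v1 = S" "norm v2 = S"
  using pos by (simp_all add: v1_eq v2_eq norm_mult)

text \<open>The Moebius map with zero \<open>v1\<close> and pole \<open>v2\<close>, rotated so that
  the circle of radius S through them goes to the real line and its interior to the upper half
  plane.\<close>

definition zt :: "complex \<Rightarrow> complex" where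
  "zt w = cis (- phi) * ((w - v1) / (w - v2))"

lemma Im_zt: "w \<noteq> v2 \<Longrightarrow> Im (zt w) * (norm (w - v2))\<^sup>2 = sin phi * (S\<^sup>2 - (norm w)\<^sup>2)"
proof -
  assume w: "w \<noteq> v2"
  have "zt w * of_real ((norm (w - v2))\<^sup>2) = cis (- phi) * (w - v1) * cnj (w - v2)"
    using w unfolding zt_def complex_norm_square by (simp add: field_simps)
  also have "Im \<dots> = sin phi * (S\<^sup>2 - (norm w)\<^sup>2)"
  proof -
    have "cis (- phi) * (w - v1) * cnj (w - v2) = cis (- phi) * (w * cnj w)
      - of_real S * (w * (cis phi * cis (-phi))) - of_real S * (cis phi * cis (- phi)) * cnj w
      + of_real (S\<^sup>2) * (cis phi * cis (- phi)) * cis phi"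
      by (simp add: v1_eq v2_eq cis_cnj algebra_simps power2_eq_square del: cis_mult)
    also have "\<dots> = cis (- phi) * of_real ((norm w)\<^sup>2) - of_real S * (w + cnj w) + of_real (S\<^sup>2) * cis phi"
      unfolding complex_norm_square by (simp add: cis_mult algebra_simps)
    also have "Im \<dots> = sin phi * (S\<^sup>2 - (norm w)\<^sup>2)" by (simp add: algebra_simps)
    finally show ?thesis .
  qed
  finally show ?thesis by simp
qed

definition V :: "complex \<Rightarrow> complex" where "V z = cis (- (phi / 2)) * U z"

lemma V_sq: "z \<noteq> of_real rc \<Longrightarrow> (V z)\<^sup>2 = zt (R z)"
  by (simp add: V_def zt_def power_mult_distrib U_sq power2_eq_square[of "cis _"] cis_mult)

lemma U_V: "U z = cis (phi / 2) * V z"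
  by (simp add: V_def cis_mult flip: mult.assoc)

text \<open>V is a Moebius map, so the preimages of the coordinate axes lie on circles: one centred
  at rb with squared radius B S, the other centred at ra with squared radius A S. This bounds the
  critical level by two null sets and makes the signs of the coordinates of V readable at real
  points.\<close>

lemma
  assumes "z \<noteq> z2"
  shows Re_V: "Re (V z) * (norm (z - z2))\<^sup>2 = sqrt (A / S) * ((norm (z - of_real rb))\<^sup>2 - B * S)"
    and Im_V: "Im (V z) * (norm (z - z2))\<^sup>2 = - sqrt (B / S) * ((norm (z - of_real ra))\<^sup>2 - A * S)"
proof -
  define \<kappa> where "\<kappa> = sqrt (A * B)"
  define x y where "x = Re z - rc" and "y = Im z"
  have "V z * of_real ((norm (z - z2))\<^sup>2) = cis (- (phi / 2)) * ((z - z1) * cnj (z - z2))"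
    using assms unfolding V_def U_def complex_norm_square by (simp add: field_simps)
  also have "(z - z1) * cnj (z - z2) = Complex (x\<^sup>2 + y\<^sup>2 - \<kappa>\<^sup>2) (- 2 * \<kappa> * x)"
    unfolding z1_def z2_def unfolding \<kappa>_def[symmetric]
    by (simp add: complex_eq_iff x_def y_def power2_eq_square algebra_simps)
  finally have "V z * of_real ((norm (z - z2))\<^sup>2) = cis (- (phi / 2)) * Complex (x\<^sup>2 + y\<^sup>2 - \<kappa>\<^sup>2) (- 2 * \<kappa> * x)" .
  then have eq: "Re (V z) * (norm (z - z2))\<^sup>2 = cos (phi / 2) * (x\<^sup>2 + y\<^sup>2 - \<kappa>\<^sup>2) - sin (phi / 2) * (2 * \<kappa> * x)"
    "Im (V z) * (norm (z - z2))\<^sup>2 = - sin (phi / 2) * (x\<^sup>2 + y\<^sup>2 - \<kappa>\<^sup>2) - cos (phi / 2) * (2 * \<kappa> * x)"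
    by (simp_all add: complex_eq_iff)
  have k2: "\<kappa>\<^sup>2 = A * B" using pos by (simp add: \<kappa>_def)
  have s: "sin (phi / 2) * \<kappa> = sqrt (A / S) * B" "cos (phi / 2) * \<kappa> = sqrt (B / S) * A"
    using pos by (simp_all add: sin_half cos_half \<kappa>_def real_sqrt_mult real_sqrt_divide)
  have "Re (V z) * (norm (z - z2))\<^sup>2 = cos (phi / 2) * (x\<^sup>2 + y\<^sup>2 - \<kappa>\<^sup>2) - (sin (phi / 2) * \<kappa>) * (2 * x)"
    unfolding eq by (simp add: algebra_simps)
  also have "\<dots> = sqrt (A / S) * (x\<^sup>2 + y\<^sup>2 - A * B - 2 * B * x)"
    unfolding s k2 cos_half by (simp add: algebra_simps)
  also have "x\<^sup>2 + y\<^sup>2 - A * B - 2 * B * x = (norm (z - of_real rb))\<^sup>2 - B * S"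
    unfolding cmod_power2 S_eq by (simp add: x_def y_def B_def power2_eq_square algebra_simps)
  finally show "Re (V z) * (norm (z - z2))\<^sup>2 = sqrt (A / S) * ((norm (z - of_real rb))\<^sup>2 - B * S)" .
  have "Im (V z) * (norm (z - z2))\<^sup>2 = - sin (phi / 2) * (x\<^sup>2 + y\<^sup>2 - \<kappa>\<^sup>2) - (cos (phi / 2) * \<kappa>) * (2 * x)"
    unfolding eq by (simp add: algebra_simps)
  also have "\<dots> = - sqrt (B / S) * (x\<^sup>2 + y\<^sup>2 - A * B + 2 * A * x)"
    unfolding s k2 sin_half by (simp add: algebra_simps)
  also have "x\<^sup>2 + y\<^sup>2 - A * B + 2 * A * x = (norm (z - of_real ra))\<^sup>2 - A * S"
    unfolding cmod_power2 S_eq by (simp add: x_def y_def A_def power2_eq_square algebra_simps)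
  finally show "Im (V z) * (norm (z - z2))\<^sup>2 = - sqrt (B / S) * ((norm (z - of_real ra))\<^sup>2 - A * S)" .
qed

lemma Re_V_pos_iff: "z \<noteq> z2 \<Longrightarrow> Re (V z) > 0 \<longleftrightarrow> (norm (z - of_real rb))\<^sup>2 > B * S"
  and Re_V_neg_iff: "z \<noteq> z2 \<Longrightarrow> Re (V z) < 0 \<longleftrightarrow> (norm (z - of_real rb))\<^sup>2 < B * S"
  and Im_V_pos_iff: "z \<noteq> z2 \<Longrightarrow> Im (V z) > 0 \<longleftrightarrow> (norm (z - of_real ra))\<^sup>2 < A * S"
  and Im_V_neg_iff: "z \<noteq> z2 \<Longrightarrow> Im (V z) < 0 \<longleftrightarrow> (norm (z - of_real ra))\<^sup>2 > A * S"
proof -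
  assume z: "z \<noteq> z2"
  have *: "0 < x \<longleftrightarrow> 0 < y" "x < 0 \<longleftrightarrow> y < 0" if "x * n = s * y" "n > 0" "s > 0" for x n s y :: real
    using that by (metis mult_less_0_iff zero_less_mult_iff less_asym)+
  have n: "(norm (z - z2))\<^sup>2 > 0" and s: "sqrt (A / S) > 0" "sqrt (B / S) > 0" using z pos by auto
  from *[OF Re_V[OF z] n s(1)]
  show "Re (V z) > 0 \<longleftrightarrow> (norm (z - of_real rb))\<^sup>2 > B * S"
       "Re (V z) < 0 \<longleftrightarrow> (norm (z - of_real rb))\<^sup>2 < B * S" by auto
  have "(- Im (V z)) * (norm (z - z2))\<^sup>2 = sqrt (B / S) * ((norm (z - of_real ra))\<^sup>2 - A * S)"
    using Im_V[OF z] by simp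
  from *[OF this n s(2)]
  show "Im (V z) > 0 \<longleftrightarrow> (norm (z - of_real ra))\<^sup>2 < A * S"
       "Im (V z) < 0 \<longleftrightarrow> (norm (z - of_real ra))\<^sup>2 > A * S" by auto
qed

lemma regset_notin: "z \<in> regset f P \<Longrightarrow> z \<noteq> of_real rc \<and> z \<noteq> z1 \<and> z \<noteq> z2 \<and> R z \<noteq> v1 \<and> R z \<noteq> v2 \<and> R z \<noteq> 0"
  using R_eq_v1_iff[of z] R_eq_v2_iff[of z] R_eq_0_iff[of z] by (auto simp: regset_eq)

text \<open>Twice the product of the coordinates of V is the imaginary part of
  \<open>zt (R z)\<close>, whose sign says on which side of the critical circle R lies. The first
  and third quadrants are thus the discs around ra and rb, the second and fourth those around rc and
  infinity.\<close>

lemma V_quadrant: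
  assumes "z \<in> regset f P"
  shows "Re (V z) * Im (V z) > 0 \<longleftrightarrow> norm (R z) < S"
    and "Re (V z) * Im (V z) < 0 \<longleftrightarrow> norm (R z) > S"
    and "Re (V z) * Im (V z) = 0 \<longleftrightarrow> norm (R z) = S"
proof -
  note n = regset_notin[OF assms]
  define q where "q = Re (V z) * Im (V z)"
  have "Im (zt (R z)) = 2 * q" using arg_cong[OF V_sq[of z], of Im] n by (simp add: q_def Im_power2)
  then have q: "2 * q * (norm (R z - v2))\<^sup>2 = sin phi * (S\<^sup>2 - (norm (R z))\<^sup>2)"
    using Im_zt[of "R z"] n by simp
  have p: "(norm (R z - v2))\<^sup>2 > 0" using n by simp
  have "0 < q \<longleftrightarrow> 0 < 2 * q * (norm (R z - v2))\<^sup>2" "q < 0 \<longleftrightarrow> 2 * q * (norm (R z - v2))\<^sup>2 < 0"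
    using p by (auto simp: zero_less_mult_iff mult_less_0_iff)
  moreover have "x\<^sup>2 < y\<^sup>2 \<longleftrightarrow> x < y" if "x \<ge> 0" "y \<ge> 0" for x y :: real
    using power_mono_iff[of y x 2] that by (simp add: not_le[symmetric])
  from this[of "norm (R z)" S] this[of S "norm (R z)"]
  have "0 < sin phi * (S\<^sup>2 - (norm (R z))\<^sup>2) \<longleftrightarrow> norm (R z) < S"
    "sin phi * (S\<^sup>2 - (norm (R z))\<^sup>2) < 0 \<longleftrightarrow> S < norm (R z)"
    using sin_phi_pos pos by (simp_all add: zero_less_mult_iff mult_less_0_iff)
  ultimately show "Re (V z) * Im (V z) > 0 \<longleftrightarrow> norm (R z) < S"
    "Re (V z) * Im (V z) < 0 \<longleftrightarrow> norm (R z) > S"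
    "Re (V z) * Im (V z) = 0 \<longleftrightarrow> norm (R z) = S"
    using q unfolding q_def[symmetric] by (simp_all, linarith)
qed

lemma V_continuous:
  assumes "horiz_arc f P \<gamma> I"
  shows "continuous_on I (\<lambda>t. V (\<gamma> t))"
  unfolding V_def U_def using assms
  by (intro continuous_intros horiz_arc_continuous[OF assms]) (auto simp: horiz_arc_def regset_eq)

text \<open>Off the critical modulus a level set meets two opposite quadrants of V, one component in
  each; the sign of Re V tells them apart.\<close>

definition level :: "real \<Rightarrow> real \<Rightarrow> complex set" where
  "level \<rho> \<sigma> = {z \<in> regset f P. norm (R z) = \<rho> \<and> \<sigma> * Re (V z) > 0}"

text \<open>A change of sign would produce a point with Re V = 0, and such points lie on the
  critical level.\<close>

lemma horiz_arc_side:
  assumes arc: "horiz_arc f P \<gamma> I" and st: "s \<in> I" "t \<in> I"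
    and ne: "norm (R (\<gamma> s)) \<noteq> S" and "\<sigma> * Re (V (\<gamma> s)) > 0"
  shows "\<sigma> * Re (V (\<gamma> t)) > 0"
proof (rule ccontr)
  assume *: "\<not> \<sigma> * Re (V (\<gamma> t)) > 0"
  have "continuous_on I (\<lambda>t. \<sigma> * Re (V (\<gamma> t)))"
    by (intro continuous_intros V_continuous[OF arc])
  moreover have "connected I" using arc by (simp add: horiz_arc_def is_interval_connected)
  ultimately have "connected ((\<lambda>t. \<sigma> * Re (V (\<gamma> t))) ` I)" by (rule connected_continuous_image)
  from connectedD_interval[OF this imageI[OF st(2)] imageI[OF st(1)], of 0]
  have "0 \<in> (\<lambda>t. \<sigma> * Re (V (\<gamma> t))) ` I" using * assms(5) by linarith
  then obtain x where x: "0 = \<sigma> * Re (V (\<gamma> x))" "x \<in> I" by (rule imageE)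
  moreover have "\<sigma> \<noteq> 0" using assms(5) by auto
  ultimately have "Re (V (\<gamma> x)) = 0" by simp
  then have "Re (V (\<gamma> x)) * Im (V (\<gamma> x)) = 0" by simp
  moreover have "\<gamma> x \<in> regset f P" using arc x(2) by (auto simp: horiz_arc_def)
  ultimately have "norm (R (\<gamma> x)) = S" using V_quadrant(3) by blast
  then show False using horiz_arc_norm_R[OF arc st(1) x(2)] ne by simp
qed

text \<open>A circle of radius other than S misses the critical circle, so \<open>zt\<close> stays
  off the real line along it and the principal root is smooth and single valued. Each lift therefore
  closes up after one turn, and the two signs of the root give the two components.\<close>

lemma level_param:
  assumes \<rho>: "\<rho> > 0" "\<rho> \<noteq> S" and \<sigma>: "\<sigma> = 1 \<or> \<sigma> = -1"
  obtains \<delta> where "horiz_arc f P \<delta> UNIV" "\<And>t. \<delta> (t + 2 * pi) = \<delta> t"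
    "\<And>t. R (\<delta> t) = of_real \<rho> * exp (\<i> * of_real t)" "range \<delta> = level \<rho> \<sigma>"
proof -
  define w where "w = (\<lambda>t::real. of_real \<rho> * exp (\<i> * of_real t))"
  define u where "u = (\<lambda>t. cis (phi / 2) * (of_real \<sigma> * csqrt (zt (w t))))"
  define \<delta> where "\<delta> = (\<lambda>t. of_U (u t))"
  have nw: "norm (w t) = \<rho>" for t using \<rho> by (simp add: w_def norm_mult)
  have w: "w t \<notin> {v1, v2, 0}" for t using nw[of t] \<rho> norm_v by auto
  have \<sigma>2: "of_real \<sigma> * (of_real \<sigma>) = (1::complex)" using \<sigma> by auto
  have Im0: "Im (zt (w t)) \<noteq> 0" for t
  proof
    assume "Im (zt (w t)) = 0"
    then have "sin phi * (S\<^sup>2 - \<rho>\<^sup>2) = 0" using Im_zt[of "w t"] w nw[of t] by auto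
    then have "S\<^sup>2 = \<rho>\<^sup>2" using sin_phi_pos by simp
    then show False using \<rho> pos by (simp add: power2_eq_iff)
  qed
  have u_sq: "(u t)\<^sup>2 = (w t - v1) / (w t - v2)" for t
  proof -
    have "(u t)\<^sup>2 = (cis (phi / 2) * cis (phi / 2)) * (of_real \<sigma> * of_real \<sigma>) * (csqrt (zt (w t)))\<^sup>2"
      unfolding u_def by (simp add: power2_eq_square mult_ac)
    also have "\<dots> = cis phi * zt (w t)" by (simp add: \<sigma>2 cis_mult)
    also have "\<dots> = (w t - v1) / (w t - v2)" by (simp add: zt_def cis_mult flip: mult.assoc)
    finally show ?thesis .
  qed
  have dw': "((\<lambda>\<zeta>. of_real \<rho> * exp (\<i> * \<zeta>)) has_field_derivative of_real \<rho> * exp (\<i> * of_real t) * (\<i> * of_real 1)) (at (of_real t))" for t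
    by (rule derivative_eq_intros refl | simp)+
  have dw: "(w has_vector_derivative w t * (\<i> * of_real 1)) (at t)" for t
    unfolding w_def by (rule has_vector_derivative_real_field[OF dw'])
  have du: "u differentiable at t" for t
  proof -
    have "zt field_differentiable at (w t)"
      unfolding zt_def[abs_def] using w[of t] by (intro derivative_intros) auto
    moreover have "csqrt field_differentiable at (zt (w t))"
      using Im0[of t] by (intro field_differentiable_at_csqrt) (auto simp: complex_nonpos_Reals_iff)
    ultimately have "(csqrt \<circ> zt) field_differentiable at (w t)"
      by (rule field_differentiable_compose)
    then obtain D where "((csqrt \<circ> zt) has_field_derivative D) (at (w t))"
      by (auto simp: field_differentiable_def)
    from field_vector_diff_chain_at[OF dw this]
    have "(\<lambda>t. csqrt (zt (w t))) differentiable at t"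
      by (auto simp: o_def intro: differentiableI_vector)
    then show ?thesis unfolding u_def by (intro differentiable_mult) auto
  qed
  have R\<delta>: "R (\<delta> t) = w t" for t using of_U_level(4)[OF u_sq] w by (auto simp: \<delta>_def)
  have reg: "\<delta> t \<in> regset f P" for t using of_U_regset[OF u_sq] w by (auto simp: \<delta>_def)
  have arc: "horiz_arc f P \<delta> UNIV"
    unfolding horiz_arc_iff
  proof (intro conjI ballI)
    fix t
    obtain g where "(\<delta> has_vector_derivative g) (at t)" "om (\<delta> t) * g = \<i> * complex_of_real 1"
      using lift_deriv[of UNIV t u w 1, OF _ _ u_sq w du dw] unfolding \<delta>_def by auto
    then show "\<exists>g h. (\<delta> has_vector_derivative g) (at t) \<and> h \<noteq> 0 \<and> om (\<delta> t) * g = \<i> * complex_of_real h"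
      using one_neq_zero by blast
  qed (use reg in auto)
  have "exp (\<i> * of_real (t + 2 * pi)) = exp (\<i> * of_real t)" for t
    using exp_two_pi_i by (simp add: exp_add ring_distribs mult_ac)
  then have per: "\<delta> (t + 2 * pi) = \<delta> t" for t by (simp add: \<delta>_def u_def w_def)
  have Re_csqrt: "Re (csqrt (zt (w t))) > 0" for t
  proof -
    have "Re (csqrt (zt (w t))) \<noteq> 0"
    proof
      assume "Re (csqrt (zt (w t))) = 0"
      moreover have "Im (zt (w t)) = 2 * Re (csqrt (zt (w t))) * Im (csqrt (zt (w t)))"
        using Im_power2[of "csqrt (zt (w t))"] by (simp only: power2_csqrt)
      ultimately have "Im (zt (w t)) = 0" by (simp only: mult_zero_left mult_zero_right)
      then show False using Im0[of t] by simp
    qed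
    then show ?thesis using csqrt_principal[of "zt (w t)"] by blast
  qed
  have V\<delta>: "V (\<delta> t) = of_real \<sigma> * csqrt (zt (w t))" for t
  proof -
    have "U (\<delta> t) = u t" unfolding \<delta>_def using of_U_level(1)[OF u_sq] w by (intro U_of_U) auto
    then show ?thesis by (simp add: V_def u_def cis_mult flip: mult.assoc)
  qed
  have "range \<delta> = level \<rho> \<sigma>"
  proof
    have aux: "\<sigma> * Re (of_real \<sigma> * X) = Re X" for X using \<sigma> by auto
    have "0 < \<sigma> * Re (V (\<delta> t))" for t unfolding V\<delta> aux by (rule Re_csqrt)
    then show "range \<delta> \<subseteq> level \<rho> \<sigma>" using reg R\<delta> nw by (auto simp: level_def)
    show "level \<rho> \<sigma> \<subseteq> range \<delta>"
    proof
      fix z assume "z \<in> level \<rho> \<sigma>"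
      then have z: "z \<in> regset f P" "norm (R z) = \<rho>" "\<sigma> * Re (V z) > 0" by (auto simp: level_def)
      note n = regset_notin[OF z(1)]
      define t where "t = Arg (R z)"
      have Rz: "R z = w t" using z(2) \<rho> Arg_eq[of "R z"] by (auto simp: w_def t_def)
      then have "(V z)\<^sup>2 = (V (\<delta> t))\<^sup>2"
        using V_sq[of z] V_sq[of "\<delta> t"] n regset_notin[OF reg[of t]] R\<delta>[of t] by simp
      moreover have "V z \<noteq> - V (\<delta> t)"
      proof
        assume "V z = - V (\<delta> t)"
        then have "\<sigma> * Re (V z) = - (\<sigma> * Re (V (\<delta> t)))" by simp
        also have "\<dots> = - Re (csqrt (zt (w t)))" unfolding V\<delta> using \<sigma> by auto
        finally show False using z(3) Re_csqrt[of t] by linarith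
      qed
      ultimately have "V z = V (\<delta> t)" by (simp add: power2_eq_iff)
      then have "U z = U (\<delta> t)" by (simp add: U_V)
      then have "z = \<delta> t" using of_U_U n regset_notin[OF reg[of t]] by metis
      then show "z \<in> range \<delta>" by simp
    qed
  qed
  then show thesis using that arc per R\<delta> unfolding w_def by blast
qed

end

lemma unbounded_real_rays:
  "\<not> bounded (complex_of_real ` {y..})" "\<not> bounded (complex_of_real ` {..y})"
proof -
  show "\<not> bounded (complex_of_real ` {y..})"
  proof
    assume "bounded (complex_of_real ` {y..})"
    then obtain K where "\<bar>x\<bar> \<le> K" if "x \<ge> y" for x by (auto simp: bounded_iff)
    from this[of "max y (K + 1)"] show False by auto
  qed
  show "\<not> bounded (complex_of_real ` {..y})"
  proof
    assume "bounded (complex_of_real ` {..y})"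
    then obtain K where "\<bar>x\<bar> \<le> K" if "x \<le> y" for x by (auto simp: bounded_iff)
    from this[of "min y (- (K + 1))"] show False by auto
  qed
qed

context collinear_qd
begin

section \<open>Noncritical level curves and the marked point that each encircles\<close>

lemma level_closed:
  assumes \<rho>: "\<rho> > 0" "\<rho> \<noteq> S" and \<sigma>: "\<sigma> = 1 \<or> \<sigma> = -1"
  shows "closed_htraj f P (level \<rho> \<sigma>)"
proof -
  from level_param[OF assms] obtain \<delta> where \<delta>: "horiz_arc f P \<delta> UNIV" "\<And>t. \<delta> (t + 2 * pi) = \<delta> t"
    "range \<delta> = level \<rho> \<sigma>" by metis
  have "htraj f P (level \<rho> \<sigma>)"
    by (rule htraj_level_component[OF \<delta>(1) level_def \<delta>(3)]) (use \<rho> in \<open>blast intro: horiz_arc_side\<close>)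
  then show ?thesis
    unfolding closed_htraj_def using \<delta>
    by (intro conjI exI[of _ \<delta>] exI[of _ "2 * pi"]) auto
qed

text \<open>Restricted to the real line, the quadrant conditions become inequalities for distances
  to ra and rb; they confine the places where a level curve can cross the axis.\<close>

lemma level_real_points:
  assumes "complex_of_real x \<in> level \<rho> \<sigma>" and \<sigma>: "\<sigma> = 1 \<or> \<sigma> = -1"
  shows "\<sigma> = 1 \<Longrightarrow> (x - rb)\<^sup>2 > B * S" "\<sigma> = -1 \<Longrightarrow> (x - rb)\<^sup>2 < B * S"
    and "\<sigma> = 1 \<Longrightarrow> \<rho> < S \<Longrightarrow> (x - ra)\<^sup>2 < A * S" "\<sigma> = -1 \<Longrightarrow> \<rho> > S \<Longrightarrow> (x - ra)\<^sup>2 < A * S"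
    and "\<sigma> = -1 \<Longrightarrow> \<rho> < S \<Longrightarrow> (x - ra)\<^sup>2 > A * S" "\<sigma> = 1 \<Longrightarrow> \<rho> > S \<Longrightarrow> (x - ra)\<^sup>2 > A * S"
proof -
  let ?z = "complex_of_real x"
  have z: "?z \<in> regset f P" "norm (R ?z) = \<rho>" "\<sigma> * Re (V ?z) > 0" using assms by (auto simp: level_def)
  have n: "?z \<noteq> z2" using regset_notin[OF z(1)] by simp
  have e: "(norm (?z - of_real y))\<^sup>2 = (x - y)\<^sup>2" for y
    by (simp flip: of_real_diff)
  note iffs = Re_V_pos_iff[OF n] Re_V_neg_iff[OF n] Im_V_pos_iff[OF n] Im_V_neg_iff[OF n]
  note iffs = iffs[unfolded e]
  have q: "Re (V ?z) * Im (V ?z) > 0 \<longleftrightarrow> \<rho> < S" "Re (V ?z) * Im (V ?z) < 0 \<longleftrightarrow> \<rho> > S"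
    using V_quadrant[OF z(1)] z(2) by auto
  show "\<sigma> = 1 \<Longrightarrow> (x - rb)\<^sup>2 > B * S" "\<sigma> = -1 \<Longrightarrow> (x - rb)\<^sup>2 < B * S"
    using z(3) iffs by auto
  show "\<sigma> = 1 \<Longrightarrow> \<rho> < S \<Longrightarrow> (x - ra)\<^sup>2 < A * S" "\<sigma> = -1 \<Longrightarrow> \<rho> > S \<Longrightarrow> (x - ra)\<^sup>2 < A * S"
    "\<sigma> = -1 \<Longrightarrow> \<rho> < S \<Longrightarrow> (x - ra)\<^sup>2 > A * S" "\<sigma> = 1 \<Longrightarrow> \<rho> > S \<Longrightarrow> (x - ra)\<^sup>2 > A * S"
    using z(3) q by (auto simp: iffs(3,4)[symmetric] zero_less_mult_iff mult_less_0_iff)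
qed

text \<open>The circle about ra has radius sqrt (A S), strictly between A and S, so on this side it
  crosses the axis between rc and rb; likewise the circle about rb crosses between ra and
  rc.\<close>

lemma real_point_sides:
  shows "x \<ge> rb \<Longrightarrow> (x - ra)\<^sup>2 \<ge> A * S" and "x \<le> ra \<Longrightarrow> (x - rb)\<^sup>2 \<ge> B * S"
    and "ra \<le> x \<Longrightarrow> x \<le> rc \<Longrightarrow> (x - ra)\<^sup>2 < A * S" and "rc \<le> x \<Longrightarrow> x \<le> rb \<Longrightarrow> (x - rb)\<^sup>2 < B * S"
proof -
  show "(x - ra)\<^sup>2 \<ge> A * S" if "x \<ge> rb"
  proof -
    have "A * S \<le> (x - ra) * (x - ra)" using that pos cb_less by (intro mult_mono) (auto simp: A_def S_def)
    then show ?thesis by (simp add: power2_eq_square)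
  qed
  show "(x - rb)\<^sup>2 \<ge> B * S" if "x \<le> ra"
  proof -
    have "B * S \<le> (rb - x) * (rb - x)" using that pos ac_less by (intro mult_mono) (auto simp: B_def S_def)
    then show ?thesis by (simp add: power2_eq_square algebra_simps)
  qed
  show "(x - ra)\<^sup>2 < A * S" if "ra \<le> x" "x \<le> rc"
  proof -
    have "(x - ra)\<^sup>2 \<le> A\<^sup>2" using that by (intro power_mono) (auto simp: A_def)
    also have "\<dots> < A * S" using pos S_eq by (simp add: power2_eq_square)
    finally show ?thesis .
  qed
  show "(x - rb)\<^sup>2 < B * S" if "rc \<le> x" "x \<le> rb"
  proof -
    have "(rb - x)\<^sup>2 \<le> B\<^sup>2" using that by (intro power_mono) (auto simp: B_def)
    also have "\<dots> < B * S" using pos S_eq by (simp add: power2_eq_square)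
    finally show ?thesis by (simp add: power2_commute)
  qed
qed

text \<open>\<open>winding_sum\<close> supplies the nonvanishing. It remains to make the other
  winding numbers vanish, or all of them coincide, by pieces of the real axis that miss the
  curve.\<close>

lemma level_circle:
  assumes \<rho>: "\<rho> > 0" "\<rho> \<noteq> S" and \<sigma>: "\<sigma> = 1 \<or> \<sigma> = -1"
  shows "circle_around_marked f P (level \<rho> \<sigma>)"
proof -
  from level_param[OF assms] obtain \<delta> where \<delta>: "horiz_arc f P \<delta> UNIV" "\<And>t. \<delta> (t + 2 * pi) = \<delta> t"
    "\<And>t. R (\<delta> t) = of_real \<rho> * exp (\<i> * of_real t)" "range \<delta> = level \<rho> \<sigma>" by metis
  define \<kappa> where "\<kappa> = (\<lambda>s. \<delta> (2 * pi * s))"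
  note wind = winding_sum[OF \<delta>(1-3) \<rho>(1), folded \<kappa>_def]
  have path: "path \<kappa>" using wind(1) by (rule valid_path_imp_path)
  have im: "path_image \<kappa> \<subseteq> level \<rho> \<sigma>" using \<delta>(4) by (auto simp: path_image_def \<kappa>_def)
  have zero: "winding_number \<kappa> (of_real x) = 0"
    if "x \<in> X" "\<And>y. y \<in> X \<Longrightarrow> complex_of_real y \<notin> level \<rho> \<sigma>" "X = {y..} \<or> X = {..y}" for x X y
  proof (rule winding_zero_outside[OF path wind(2)])
    show "connected (complex_of_real ` X)"
      using that(3) by (intro connected_continuous_image continuous_intros) auto
    show "\<not> bounded (complex_of_real ` X)" using that(3) unbounded_real_rays by auto
  qed (use that im in auto)
  note lp = level_real_points[OF _ \<sigma>] and rs = real_point_sides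
  let ?wa = "winding_number \<kappa> (of_real ra)" and ?wb = "winding_number \<kappa> (of_real rb)"
    and ?wc = "winding_number \<kappa> (of_real rc)"
  \<comment> \<open>In this order the curves go around ra, rb, rc and infinity.\<close>
  consider "\<sigma> = 1" "\<rho> < S" | "\<sigma> = -1" "\<rho> < S" | "\<sigma> = -1" "\<rho> > S" | "\<sigma> = 1" "\<rho> > S"
    using \<sigma> \<rho> by linarith
  then have "(\<exists>z\<in>P. winding_number \<kappa> z \<noteq> 0 \<and> (\<forall>z'\<in>P - {z}. winding_number \<kappa> z' = 0))
          \<or> (\<forall>z\<in>P. winding_number \<kappa> z \<noteq> 0)"
  proof cases
    case 1
    have "complex_of_real x \<notin> level \<rho> \<sigma>" if "x \<in> {rc..}" for x
      using lp(1,3)[of x \<rho>] rs(1,4)[of x] 1 that by (cases "x \<ge> rb") fastforce+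
    then have "?wb = 0" "?wc = 0" using zero[of _ "{rc..}" rc] cb_less by auto
    then show ?thesis using wind(3) unfolding P_eq by auto
  next
    case 2
    have "complex_of_real x \<notin> level \<rho> \<sigma>" if "x \<in> {..rc}" for x
      using lp(2,5)[of x \<rho>] rs(2,3)[of x] 2 that by (cases "x \<le> ra") fastforce+
    then have "?wa = 0" "?wc = 0" using zero[of _ "{..rc}" rc] ac_less by auto
    then show ?thesis using wind(3) unfolding P_eq by auto
  next
    case 3
    have "complex_of_real x \<notin> level \<rho> \<sigma>" if "x \<in> {..ra}" for x
      using lp(2)[of x \<rho>] rs(2)[of x] 3 that by fastforce
    then have "?wa = 0" using zero[of _ "{..ra}" ra] by auto
    moreover have "complex_of_real x \<notin> level \<rho> \<sigma>" if "x \<in> {rb..}" for x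
      using lp(4)[of x \<rho>] rs(1)[of x] 3 that by fastforce
    then have "?wb = 0" using zero[of _ "{rb..}" rb] by auto
    ultimately show ?thesis using wind(3) unfolding P_eq by auto
  next
    case 4
    \<comment> \<open>For the curve around infinity the segment joining all finite marked points is
      missed. The three winding numbers agree, and their signed sum makes each of them 1.\<close>
    have "complex_of_real x \<notin> level \<rho> \<sigma>" if "x \<in> {ra..rb}" for x
      using lp(1,6)[of x \<rho>] rs(3,4)[of x] 4 that by (cases "x \<le> rc") fastforce+
    then have dis: "complex_of_real ` {ra..rb} \<inter> path_image \<kappa> = {}" using im by auto
    have "connected (complex_of_real ` {ra..rb})"
      by (intro connected_continuous_image continuous_intros) auto
    from winding_number_eq[OF path wind(2) _ _ this dis]
    have "?wb = ?wa" "?wc = ?wa" using ac_less cb_less by auto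
    then show ?thesis using wind(3) unfolding P_eq by auto
  qed
  then show ?thesis
    unfolding circle_around_marked_def Let_def \<kappa>_def using \<delta>
    by (intro exI[of _ \<delta>] exI[of _ "2 * pi"]) auto
qed

section \<open>The critical level and the Strebel property\<close>

lemma zt_R_deriv:
  assumes "(\<gamma> has_vector_derivative g) (at t)" "\<gamma> t \<in> regset f P" "om (\<gamma> t) * g = \<i> * of_real h" "h \<noteq> 0"
  shows "\<exists>D. ((\<lambda>t. zt (R (\<gamma> t))) has_vector_derivative D) (at t) \<and> D \<noteq> 0"
proof -
  note n = regset_notin[OF assms(2)]
  have "(zt has_field_derivative cis (- phi) * ((v1 - v2) / (R (\<gamma> t) - v2)\<^sup>2)) (at (R (\<gamma> t)))"
    unfolding zt_def[abs_def]
    by (rule derivative_eq_intros refl | use n in force)+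
      (use n in \<open>simp add: field_simps power2_eq_square\<close>)
  from field_vector_diff_chain_at[OF R_comp_deriv[OF assms(1,2)] this]
  show ?thesis using n assms(3,4) v1_ne_v2 by (auto simp: o_def)
qed

text \<open>On the critical level \<open>zt (R z)\<close> is real, and along a horizontal arc its
  derivative never vanishes. A periodic arc would contradict Rolle's theorem.\<close>

lemma critical_level_not_closed:
  assumes \<gamma>: "horiz_arc f P \<gamma> UNIV" "p > 0" "\<And>t. \<gamma> (t + p) = \<gamma> t"
  shows "norm (R (\<gamma> t)) \<noteq> S"
proof
  assume "norm (R (\<gamma> t)) = S"
  then have lev: "norm (R (\<gamma> s)) = S" for s using horiz_arc_norm_R[OF \<gamma>(1), of s t] by simp
  have reg: "\<gamma> s \<in> regset f P" for s using \<gamma>(1) by (auto simp: horiz_arc_def)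
  have Im0: "Im (zt (R (\<gamma> s))) = 0" for s
    using Im_zt[of "R (\<gamma> s)"] regset_notin[OF reg[of s]] lev[of s] by auto
  have der: "\<exists>D. ((\<lambda>t. zt (R (\<gamma> t))) has_vector_derivative D) (at s) \<and> D \<noteq> 0" for s
  proof -
    obtain g h where "(\<gamma> has_vector_derivative g) (at s)" "h \<noteq> 0" "om (\<gamma> s) * g = \<i> * of_real h"
      using \<gamma>(1) unfolding horiz_arc_iff by blast
    then show ?thesis using zt_R_deriv[of \<gamma> g s h] reg by blast
  qed
  have Re_der: "\<exists>d. ((\<lambda>t. Re (zt (R (\<gamma> t)))) has_real_derivative d) (at s) \<and> d \<noteq> 0" for s
  proof -
    obtain D where D: "((\<lambda>t. zt (R (\<gamma> t))) has_vector_derivative D) (at s)" "D \<noteq> 0" using der by blast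
    have "((\<lambda>t. Im (zt (R (\<gamma> t)))) has_vector_derivative Im D) (at s)"
      using bounded_linear.has_vector_derivative[OF bounded_linear_Im D(1)] .
    then have "((\<lambda>t. 0) has_vector_derivative Im D) (at s)" by (simp add: Im0)
    then have "Im D = 0" using vector_derivative_unique_at has_vector_derivative_const by blast
    then have "Re D \<noteq> 0" using D(2) by (simp add: complex_eq_iff)
    moreover have "((\<lambda>t. Re (zt (R (\<gamma> t)))) has_real_derivative Re D) (at s)"
      using bounded_linear.has_vector_derivative[OF bounded_linear_Re D(1)]
      by (simp add: has_real_derivative_iff_has_vector_derivative)
    ultimately show ?thesis by blast
  qed
  have "\<exists>z>0. z < p \<and> ((\<lambda>t. Re (zt (R (\<gamma> t)))) has_real_derivative 0) (at z)"
  proof (rule Rolle[OF \<gamma>(2)])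
    show "Re (zt (R (\<gamma> 0))) = Re (zt (R (\<gamma> p)))" using \<gamma>(3)[of 0] by simp
    show "continuous_on {0..p} (\<lambda>t. Re (zt (R (\<gamma> t))))"
      using Re_der by (intro continuous_at_imp_continuous_on) (meson DERIV_isCont)
    show "(\<lambda>t. Re (zt (R (\<gamma> t)))) differentiable at x" for x
      using Re_der real_differentiable_def by blast
  qed
  then obtain z where "((\<lambda>t. Re (zt (R (\<gamma> t)))) has_real_derivative 0) (at z)" by blast
  then show False using Re_der[of z] DERIV_unique by blast
qed

text \<open>The conserved quantities put the trajectory inside one level component; maximality,
  applied to the explicit parametrization of that component, gives the converse inclusion.\<close>

lemma htraj_noncritical:
  assumes T: "htraj f P T" and z: "z \<in> T" "norm (R z) \<noteq> S"
  obtains \<rho> \<sigma> where "\<rho> > 0" "\<rho> \<noteq> S" "\<sigma> = 1 \<or> \<sigma> = (-1::real)" "T = level \<rho> \<sigma>"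
proof -
  obtain \<gamma> I where \<gamma>: "horiz_arc f P \<gamma> I" "T = \<gamma> ` I"
    and max: "\<forall>\<delta> J. horiz_arc f P \<delta> J \<and> \<delta> ` J \<inter> T \<noteq> {} \<longrightarrow> \<delta> ` J \<subseteq> T"
    using T unfolding htraj_def by (elim exE conjE)
  obtain t0 where t0: "t0 \<in> I" "z = \<gamma> t0" using z(1) \<gamma>(2) by auto
  have reg: "z \<in> regset f P" using \<gamma>(1) t0 unfolding horiz_arc_def by blast
  define \<rho> where "\<rho> = norm (R z)"
  define \<sigma> where "\<sigma> = sgn (Re (V z))"
  have "Re (V z) \<noteq> 0" using V_quadrant(3)[OF reg] z(2) by auto
  then have \<sigma>: "\<sigma> = 1 \<or> \<sigma> = -1" "\<sigma> * Re (V z) > 0" by (auto simp: \<sigma>_def sgn_if)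
  have \<rho>: "\<rho> > 0" "\<rho> \<noteq> S" using regset_notin[OF reg] z(2) by (auto simp: \<rho>_def)
  have zl: "z \<in> level \<rho> \<sigma>" using reg \<sigma> by (simp add: level_def \<rho>_def)
  have "T \<subseteq> level \<rho> \<sigma>"
  proof
    fix y assume "y \<in> T"
    then obtain t where t: "t \<in> I" "y = \<gamma> t" using \<gamma> by auto
    then show "y \<in> level \<rho> \<sigma>"
      using horiz_arc_norm_R[OF \<gamma>(1) t0(1) t(1)] horiz_arc_side[OF \<gamma>(1) t0(1) t(1), of \<sigma>]
        \<sigma>(2) \<rho> t0 \<gamma>(1) by (auto simp: level_def \<rho>_def horiz_arc_def)
  qed
  moreover obtain \<delta> where "horiz_arc f P \<delta> UNIV" "range \<delta> = level \<rho> \<sigma>"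
    using level_param[OF \<rho> \<sigma>(1)] by metis
  then have "level \<rho> \<sigma> \<subseteq> T" using max[rule_format, of \<delta> UNIV] zl z(1) by auto
  ultimately show thesis using that[OF \<rho> \<sigma>(1)] by blast
qed

lemma critical_level_null: "{z \<in> regset f P. norm (R z) = S} \<in> null_sets lebesgue"
proof -
  have "{z \<in> regset f P. norm (R z) = S} \<subseteq>
    sphere (of_real rb) (sqrt (B * S)) \<union> sphere (of_real ra) (sqrt (A * S))"
  proof
    fix z assume z: "z \<in> {z \<in> regset f P. norm (R z) = S}"
    then have "Re (V z) = 0 \<or> Im (V z) = 0" using V_quadrant(3)[of z] by auto
    moreover have "z \<noteq> z2" using z regset_notin by blast
    ultimately have "(norm (z - of_real rb))\<^sup>2 = B * S \<or> (norm (z - of_real ra))\<^sup>2 = A * S"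
      using Re_V[of z] Im_V[of z] pos by auto
    then have "norm (z - of_real rb) = sqrt (B * S) \<or> norm (z - of_real ra) = sqrt (A * S)"
      by (metis norm_ge_zero real_sqrt_unique)
    then show "z \<in> sphere (of_real rb) (sqrt (B * S)) \<union> sphere (of_real ra) (sqrt (A * S))"
      by (auto simp: dist_norm norm_minus_commute)
  qed
  moreover have "negligible (sphere (complex_of_real rb) (sqrt (B * S)) \<union> sphere (of_real ra) (sqrt (A * S)))"
    by (intro negligible_Un negligible_sphere)
  ultimately show ?thesis
    using negligible_subset negligible_iff_null_sets by blast
qed

lemma strebel: "strebel_P1 f P (\<lambda>_. 1) 1"
  unfolding strebel_P1_def
proof (intro conjI ballI allI impI)
  show "finite P" by (simp add: P_eq)
  show "f holomorphic_on - P" by (rule f_holomorphic)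
  show "double_pole_res f p 1" if "p \<in> P" for p using that by (rule double_pole_res_P)
  show "double_pole_res_inf f 1" by (rule double_pole_res_infinity)
  \<comment> \<open>A trajectory with a point off the critical level is one of the closed curves
    \<open>level\<close>, so the non-closed ones are confined to the critical level.\<close>
  have "\<Union> {T. htraj f P T \<and> \<not> closed_htraj f P T} \<subseteq> {z \<in> regset f P. norm (R z) = S}"
  proof
    fix z assume "z \<in> \<Union> {T. htraj f P T \<and> \<not> closed_htraj f P T}"
    then obtain T where T: "htraj f P T" "\<not> closed_htraj f P T" "z \<in> T" by auto
    have "z \<in> regset f P" using T(1,3) by (auto simp: htraj_def horiz_arc_def)
    moreover have "norm (R z) = S"
      using htraj_noncritical[OF T(1,3)] T(2) level_closed by metis
    ultimately show "z \<in> {z \<in> regset f P. norm (R z) = S}" by simp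
  qed
  then show "\<Union> {T. htraj f P T \<and> \<not> closed_htraj f P T} \<in> null_sets lebesgue"
    using critical_level_null negligible_subset negligible_iff_null_sets by blast
  show "circle_around_marked f P T" if T: "closed_htraj f P T" for T
  proof -
    obtain \<gamma> p where \<gamma>: "p > 0" "horiz_arc f P \<gamma> UNIV" "\<And>t. \<gamma> (t + p) = \<gamma> t" "T = range \<gamma>"
      using T unfolding closed_htraj_def by blast
    have "norm (R (\<gamma> 0)) \<noteq> S" by (rule critical_level_not_closed[OF \<gamma>(2,1,3)])
    then show ?thesis
      using htraj_noncritical[of T "\<gamma> 0"] T \<gamma>(4) level_circle by (metis closed_htraj_def rangeI)
  qed
qed auto

end

section \<open>Ribbon graphs with two vertices and four edges\<close>

text \<open>The four horizontal directions at a double zero of q, once one of them is known.\<close>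

definition quarter_turns :: "complex \<Rightarrow> complex set" where
  "quarter_turns d = {d, d * \<i>, - d, - (d * \<i>)}"

lemma quarter_turns_iff: "x \<in> quarter_turns d \<longleftrightarrow> (\<exists>k<4. x = d * \<i> ^ k)"
  and quarter_turns_iff': "x \<in> quarter_turns d \<longleftrightarrow> (\<exists>k<4. x = d * (-\<i>) ^ k)"
proof -
  have "k < 4 \<longleftrightarrow> k = 0 \<or> k = 1 \<or> k = 2 \<or> k = 3" for k :: nat by auto
  then have ex: "(\<exists>k<4. Q k) \<longleftrightarrow> Q 0 \<or> Q 1 \<or> Q 2 \<or> Q 3" for Q :: "nat \<Rightarrow> bool" by auto
  show "x \<in> quarter_turns d \<longleftrightarrow> (\<exists>k<4. x = d * \<i> ^ k)"
    "x \<in> quarter_turns d \<longleftrightarrow> (\<exists>k<4. x = d * (-\<i>) ^ k)"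
    unfolding ex by (auto simp: quarter_turns_def eval_nat_numeral)
qed

lemma quarter_turns_rotate: "d' \<in> quarter_turns d \<Longrightarrow> quarter_turns d' = quarter_turns d"
proof -
  have "d * \<i> * \<i> = - d" by (simp add: mult.assoc)
  then show "d' \<in> quarter_turns d \<Longrightarrow> quarter_turns d' = quarter_turns d"
    by (auto simp: quarter_turns_def)
qed

lemma ii_power_mod_4: "\<i> ^ (k mod 4) = \<i> ^ k" "(-\<i>) ^ (k mod 4) = (-\<i>) ^ k"
proof -
  have "\<i> ^ 4 = 1" "(-\<i>) ^ 4 = (1::complex)" by (simp_all add: numeral_eq_Suc)
  then have "\<i> ^ (4 * (k div 4) + k mod 4) = \<i> ^ (k mod 4)"
    "(-\<i>) ^ (4 * (k div 4) + k mod 4) = (-\<i>) ^ (k mod 4)"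
    unfolding power_add power_mult by simp_all
  then show "\<i> ^ (k mod 4) = \<i> ^ k" "(-\<i>) ^ (k mod 4) = (-\<i>) ^ k" by simp_all
qed

lemma quarter_turns_power: "d * \<i> ^ k \<in> quarter_turns d" "d * (-\<i>) ^ k \<in> quarter_turns d"
  unfolding quarter_turns_iff[of "d * \<i> ^ k"] quarter_turns_iff'[of "d * (-\<i>) ^ k"]
  by (rule exI[of _ "k mod 4"], simp only: ii_power_mod_4, simp)+

lemma times_quarter_turns:
  "{v} \<times> quarter_turns d = (\<lambda>k. (v, d * \<i> ^ k)) ` {0..<4}"
  "{v} \<times> quarter_turns d = (\<lambda>k. (v, d * (-\<i>) ^ k)) ` {0..<4}"
proof -
  have "quarter_turns d = (\<lambda>k. d * \<i> ^ k) ` {0..<4}" by (rule set_eqI) (auto simp: quarter_turns_iff)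
  then show "{v} \<times> quarter_turns d = (\<lambda>k. (v, d * \<i> ^ k)) ` {0..<4}" by auto
  have "quarter_turns d = (\<lambda>k. d * (-\<i>) ^ k) ` {0..<4}"
    by (rule set_eqI) (auto simp: quarter_turns_iff' simp del: power_minus)
  moreover have "{v} \<times> g ` K = (\<lambda>k. (v, g k)) ` K" for g :: "nat \<Rightarrow> complex" and K by auto
  ultimately show "{v} \<times> quarter_turns d = (\<lambda>k. (v, d * (-\<i>) ^ k)) ` {0..<4}" by simp
qed

text \<open>Edges are numbered by unrestricted exponents, which matter only modulo 4. A power of
  \<i> determines its conjugate, hence the direction at the far end, and the parity, hence the edge
  length.\<close>

lemma ii_power_eq_imp: "\<i> ^ j = \<i> ^ k \<Longrightarrow> (-\<i>) ^ j = (-\<i>) ^ k \<and> (even j \<longleftrightarrow> even k)"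
proof -
  assume eq: "\<i> ^ j = \<i> ^ k"
  have "(-\<i>) ^ n = cnj (\<i> ^ n)" for n by simp
  then have "(-\<i>) ^ j = (-\<i>) ^ k" using eq by metis
  moreover have "(\<i> ^ n)\<^sup>2 = (if even n then 1 else -1)" for n
    by (simp add: power_mult[symmetric] mult.commute[of n] power_mult)
  then have "even j \<longleftrightarrow> even k" using eq by (metis one_neq_neg_one)
  ultimately show ?thesis by simp
qed

lemma ii_power_inj: "inj_on (\<lambda>k. \<i> ^ k) {0..<4}" "inj_on (\<lambda>k. (-\<i>) ^ k) {0..<4}"
proof -
  have "{0..<4} = {0, 1, 2, 3::nat}" by auto
  then show "inj_on (\<lambda>k. \<i> ^ k) {0..<4}" "inj_on (\<lambda>k. (-\<i>) ^ k) {0..<4}"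
    by (auto simp: inj_on_def numeral_eq_Suc complex_eq_iff)
qed

lemma ccw_angle_quarter_turns:
  assumes "d \<noteq> 0"
  shows "ccw_angle d (d * \<i>) = pi / 2"
    and "x \<in> quarter_turns d \<Longrightarrow> x \<noteq> d * \<i> \<Longrightarrow> ccw_angle d x > pi / 2"
proof -
  \<comment> \<open>\<open>ccw_angle\<close> takes values above 0 and up to 2 pi, so a direction is
    a full turn from itself and never its own successor.\<close>
  have "ccw_angle d d = 2 * pi" "ccw_angle d (- d) = pi" "ccw_angle d (- (d * \<i>)) = 3 * pi / 2"
    using assms Arg_of_real[of "-1"] pi_gt_zero by (simp_all add: ccw_angle_def Let_def not_le)
  then show "x \<in> quarter_turns d \<Longrightarrow> x \<noteq> d * \<i> \<Longrightarrow> ccw_angle d x > pi / 2"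
    using pi_gt_zero by (auto simp: quarter_turns_def)
  show "ccw_angle d (d * \<i>) = pi / 2"
    using assms pi_gt_zero by (simp add: ccw_angle_def Let_def not_le)
qed

lemma rg_next_iff:
  assumes darts: "\<And>x. (v, x) \<in> rg_darts f P \<longleftrightarrow> x \<in> quarter_turns d" and "d \<noteq> 0"
  shows "rg_next f P (v, d) y \<longleftrightarrow> y = (v, d * \<i>)"
proof
  note ccw = ccw_angle_quarter_turns[OF \<open>d \<noteq> 0\<close>]
  have self: "(v, d) \<in> rg_darts f P" "(v, d * \<i>) \<in> rg_darts f P"
    unfolding darts by (auto simp: quarter_turns_def)
  show "y = (v, d * \<i>)" if nxt: "rg_next f P (v, d) y"
  proof -
    have y: "y \<in> rg_darts f P" "fst y = v" using nxt by (auto simp: rg_next_def)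
    have "ccw_angle d (snd y) \<le> ccw_angle d (d * \<i>)"
      using nxt self(2) unfolding rg_next_def by (metis fst_conv snd_conv)
    moreover have "snd y \<in> quarter_turns d" using y darts by (metis prod.collapse)
    ultimately have "snd y = d * \<i>" using ccw by (metis not_le)
    then show ?thesis using y(2) by (simp add: prod_eq_iff)
  qed
  show "rg_next f P (v, d) y" if "y = (v, d * \<i>)"
  proof -
    have "ccw_angle d (d * \<i>) \<le> ccw_angle d (snd z)" if "z \<in> rg_darts f P" "fst z = v" for z
    proof -
      have "snd z \<in> quarter_turns d" using that darts by (metis prod.collapse)
      then show ?thesis using ccw by (metis less_imp_le order_refl)
    qed
    then show ?thesis using self that by (simp add: rg_next_def)
  qed
qed

text \<open>Edge k leaves v in direction d i^k and arrives at w from direction e (-i)^k: the cyclic orders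
  at the two ends are opposite.\<close>
definition quad_ribbon ::
  "(complex \<Rightarrow> complex) \<Rightarrow> complex set \<Rightarrow> complex \<Rightarrow> complex \<Rightarrow> complex \<Rightarrow> complex \<Rightarrow> (nat \<Rightarrow> real) \<Rightarrow> bool"
where
  "quad_ribbon f P v w d e l \<longleftrightarrow> v \<noteq> w \<and> d \<noteq> 0 \<and> e \<noteq> 0 \<and>
     rg_darts f P = {v} \<times> quarter_turns d \<union> {w} \<times> quarter_turns e \<and>
     (\<forall>k y L. rg_edge f P (v, d * \<i> ^ k) y L \<longleftrightarrow> y = (w, e * (-\<i>) ^ k) \<and> L = l k) \<and>
     (\<forall>k y L. rg_edge f P (w, e * (-\<i>) ^ k) y L \<longleftrightarrow> y = (v, d * \<i> ^ k) \<and> L = l k)"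

lemma quad_ribbonD:
  assumes "quad_ribbon f P v w d e l"
  shows "v \<noteq> w" "d \<noteq> 0" "e \<noteq> 0"
    and "rg_darts f P = {v} \<times> quarter_turns d \<union> {w} \<times> quarter_turns e"
    and "rg_edge f P (v, d * \<i> ^ k) y L \<longleftrightarrow> y = (w, e * (-\<i>) ^ k) \<and> L = l k"
    and "rg_edge f P (w, e * (-\<i>) ^ k) y L \<longleftrightarrow> y = (v, d * \<i> ^ k) \<and> L = l k"
  using assms unfolding quad_ribbon_def by blast+

lemma quad_ribbon_next:
  assumes q: "quad_ribbon f P v w d e l" and x: "x \<in> rg_darts f P"
  shows "rg_next f P x y \<longleftrightarrow> y = (fst x, snd x * \<i>)"
proof -
  note D = quad_ribbonD[OF q]
  have "\<exists>d'. d' \<noteq> 0 \<and> snd x \<in> quarter_turns d' \<and> (\<forall>y. (fst x, y) \<in> rg_darts f P \<longleftrightarrow> y \<in> quarter_turns d')"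
    using x D(1-3) unfolding D(4) by auto
  then obtain d' where d': "d' \<noteq> 0" "snd x \<in> quarter_turns d'"
    "\<And>y. (fst x, y) \<in> rg_darts f P \<longleftrightarrow> y \<in> quarter_turns d'" by blast
  have "snd x \<noteq> 0" using d' by (auto simp: quarter_turns_def)
  then have "rg_next f P (fst x, snd x) y \<longleftrightarrow> y = (fst x, snd x * \<i>)"
    by (intro rg_next_iff) (simp_all add: d'(3) quarter_turns_rotate[OF d'(2)])
  then show ?thesis by simp
qed

text \<open>Renumbering the edges by one interchanges the lengths at even and odd positions; this
  absorbs the exchange of A and B.\<close>

lemma quad_ribbon_shift:
  assumes "quad_ribbon f P v w d e l"
  shows "quad_ribbon f P v w (d * \<i>) (e * (-\<i>)) (\<lambda>k. l (Suc k))"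
proof -
  have p: "x * y * y ^ k = x * y ^ Suc k" for x y :: complex and k by simp
  have r: "quarter_turns (d * \<i>) = quarter_turns d" "quarter_turns (e * (-\<i>)) = quarter_turns e"
    using quarter_turns_power(1)[of d 1] quarter_turns_power(2)[of e 1]
    by (simp_all add: quarter_turns_rotate)
  have "d * \<i> \<noteq> 0" "e * (-\<i>) \<noteq> 0" using quad_ribbonD(2,3)[OF assms] by auto
  then show ?thesis
    using quad_ribbonD[OF assms] unfolding quad_ribbon_def r p by blast
qed

lemma quad_ribbon_two_vertices_four_edges:
  assumes q: "quad_ribbon f P v w d e l" and z: "qzeros f P = {v, w}"
  shows "rg_two_vertices_four_edges f P l"
  unfolding rg_two_vertices_four_edges_def
proof (rule exI[of _ v], rule exI[of _ w], rule exI[of _ "\<lambda>k. d * \<i> ^ k"],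
    rule exI[of _ "\<lambda>k. e * (-\<i>) ^ k"], intro conjI allI impI)
  note D = quad_ribbonD[OF q]
  show "v \<noteq> w" "qzeros f P = {v, w}" using D(1) z by auto
  show "inj_on (\<lambda>k. d * \<i> ^ k) {0..<4}" "inj_on (\<lambda>k. e * (-\<i>) ^ k) {0..<4}"
    using ii_power_inj D(2,3) unfolding inj_on_def by (metis mult_cancel_left)+
  have "{x \<in> rg_darts f P. fst x = v} = {v} \<times> quarter_turns d"
    "{x \<in> rg_darts f P. fst x = w} = {w} \<times> quarter_turns e"
    unfolding D(4) using D(1) by auto
  then show "{x \<in> rg_darts f P. fst x = v} = (\<lambda>i. (v, d * \<i> ^ i)) ` {0..<4}"
    "{x \<in> rg_darts f P. fst x = w} = (\<lambda>i. (w, e * (-\<i>) ^ i)) ` {0..<4}"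
    unfolding times_quarter_turns(1)[of v] times_quarter_turns(2)[of w] .
  show "rg_next f P (v, d * \<i> ^ i) (v, d * \<i> ^ ((i + 1) mod 4))" if "i < 4" for i
  proof -
    have "(v, d * \<i> ^ i) \<in> rg_darts f P" unfolding D(4) using quarter_turns_power by blast
    then show ?thesis unfolding ii_power_mod_4 by (simp add: quad_ribbon_next[OF q])
  qed
  show "rg_edge f P (v, d * \<i> ^ i) y L \<longleftrightarrow> y = (w, e * (-\<i>) ^ i) \<and> L = l i"
    "rg_edge f P (w, e * (-\<i>) ^ i) y L \<longleftrightarrow> y = (v, d * \<i> ^ i) \<and> L = l i" if "i < 4" for i y L
    by (rule D(5) D(6))+
qed

text \<open>At each vertex the map is multiplication of directions by a constant, which commutes
  with the quarter turn that defines the cyclic order.\<close>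

lemma quad_ribbon_iso:
  assumes q: "quad_ribbon f P v w d e l" and q': "quad_ribbon f' P' v' w' d' e' l"
  shows "rg_iso f P f' P'"
proof -
  note D = quad_ribbonD[OF q] and D' = quad_ribbonD[OF q']
  define \<phi> where "\<phi> x = (if fst x = v then (v', d' * (snd x / d)) else (w', e' * (snd x / e)))" for x
  have \<phi>: "\<phi> (v, d * x) = (v', d' * x)" "\<phi> (w, e * x) = (w', e' * x)" for x
    using D(1-3) by (auto simp: \<phi>_def)
  have vw: "fst x = v \<or> fst x = w" if "x \<in> rg_darts f P" for x using that by (auto simp: D(4))
  have inj: "x = y" if "fst x = v \<or> fst x = w" "fst y = v \<or> fst y = w" "\<phi> x = \<phi> y" for x y
    using that D(1-3) D'(1-3) by (auto simp: \<phi>_def prod_eq_iff split: if_splits)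
  have im: "\<phi> ` rg_darts f P = rg_darts f' P'"
  proof -
    have "\<phi> ` ({v} \<times> quarter_turns d) = {v'} \<times> quarter_turns d'"
      "\<phi> ` ({w} \<times> quarter_turns e) = {w'} \<times> quarter_turns e'"
      unfolding times_quarter_turns(1)[of v] times_quarter_turns(1)[of v']
        times_quarter_turns(2)[of w] times_quarter_turns(2)[of w'] image_image \<phi> by (rule refl)+
    then show ?thesis unfolding D(4) D'(4) image_Un by simp
  qed
  show ?thesis
    unfolding rg_iso_def
  proof (intro exI[of _ \<phi>] conjI ballI allI)
    show "bij_betw \<phi> (rg_darts f P) (rg_darts f' P')"
      unfolding bij_betw_def using im inj vw by (auto simp: inj_on_def)
    fix x y assume x: "x \<in> rg_darts f P" and y: "y \<in> rg_darts f P"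
    have "\<phi> (fst x, snd x * \<i>) = (fst (\<phi> x), snd (\<phi> x) * \<i>)" by (simp add: \<phi>_def)
    then have "rg_next f' P' (\<phi> x) (\<phi> y) \<longleftrightarrow> \<phi> y = \<phi> (fst x, snd x * \<i>)"
      using quad_ribbon_next[OF q', of "\<phi> x" "\<phi> y"] im x by auto
    also have "\<dots> \<longleftrightarrow> y = (fst x, snd x * \<i>)" using inj[of y "(fst x, snd x * \<i>)"] vw[OF x] vw[OF y] by auto
    also have "\<dots> \<longleftrightarrow> rg_next f P x y" using quad_ribbon_next[OF q x] by simp
    finally show "rg_next f P x y \<longleftrightarrow> rg_next f' P' (\<phi> x) (\<phi> y)" by simp
    fix L
    from x consider k where "x = (v, d * \<i> ^ k)" | k where "x = (w, e * (-\<i>) ^ k)"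
      unfolding D(4) times_quarter_turns(1)[of v] times_quarter_turns(2)[of w] by blast
    then show "rg_edge f P x y L \<longleftrightarrow> rg_edge f' P' (\<phi> x) (\<phi> y) L"
    proof cases
      case 1
      have "\<phi> y = \<phi> (w, e * (-\<i>) ^ k) \<longleftrightarrow> y = (w, e * (-\<i>) ^ k)"
        using inj[OF vw[OF y], of "(w, e * (-\<i>) ^ k)"] by (auto simp del: power_minus)
      then show ?thesis unfolding 1 \<phi> D(5) D'(5) by simp
    next
      case 2
      have "\<phi> y = \<phi> (v, d * \<i> ^ k) \<longleftrightarrow> y = (v, d * \<i> ^ k)"
        using inj[OF vw[OF y], of "(v, d * \<i> ^ k)"] by auto
      then show ?thesis unfolding 2 \<phi> D(6) D'(6) by simp
    qed
  qed
qed

section \<open>The critical graph\<close>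

lemma tendsto_reverse:
  fixes L :: real
  shows "(g \<longlongrightarrow> l) (at_left L) \<Longrightarrow> ((\<lambda>t. g (L - t)) \<longlongrightarrow> l) (at_right 0)"
    and "(g \<longlongrightarrow> l) (at_right 0) \<Longrightarrow> ((\<lambda>t. g (L - t)) \<longlongrightarrow> l) (at_left L)"
proof -
  have "filterlim (\<lambda>t. L - t) (at_left L) (at_right 0)"
    unfolding filterlim_at by (auto intro!: tendsto_eq_intros simp: eventually_at_filter)
  then show "(g \<longlongrightarrow> l) (at_left L) \<Longrightarrow> ((\<lambda>t. g (L - t)) \<longlongrightarrow> l) (at_right 0)"
    by (rule filterlim_compose[rotated])
  have "filterlim (\<lambda>t. L - t) (at_right 0) (at_left L)"
    unfolding filterlim_at by (auto intro!: tendsto_eq_intros simp: eventually_at_filter)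
  then show "(g \<longlongrightarrow> l) (at_right 0) \<Longrightarrow> ((\<lambda>t. g (L - t)) \<longlongrightarrow> l) (at_left L)"
    by (rule filterlim_compose[rotated])
qed

lemma nat_arc_reverse:
  assumes "nat_arc f P \<gamma> {0<..<L}"
  shows "nat_arc f P (\<lambda>t. \<gamma> (L - t)) {0<..<L}"
  unfolding nat_arc_def
proof (intro conjI ballI)
  show "is_interval {0<..<L}" "open {0<..<L}" "{0<..<L} \<noteq> {}" using assms by (auto simp: nat_arc_def)
  fix t assume t: "t \<in> {0<..<L}"
  then have "L - t \<in> {0<..<L}" by auto
  then obtain g where g: "\<gamma> (L - t) \<in> regset f P" "(\<gamma> has_vector_derivative g) (at (L - t))"
    "f (\<gamma> (L - t)) * g\<^sup>2 = 1" using assms unfolding nat_arc_def by blast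
  show "\<gamma> (L - t) \<in> regset f P" by (rule g)
  have "((\<lambda>t. L - t) has_vector_derivative -1) (at t)"
    by (auto intro!: derivative_eq_intros simp: has_real_derivative_iff_has_vector_derivative[symmetric])
  from vector_diff_chain_at[OF this g(2)]
  have "((\<lambda>t. \<gamma> (L - t)) has_vector_derivative - g) (at t)" by (simp add: o_def)
  then show "\<exists>g. ((\<lambda>t. \<gamma> (L - t)) has_vector_derivative g) (at t) \<and> f (\<gamma> (L - t)) * g\<^sup>2 = 1"
    using g(3) by (metis power2_minus)
qed

lemma rg_edge_sym:
  assumes "rg_edge f P x y L"
  shows "rg_edge f P y x L"
proof -
  obtain \<gamma> where "x \<in> rg_darts f P" "y \<in> rg_darts f P" "L > 0" and \<gamma>: "nat_arc f P \<gamma> {0<..<L}"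
        "(\<gamma> \<longlongrightarrow> fst x) (at_right 0)" "((\<lambda>t. sgn (\<gamma> t - fst x)) \<longlongrightarrow> snd x) (at_right 0)"
        "(\<gamma> \<longlongrightarrow> fst y) (at_left L)" "((\<lambda>t. sgn (\<gamma> t - fst y)) \<longlongrightarrow> snd y) (at_left L)"
    using assms unfolding rg_edge_def by blast
  then show ?thesis
    unfolding rg_edge_def
    using nat_arc_reverse[OF \<gamma>(1)] tendsto_reverse(1)[OF \<gamma>(4)] tendsto_reverse(1)[OF \<gamma>(5)]
      tendsto_reverse(2)[OF \<gamma>(2), of L] tendsto_reverse(2)[OF \<gamma>(3), of L]
    by (intro conjI exI[of _ "\<lambda>t. \<gamma> (L - t)"]) auto
qed

text \<open>Darboux's argument, as the derivative need not be continuous: the maximum on the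
  interval is interior, and there the derivative would vanish.\<close>

lemma deriv_sign_change_zero:
  fixes \<theta> :: "real \<Rightarrow> real"
  assumes "x < y" and d: "\<And>t. t \<in> {x..y} \<Longrightarrow> \<exists>h. h \<noteq> 0 \<and> (\<theta> has_real_derivative h) (at t)"
    and x: "(\<theta> has_real_derivative p) (at x)" "p > 0" and y: "(\<theta> has_real_derivative q) (at y)" "q < 0"
  shows False
proof -
  have "continuous_on {x..y} \<theta>"
    using d by (intro continuous_at_imp_continuous_on) (meson DERIV_isCont)
  then obtain z where z: "z \<in> {x..y}" "\<And>t. t \<in> {x..y} \<Longrightarrow> \<theta> t \<le> \<theta> z"
    using continuous_attains_sup[of "{x..y}" \<theta>] \<open>x < y\<close> by auto
  obtain e where e: "e > 0" "\<And>h. 0 < h \<Longrightarrow> h < e \<Longrightarrow> \<theta> x < \<theta> (x + h)"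
    using DERIV_pos_inc_right[OF x] by blast
  obtain e' where e': "e' > 0" "\<And>h. 0 < h \<Longrightarrow> h < e' \<Longrightarrow> \<theta> y < \<theta> (y - h)"
    using DERIV_neg_dec_left[OF y] by blast
  have "z \<noteq> x"
  proof
    assume "z = x"
    obtain h where h: "0 < h" "h < e" "h < y - x" using e(1) \<open>x < y\<close> field_lbound_gt_zero[of e "y - x"] by auto
    then show False using z(2)[of "x + h"] e(2)[of h] \<open>z = x\<close> by auto
  qed
  moreover have "z \<noteq> y"
  proof
    assume "z = y"
    obtain h where h: "0 < h" "h < e'" "h < y - x" using e'(1) \<open>x < y\<close> field_lbound_gt_zero[of e' "y - x"] by auto
    then show False using z(2)[of "y - h"] e'(2)[of h] \<open>z = y\<close> by auto
  qed
  ultimately have zi: "x < z" "z < y" using z(1) by auto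
  obtain h where h: "h \<noteq> 0" "(\<theta> has_real_derivative h) (at z)" using d z(1) by blast
  have "h = 0"
  proof (rule DERIV_local_max[OF h(2)])
    show "0 < min (z - x) (y - z)" using zi by auto
    show "\<forall>t. \<bar>z - t\<bar> < min (z - x) (y - z) \<longrightarrow> \<theta> t \<le> \<theta> z"
    proof (intro allI impI)
      fix t assume "\<bar>z - t\<bar> < min (z - x) (y - z)"
      then have "t \<in> {x..y}" unfolding atLeastAtMost_iff by linarith
      then show "\<theta> t \<le> \<theta> z" by (rule z(2))
    qed
  qed
  then show False using h(1) by simp
qed

text \<open>A natural arc fixes the derivative of the angle only up to a sign that might vary with
  t. By the Darboux property it cannot vary, so the angle is affine.\<close>

lemma affine_if_abs_deriv_const:
  fixes \<theta> :: "real \<Rightarrow> real"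
  assumes "L > 0" "m > 0"
    and d: "\<And>t. t \<in> {0<..<L} \<Longrightarrow> \<exists>h. \<bar>h\<bar> = m \<and> (\<theta> has_real_derivative h) (at t)"
  obtains s \<theta>0 where "s = 1 \<or> s = -1" "\<And>t. t \<in> {0<..<L} \<Longrightarrow> \<theta> t = \<theta>0 + s * m * t"
proof -
  have no: False if "x \<in> {0<..<L}" "y \<in> {0<..<L}" "x < y"
    "(\<theta> has_real_derivative p) (at x)" "(\<theta> has_real_derivative q) (at y)" "p * q < 0" for x y p q
  proof -
    have nz: "\<exists>h. h \<noteq> 0 \<and> (\<theta> has_real_derivative h) (at t)" if "t \<in> {x..y}" for t
      using d[of t] that \<open>x \<in> _\<close> \<open>y \<in> _\<close> \<open>m > 0\<close> by force
    have nz': "\<exists>h. h \<noteq> 0 \<and> ((\<lambda>t. - \<theta> t) has_real_derivative h) (at t)" if "t \<in> {x..y}" for t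
      using nz[OF that] by (metis DERIV_minus neg_equal_0_iff_equal)
    from \<open>p * q < 0\<close> consider "p > 0" "q < 0" | "- p > 0" "- q < 0" by (auto simp: mult_less_0_iff)
    then show False
      using deriv_sign_change_zero[OF \<open>x < y\<close> nz that(4) _ that(5)]
        deriv_sign_change_zero[OF \<open>x < y\<close> nz' DERIV_minus[OF that(4)] _ DERIV_minus[OF that(5)]]
      by cases auto
  qed
  have "L / 2 \<in> {0<..<L}" using \<open>L > 0\<close> by auto
  then obtain h0 where h0: "\<bar>h0\<bar> = m" "(\<theta> has_real_derivative h0) (at (L / 2))" using d by blast
  define s where "s = sgn h0"
  have s: "s = 1 \<or> s = -1" "h0 = s * m" using h0(1) \<open>m > 0\<close> by (auto simp: s_def sgn_if)
  have der: "(\<theta> has_real_derivative s * m) (at t)" if t: "t \<in> {0<..<L}" for t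
  proof -
    obtain h where h: "\<bar>h\<bar> = m" "(\<theta> has_real_derivative h) (at t)" using d[OF t] by blast
    have "h = h0"
    proof (rule ccontr)
      assume "h \<noteq> h0"
      then have "h = - h0" using h(1) h0(1) by linarith
      have "h0 * h0 > 0" using h0(1) \<open>m > 0\<close> by (metis abs_zero less_irrefl not_real_square_gt_zero)
      then have neg: "h * h0 < 0" "h0 * h < 0" using \<open>h = - h0\<close> by auto
      have "t \<noteq> L / 2" using \<open>h \<noteq> h0\<close> h(2) h0(2) DERIV_unique by blast
      then show False
        using no[OF t \<open>L / 2 \<in> _\<close> _ h(2) h0(2) neg(1)] no[OF \<open>L / 2 \<in> _\<close> t _ h0(2) h(2) neg(2)] by linarith
    qed
    then show ?thesis using h(2) s(2) by simp
  qed
  have "((\<lambda>t. \<theta> t - s * m * t) has_real_derivative 0) (at t within {0<..<L})" if "t \<in> {0<..<L}" for t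
    by (rule DERIV_subset) (auto intro!: derivative_eq_intros der that)
  then obtain \<theta>0 where "\<And>t. t \<in> {0<..<L} \<Longrightarrow> \<theta> t - s * m * t = \<theta>0"
    using has_field_derivative_zero_constant[of "{0<..<L}" "\<lambda>t. \<theta> t - s * m * t"] by auto
  then show thesis using that[of s \<theta>0] s(1) by (metis add.commute diff_add_cancel)
qed

lemma exp_ii_inj:
  assumes "exp (\<i> * of_real x) = exp (\<i> * of_real y)" "\<bar>x - y\<bar> < 2 * pi"
  shows "x = y"
proof -
  obtain n :: int where n: "\<i> * complex_of_real x = \<i> * of_real y + (of_int (2 * n) * pi) * \<i>"
    using assms(1) by (auto simp: exp_eq)
  then have "x = y + of_int (2 * n) * pi" by (simp add: complex_eq_iff)
  then have "x - y = 2 * pi * of_int n" by simp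
  then have "2 * pi * \<bar>of_int n\<bar> < 2 * pi * 1" using assms(2) by (simp add: abs_mult)
  then have "\<bar>of_int n :: real\<bar> < 1"
    using mult_less_cancel_left_pos[of "2 * pi" "\<bar>real_of_int n\<bar>" 1] by simp
  then have "n = 0" by linarith
  then show ?thesis using \<open>x - y = _\<close> by simp
qed

lemma cis_diff: "cis x - cis y = 2 * \<i> * of_real (sin ((x - y) / 2)) * cis ((x + y) / 2)"
proof -
  have "sin ((y - x) / 2) = - sin ((x - y) / 2)" by (metis minus_diff_eq minus_divide_left sin_minus)
  then show ?thesis by (simp add: complex_eq_iff cos_diff_cos sin_diff_sin)
qed

lemma eventually_greaterThanLessThan:
  "(0::real) < e \<Longrightarrow> eventually (\<lambda>t. t \<in> {0<..<e}) (at_right 0)"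
  "(0::real) < e \<Longrightarrow> eventually (\<lambda>t. t \<in> {0<..<e}) (at_left e)"
  by (rule eventually_at_right_real, assumption) (rule eventually_at_left_real, assumption)

context collinear_qd
begin

section \<open>Arcs on the critical level, their directions at the zeros and their lengths\<close>

lemma critical_level_if_limit_zero:
  assumes arc: "horiz_arc f P \<gamma> I" and lim: "(\<gamma> \<longlongrightarrow> v) F" "F \<noteq> bot" "eventually (\<lambda>t. t \<in> I) F"
    and v: "v \<in> {z1, z2}" and t: "t \<in> I"
  shows "norm (R (\<gamma> t)) = S"
proof -
  have Rlim: "((\<lambda>t. R (\<gamma> t)) \<longlongrightarrow> R v) F"
    using DERIV_isCont[OF R_deriv] z12_notin v lim(1) by (auto intro: isCont_tendsto_compose)
  have "((\<lambda>t. norm (R (\<gamma> t))) \<longlongrightarrow> norm (R v)) F" by (rule tendsto_norm[OF Rlim])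
  moreover have "eventually (\<lambda>s. norm (R (\<gamma> s)) = norm (R (\<gamma> t))) F"
    using lim(3) by eventually_elim (rule horiz_arc_norm_R[OF arc _ t])
  ultimately have "((\<lambda>s. norm (R (\<gamma> t))) \<longlongrightarrow> norm (R v)) F"
    by (rule Lim_transform_eventually)
  then have "norm (R (\<gamma> t)) = norm (R v)" using lim(2) by (simp add: tendsto_const_iff)
  then show ?thesis using v norm_v R_z1 R_z2 by auto
qed

text \<open>On the critical level V lies on the axes without vanishing, so its sign takes at most
  four values; being continuous on an interval, it is constant.\<close>

lemma critical_arc_branch:
  assumes arc: "horiz_arc f P \<gamma> I" and S: "\<And>t. t \<in> I \<Longrightarrow> norm (R (\<gamma> t)) = S"
  obtains k :: nat where "k < 4" "\<And>t. t \<in> I \<Longrightarrow> V (\<gamma> t) = \<i> ^ k * of_real (norm (V (\<gamma> t)))"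
proof -
  have reg: "\<gamma> t \<in> regset f P" if "t \<in> I" for t using arc that by (auto simp: horiz_arc_def)
  have nz: "V (\<gamma> t) \<noteq> 0" if "t \<in> I" for t
    using regset_notin[OF reg[OF that]] by (auto simp: V_def U_def)
  define g where "g t = sgn (V (\<gamma> t))" for t
  have val: "g t \<in> {1, \<i>, -1, - \<i>}" if t: "t \<in> I" for t
  proof -
    have "Re (g t) * Im (g t) = 0"
      using V_quadrant(3)[OF reg[OF t]] S[OF t] by (auto simp: g_def Re_sgn Im_sgn)
    moreover have "(Re (g t))\<^sup>2 + (Im (g t))\<^sup>2 = 1"
    proof -
      have "norm (g t) = 1" using norm_sgn[of "V (\<gamma> t)"] nz[OF t] by (simp add: g_def)
      then show ?thesis using cmod_power2[of "g t"] by simp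
    qed
    ultimately show ?thesis by (auto simp: complex_eq_iff power2_eq_1_iff)
  qed
  have "continuous_on I g"
    unfolding g_def sgn_div_norm using nz by (intro continuous_intros V_continuous[OF arc]) auto
  moreover have "connected I" using arc by (simp add: horiz_arc_def is_interval_connected)
  moreover have "finite (g ` I)" by (rule finite_subset[of _ "{1, \<i>, -1, - \<i>}"]) (use val in auto)
  ultimately have "g constant_on I" using continuous_finite_range_constant by blast
  then obtain x where x: "\<And>t. t \<in> I \<Longrightarrow> g t = x" by (auto simp: constant_on_def)
  obtain t0 where "t0 \<in> I" using arc by (auto simp: horiz_arc_def)
  then have "x \<in> {1, \<i>, -1, - \<i>}" using val x by metis
  then have "\<exists>k<4. x = \<i> ^ k"
  proof -
    have "\<i> ^ 0 = 1" "\<i> ^ 1 = \<i>" "\<i> ^ 2 = -1" "\<i> ^ 3 = - \<i>" by (simp_all add: eval_nat_numeral)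
    moreover have "(0::nat) < 4" "(1::nat) < 4" "(2::nat) < 4" "(3::nat) < 4" by simp_all
    ultimately show ?thesis using \<open>x \<in> _\<close> by (metis empty_iff insert_iff)
  qed
  then obtain k where k: "k < 4" "x = \<i> ^ k" by blast
  have "V (\<gamma> t) = \<i> ^ k * of_real (norm (V (\<gamma> t)))" if "t \<in> I" for t
    using x[OF that] nz[OF that] unfolding g_def k(2)
    by (simp add: sgn_div_norm scaleR_conv_of_real field_simps)
  then show thesis using that k(1) by blast
qed

text \<open>\<open>dir1\<close> and the following \<open>dir2\<close> are the directions at
  \<open>z1\<close> and \<open>z2\<close> of the branch on which V is positive.\<close>

definition dir1 where "dir1 = \<i> * cis (phi / 2)"
definition dir2 where "dir2 = - \<i> * cis (- (phi / 2))"

lemma sgn_z1_z2: "sgn (z1 - z2) = \<i>" "sgn (z2 - z1) = - \<i>"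
proof -
  have "z1 - z2 = of_real (2 * sqrt (A * B)) * \<i>" "z2 - z1 = of_real (2 * sqrt (A * B)) * (- \<i>)"
    by (simp_all add: z1_def z2_def)
  then show "sgn (z1 - z2) = \<i>" "sgn (z2 - z1) = - \<i>"
    using pos by (simp_all only: sgn_mult) (simp_all add: sgn_of_real sgn_eq)
qed

lemma sgn_U_branch:
  assumes "V z = \<i> ^ k * of_real (norm (V z))" "z \<noteq> z1" "z \<noteq> z2"
  shows "sgn (U z) = cis (phi / 2) * \<i> ^ k"
proof -
  have "V z \<noteq> 0" using assms(2,3) by (auto simp: V_def U_def)
  have "U z = cis (phi / 2) * \<i> ^ k * of_real (norm (V z))"
    unfolding U_V by (subst assms(1)) (simp add: mult.assoc)
  then have "sgn (U z) = sgn (cis (phi / 2)) * sgn (\<i> ^ k) * sgn (of_real (norm (V z)))"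
    by (simp only: sgn_mult)
  moreover have "sgn (of_real (norm (V z)) :: complex) = 1" using \<open>V z \<noteq> 0\<close> by (simp add: sgn_of_real)
  moreover have "sgn (cis (phi / 2)) = cis (phi / 2)" "sgn (\<i> ^ k) = \<i> ^ k"
    by (simp_all add: sgn_eq norm_power)
  ultimately show ?thesis by simp
qed

text \<open>Near \<open>z1\<close> the direction of z - z1 is that of \<open>U\<close> times the
  nearly constant direction of z - z2. Near the pole \<open>z2\<close> of \<open>U\<close> one
  divides instead, which turns powers of \<i> into powers of -\<i> and reverses the cyclic order
  there.\<close>

lemma direction_limit:
  assumes ev: "eventually (\<lambda>t. \<gamma> t \<notin> {z1, z2} \<and> V (\<gamma> t) = \<i> ^ k * of_real (norm (V (\<gamma> t)))) F"
  shows "(\<gamma> \<longlongrightarrow> z1) F \<Longrightarrow> ((\<lambda>t. sgn (\<gamma> t - z1)) \<longlongrightarrow> dir1 * \<i> ^ k) F"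
    and "(\<gamma> \<longlongrightarrow> z2) F \<Longrightarrow> ((\<lambda>t. sgn (\<gamma> t - z2)) \<longlongrightarrow> dir2 * (-\<i>) ^ k) F"
proof -
  assume lim: "(\<gamma> \<longlongrightarrow> z1) F"
  have "((\<lambda>t. cis (phi / 2) * \<i> ^ k * sgn (\<gamma> t - z2)) \<longlongrightarrow> cis (phi / 2) * \<i> ^ k * sgn (z1 - z2)) F"
    using z1_ne_z2 by (intro tendsto_intros lim) auto
  moreover have "eventually (\<lambda>t. cis (phi / 2) * \<i> ^ k * sgn (\<gamma> t - z2) = sgn (\<gamma> t - z1)) F"
    using ev
  proof eventually_elim
    case (elim t)
    then have "\<gamma> t - z1 = U (\<gamma> t) * (\<gamma> t - z2)" by (simp add: U_def)
    then have "sgn (\<gamma> t - z1) = sgn (U (\<gamma> t)) * sgn (\<gamma> t - z2)" by (simp only: sgn_mult)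
    then show ?case using sgn_U_branch[of "\<gamma> t" k] elim by simp
  qed
  ultimately have "((\<lambda>t. sgn (\<gamma> t - z1)) \<longlongrightarrow> cis (phi / 2) * \<i> ^ k * sgn (z1 - z2)) F"
    by (rule Lim_transform_eventually)
  then show "((\<lambda>t. sgn (\<gamma> t - z1)) \<longlongrightarrow> dir1 * \<i> ^ k) F"
    by (simp add: sgn_z1_z2 dir1_def mult_ac)
next
  assume lim: "(\<gamma> \<longlongrightarrow> z2) F"
  have inv: "cis (- (phi / 2)) * (-\<i>) ^ k * (cis (phi / 2) * \<i> ^ k) = 1"
  proof -
    have "cis (- (phi / 2)) * (-\<i>) ^ k * (cis (phi / 2) * \<i> ^ k) = (cis (- (phi / 2)) * cis (phi / 2)) * ((-\<i>) * \<i>) ^ k"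
      by (simp only: power_mult_distrib mult_ac)
    then show ?thesis by (simp add: cis_mult)
  qed
  have "((\<lambda>t. cis (- (phi / 2)) * (-\<i>) ^ k * sgn (\<gamma> t - z1)) \<longlongrightarrow> cis (- (phi / 2)) * (-\<i>) ^ k * sgn (z2 - z1)) F"
    using z1_ne_z2 by (intro tendsto_intros lim) auto
  moreover have "eventually (\<lambda>t. cis (- (phi / 2)) * (-\<i>) ^ k * sgn (\<gamma> t - z1) = sgn (\<gamma> t - z2)) F"
    using ev
  proof eventually_elim
    case (elim t)
    then have "\<gamma> t - z1 = U (\<gamma> t) * (\<gamma> t - z2)" by (simp add: U_def)
    then have "sgn (\<gamma> t - z1) = sgn (U (\<gamma> t)) * sgn (\<gamma> t - z2)" by (simp only: sgn_mult)
    then have "sgn (\<gamma> t - z1) = cis (phi / 2) * \<i> ^ k * sgn (\<gamma> t - z2)"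
      using sgn_U_branch[of "\<gamma> t" k] elim by simp
    then show ?case using inv by (metis mult.assoc mult_1)
  qed
  ultimately have "((\<lambda>t. sgn (\<gamma> t - z2)) \<longlongrightarrow> cis (- (phi / 2)) * (-\<i>) ^ k * sgn (z2 - z1)) F"
    by (rule Lim_transform_eventually)
  moreover have "cis (- (phi / 2)) * (-\<i>) ^ k * sgn (z2 - z1) = dir2 * (-\<i>) ^ k"
    unfolding sgn_z1_z2 dir2_def by (simp only: mult_ac)
  ultimately show "((\<lambda>t. sgn (\<gamma> t - z2)) \<longlongrightarrow> dir2 * (-\<i>) ^ k) F" by simp
qed

text \<open>The argument of \<open>v1\<close> when angles on the critical circle are measured from
  \<open>- v2\<close>. With this origin \<open>v2\<close> sits at the angles pi and -pi, on the cut
  of the logarithm, so an arc avoiding \<open>v2\<close> has a continuous angle between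
  them.\<close>

definition thstar where "thstar = 2 * phi - pi"

lemma v1_thstar: "v1 = - v2 * exp (\<i> * of_real thstar)"
proof -
  have "- v2 * exp (\<i> * of_real thstar) = of_real S * (cis (- phi) * cis pi * cis thstar)"
    by (simp add: v2_eq cis_conv_exp)
  also have "cis (- phi) * cis pi * cis thstar = cis phi" unfolding cis_mult by (simp add: thstar_def)
  finally show ?thesis by (simp add: v1_eq)
qed

text \<open>For w on the critical circle both w - v1 and w - v2 are chords. Their phases differ by
  the constant phi, as in the inscribed angle theorem, and the rotation in \<open>zt\<close> cancels
  it; a real quotient of half-angle sines remains, one of which is a cosine by the choice of
  origin.\<close>

lemma zt_angle:
  assumes "cos (\<theta> / 2) \<noteq> 0"
  shows "zt (- v2 * exp (\<i> * of_real \<theta>)) = of_real (sin ((\<theta> - thstar) / 2) / cos (\<theta> / 2))"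
proof -
  define \<Theta> where "\<Theta> = \<theta> + pi - phi"
  have w: "- v2 * exp (\<i> * of_real \<theta>) = of_real S * cis \<Theta>"
  proof -
    have "- v2 * exp (\<i> * of_real \<theta>) = of_real S * (cis (- phi) * cis pi * cis \<theta>)"
      by (simp add: v2_eq cis_conv_exp)
    also have "cis (- phi) * cis pi * cis \<theta> = cis \<Theta>" unfolding cis_mult by (simp add: \<Theta>_def algebra_simps)
    finally show ?thesis .
  qed
  define a b where "a = (\<Theta> - phi) / 2" and "b = (\<Theta> + phi) / 2"
  have "sin b = cos (\<theta> / 2)" unfolding b_def \<Theta>_def by (simp add: sin_cos_eq add_divide_distrib)
  then have sb: "sin b \<noteq> 0" using assms by simp
  have "cis \<Theta> - cis phi = 2 * \<i> * of_real (sin a) * cis b"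
    unfolding a_def b_def by (rule cis_diff)
  moreover have "cis \<Theta> - cis (- phi) = 2 * \<i> * of_real (sin b) * cis a"
    using cis_diff[of \<Theta> "- phi"] by (simp add: a_def b_def)
  ultimately have "(of_real S * cis \<Theta> - v1) / (of_real S * cis \<Theta> - v2)
      = (of_real S * (2 * \<i> * of_real (sin a) * cis b)) / (of_real S * (2 * \<i> * of_real (sin b) * cis a))"
    unfolding v1_eq v2_eq right_diff_distrib[symmetric] by simp
  also have "\<dots> = of_real (sin a / sin b) * (cis b / cis a)"
    using pos sb by (simp add: divide_simps)
  also have "cis b / cis a = cis phi" by (simp add: cis_divide a_def b_def field_simps)
  finally have "zt (of_real S * cis \<Theta>) = of_real (sin a / sin b) * (cis (- phi) * cis phi)"
    unfolding zt_def by simp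
  then show ?thesis unfolding w using \<open>sin b = cos (\<theta> / 2)\<close>
    by (simp add: cis_mult a_def \<Theta>_def thstar_def algebra_simps)
qed

text \<open>The critical values cut the circle of radius S into arcs of angle 2 pi - 2 phi and 2
  phi; division by 2 pi gives the lengths. Each arc has two lifts, of equal parity.\<close>

definition edge_len :: "nat \<Rightarrow> real" where
  "edge_len k = (if even k then 1 - phi / pi else phi / pi)"

lemma edge_len_bounds: "0 < edge_len k" "edge_len k < 1"
  using phi_bounds by (auto simp: edge_len_def)

end

context collinear_qd
begin

text \<open>The angle starts at \<open>thstar\<close>, the position of \<open>v1\<close>, and moves
  at speed 2 pi upwards for even k and downwards for odd k until it reaches \<open>v2\<close>. On
  the way \<open>zt\<close> has the constant sign \<open>s\<close>, which is the square of
  \<open>\<i> ^ k\<close>, so a real positive root \<open>y\<close> suffices.\<close>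

lemma edge_exists:
  obtains \<gamma> where "nat_arc f P \<gamma> {0<..<edge_len k}"
    "(\<gamma> \<longlongrightarrow> z1) (at_right 0)" "((\<lambda>t. sgn (\<gamma> t - z1)) \<longlongrightarrow> dir1 * \<i> ^ k) (at_right 0)"
    "(\<gamma> \<longlongrightarrow> z2) (at_left (edge_len k))"
    "((\<lambda>t. sgn (\<gamma> t - z2)) \<longlongrightarrow> dir2 * (-\<i>) ^ k) (at_left (edge_len k))"
proof -
  define L where "L = edge_len k"
  define s :: real where "s = (if even k then 1 else -1)"
  define th where "th t = thstar + s * (2 * pi * t)" for t
  define y where "y t = sqrt (sin (pi * t) / cos (th t / 2))" for t
  define u where "u t = cis (phi / 2) * \<i> ^ k * of_real (y t)" for t
  define w where "w t = - v2 * exp (\<i> * of_real (th t))" for t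
  define \<gamma> where "\<gamma> t = of_U (u t)" for t
  let ?I = "{0<..<L}"
  have L: "0 < L" "L < 1" using edge_len_bounds by (auto simp: L_def)
  have s: "s = 1 \<or> s = -1" "s * s = 1" by (auto simp: s_def)
  have cos_pos: "cos (th t / 2) > 0" if t: "t \<in> ?I" for t
  proof -
    have "pi * t < pi * L" "0 < pi * t" using t by auto
    moreover have "pi * L = (if even k then pi - phi else phi)"
      by (simp add: L_def edge_len_def right_diff_distrib)
    ultimately have "- pi < th t \<and> th t < pi"
      using phi_bounds by (auto simp: th_def s_def thstar_def split: if_splits)
    then show ?thesis by (intro cos_gt_zero_pi) auto
  qed
  have sin_pos: "sin (pi * t) > 0" if t: "t \<in> ?I" for t
  proof (rule sin_gt_zero)
    show "0 < pi * t" using t by auto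
    have "pi * t < pi * 1" using t L by (intro mult_strict_left_mono) auto
    then show "pi * t < pi" by simp
  qed
  have y2: "(y t)\<^sup>2 = sin (pi * t) / cos (th t / 2)" and y_pos: "y t > 0" if "t \<in> ?I" for t
    using cos_pos[OF that] sin_pos[OF that] by (simp_all add: y_def)
  have ztw: "zt (w t) = of_real (s * (y t)\<^sup>2)" if "t \<in> ?I" for t
  proof -
    have "sin ((th t - thstar) / 2) = s * sin (pi * t)" using s(1) by (auto simp: th_def)
    then show ?thesis using zt_angle[of "th t"] cos_pos[OF that] y2[OF that] by (simp add: w_def)
  qed
  have w: "w t \<notin> {v1, v2, 0}" if "t \<in> ?I" for t
    using ztw[OF that] y_pos[OF that] s(1) v2_nz by (auto simp: zt_def w_def)
  have ik2: "(\<i> ^ k)\<^sup>2 = of_real s"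
    by (simp add: s_def power_mult[symmetric] mult.commute[of k] power_mult)
  have u_sq: "(u t)\<^sup>2 = (w t - v1) / (w t - v2)" if "t \<in> ?I" for t
  proof -
    have "(u t)\<^sup>2 = (cis (phi / 2) * cis (phi / 2)) * ((\<i> ^ k)\<^sup>2 * of_real ((y t)\<^sup>2))"
      by (simp add: u_def power2_eq_square mult_ac)
    also have "\<dots> = cis phi * zt (w t)" unfolding ik2 ztw[OF that] cis_mult by simp
    also have "\<dots> = (w t - v1) / (w t - v2)" by (simp add: zt_def cis_mult flip: mult.assoc)
    finally show ?thesis .
  qed
  have dw: "(w has_vector_derivative w t * (\<i> * of_real (s * (2 * pi)))) (at t)" for t
  proof -
    have "((\<lambda>\<zeta>. - v2 * exp (\<i> * (of_real thstar + of_real s * (2 * of_real pi * \<zeta>)))) has_field_derivative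
        - v2 * exp (\<i> * (of_real thstar + of_real s * (2 * of_real pi * of_real t))) * (\<i> * of_real (s * (2 * pi)))) (at (of_real t))"
      by (rule derivative_eq_intros refl | simp)+
    from has_vector_derivative_real_field[OF this] show ?thesis unfolding w_def[abs_def] th_def by simp
  qed
  have du: "u differentiable at t" if t: "t \<in> ?I" for t
  proof -
    have "\<exists>D. ((\<lambda>t. sin (pi * t) / cos (th t / 2)) has_real_derivative D) (at t)"
      unfolding th_def using cos_pos[OF t, unfolded th_def]
      by (intro exI) (rule derivative_eq_intros refl | simp)+
    then obtain D where D: "((\<lambda>t. sin (pi * t) / cos (th t / 2)) has_real_derivative D) (at t)" by blast
    have "sin (pi * t) / cos (th t / 2) > 0" using cos_pos[OF t] sin_pos[OF t] by simp
    from DERIV_chain2[OF DERIV_real_sqrt[OF this] D]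
    obtain D' where "(y has_vector_derivative D') (at t)"
      unfolding y_def[abs_def] by (auto simp: has_real_derivative_iff_has_vector_derivative)
    then have "(\<lambda>t. complex_of_real (y t)) differentiable at t"
      by (rule differentiableI_vector[OF bounded_linear.has_vector_derivative[OF bounded_linear_of_real]])
    then show ?thesis unfolding u_def by (intro differentiable_mult) auto
  qed
  have reg: "\<gamma> t \<in> regset f P" if "t \<in> ?I" for t
    using of_U_regset[OF u_sq[OF that]] w[OF that] by (auto simp: \<gamma>_def)
  have arc: "nat_arc f P \<gamma> ?I"
    unfolding nat_arc_iff
  proof (intro conjI ballI)
    fix t assume t: "t \<in> ?I"
    obtain g where "(\<gamma> has_vector_derivative g) (at t)" "om (\<gamma> t) * g = \<i> * of_real (s * (2 * pi))"
      using lift_deriv[OF _ t u_sq w du[OF t] dw] unfolding \<gamma>_def[abs_def] by auto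
    moreover have "\<bar>s * (2 * pi)\<bar> = 2 * pi" using s(1) by auto
    ultimately show "\<exists>g h. (\<gamma> has_vector_derivative g) (at t) \<and> \<bar>h\<bar> = 2 * pi \<and> om (\<gamma> t) * g = \<i> * complex_of_real h"
      by blast
  qed (use L reg in auto)
  have cont_th: "isCont (\<lambda>t. cos (th t / 2)) t" for t
    unfolding th_def by (intro continuous_intros) simp
  have lim1: "(\<gamma> \<longlongrightarrow> z1) (at_right 0)"
  proof -
    have th0: "th 0 / 2 = phi - pi / 2" by (simp add: th_def thstar_def field_simps)
    have c0: "cos (th 0 / 2) > 0" unfolding th0 using sin_phi_pos by (simp add: cos_diff)
    have "isCont y 0" unfolding y_def[abs_def] using c0 by (intro continuous_intros cont_th) auto
    then have "isCont u 0" unfolding u_def[abs_def] by (intro continuous_intros)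
    moreover have "u 0 = 0" by (simp add: u_def y_def)
    moreover have "isCont of_U 0" unfolding of_U_def[abs_def] by (intro continuous_intros) auto
    ultimately have "isCont (\<lambda>t. of_U (u t)) 0" by (metis isCont_o2)
    then have "((\<lambda>t. of_U (u t)) \<longlongrightarrow> of_U (u 0)) (at_right 0)"
      unfolding isCont_def by (rule tendsto_within_subset) simp
    moreover have "of_U (u 0) = z1" by (simp add: u_def y_def of_U_def z1_def)
    ultimately show ?thesis by (simp add: \<gamma>_def[abs_def])
  qed
  \<comment> \<open>At the far end V tends to infinity, so the limit is taken in the reciprocal
    coordinate, in which the Moebius map \<open>of_U\<close> is continuous at 0.\<close>
  define y' where "y' t = sqrt (cos (th t / 2) / sin (pi * t))" for t
  define u' where "u' t = inverse (cis (phi / 2) * \<i> ^ k) * of_real (y' t)" for t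
  have lim2: "(\<gamma> \<longlongrightarrow> z2) (at_left L)"
  proof -
    have "th L = s * pi" by (simp add: th_def thstar_def L_def edge_len_def s_def field_simps)
    then have c0: "cos (th L / 2) = 0" using s(1) by auto
    have "sin (pi * L) > 0" using L by (intro sin_gt_zero) auto
    then have "isCont y' L" unfolding y'_def[abs_def] by (intro continuous_intros cont_th) auto
    then have cu': "isCont u' L" unfolding u'_def[abs_def] by (intro continuous_intros)
    have u'0: "u' L = 0" by (simp add: u'_def y'_def c0)
    define G where "G t = of_real rc + \<i> * of_real (sqrt (A * B)) * (u' t + 1) / (u' t - 1)" for t
    have "isCont G L" unfolding G_def[abs_def] using u'0 by (intro continuous_intros cu') auto
    then have lim: "(G \<longlongrightarrow> G L) (at_left L)"
      unfolding isCont_def by (rule tendsto_within_subset) simp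
    have "G L = z2" by (simp add: G_def u'0 z2_def)
    have "eventually (\<lambda>t. G t = \<gamma> t) (at_left L)"
      using eventually_greaterThanLessThan(2)[OF L(1)]
    proof eventually_elim
      case (elim t)
      have "y t * y' t = sqrt ((sin (pi * t) / cos (th t / 2)) * (cos (th t / 2) / sin (pi * t)))"
        unfolding y_def y'_def real_sqrt_mult ..
      also have "\<dots> = 1" using cos_pos[OF elim] sin_pos[OF elim] by simp
      finally have yy': "of_real (y t) * of_real (y' t) = (1 :: complex)" by (metis of_real_1 of_real_mult)
      have "u t * u' t = ((cis (phi / 2) * \<i> ^ k) * inverse (cis (phi / 2) * \<i> ^ k)) * (of_real (y t) * of_real (y' t))"
        unfolding u_def u'_def by (simp only: mult_ac)
      moreover have "(cis (phi / 2) * \<i> ^ k) * inverse (cis (phi / 2) * \<i> ^ k) = 1"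
        by (rule right_inverse) simp
      ultimately have uu': "u t * u' t = 1" unfolding yy' by simp
      then have nz: "u t \<noteq> 0" by auto
      have "u' t = 1 / u t" using uu' nz by (simp add: field_simps)
      then have "u' t + 1 = (1 + u t) / u t" "u' t - 1 = (1 - u t) / u t"
        using nz by (simp_all add: diff_divide_distrib add_divide_distrib)
      then have "(u' t + 1) / (u' t - 1) = (1 + u t) / (1 - u t)" using nz by simp
      then show ?case unfolding G_def \<gamma>_def of_U_def by (simp only: times_divide_eq_right[symmetric])
    qed
    from Lim_transform_eventually[OF lim this] show ?thesis using \<open>G L = z2\<close> by simp
  qed
  have br: "\<gamma> t \<notin> {z1, z2} \<and> V (\<gamma> t) = \<i> ^ k * of_real (norm (V (\<gamma> t)))" if t: "t \<in> ?I" for t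
  proof -
    have "U (\<gamma> t) = u t" unfolding \<gamma>_def using of_U_level(1)[OF u_sq[OF t]] w[OF t] by (intro U_of_U) auto
    then have "V (\<gamma> t) = (cis (- (phi / 2)) * cis (phi / 2)) * \<i> ^ k * of_real (y t)"
      unfolding V_def u_def by (simp only: mult.assoc)
    then have "V (\<gamma> t) = \<i> ^ k * of_real (y t)" by (simp add: cis_mult)
    moreover from this have "norm (V (\<gamma> t)) = y t" using y_pos[OF t] by (simp add: norm_mult norm_power)
    ultimately show ?thesis using regset_notin[OF reg[OF t]] by simp
  qed
  show thesis
  proof (rule that)
    show "nat_arc f P \<gamma> {0<..<edge_len k}" "(\<gamma> \<longlongrightarrow> z1) (at_right 0)" "(\<gamma> \<longlongrightarrow> z2) (at_left (edge_len k))"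
      using arc lim1 lim2 by (simp_all add: L_def)
    show "((\<lambda>t. sgn (\<gamma> t - z1)) \<longlongrightarrow> dir1 * \<i> ^ k) (at_right 0)"
      by (rule direction_limit(1)[OF eventually_mono[OF eventually_greaterThanLessThan(1)[OF L(1)] br] lim1])
    show "((\<lambda>t. sgn (\<gamma> t - z2)) \<longlongrightarrow> dir2 * (-\<i>) ^ k) (at_left (edge_len k))"
      using direction_limit(2)[OF eventually_mono[OF eventually_greaterThanLessThan(2)[OF L(1)] br] lim2]
      by (simp add: L_def)
  qed
qed

lemma zero_angle:
  assumes v: "v \<in> {z1, z2}" and R: "R v = - v2 * exp (\<i> * of_real x)" and x: "- pi \<le> x" "x \<le> pi"
  shows "v = z1 \<and> x = thstar \<or> v = z2 \<and> (x = pi \<or> x = - pi)"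
proof (cases "v = z1")
  case True
  have "exp (\<i> * of_real x) = exp (\<i> * of_real thstar)"
    using R v1_thstar v2_nz unfolding True R_z1 by simp
  then have "x = thstar" by (rule exp_ii_inj) (use x phi_bounds in \<open>auto simp: thstar_def\<close>)
  then show ?thesis using True by simp
next
  case False
  then have "v = z2" using v by simp
  then have "exp (\<i> * of_real x) = exp (\<i> * of_real pi)" using R v2_nz by (simp add: R_z2) (metis minus_equation_iff mult_cancel_left1 mult_minus_right)
  then have "x = pi" if "x \<noteq> - pi" by (rule exp_ii_inj) (use x that in auto)
  then show ?thesis using \<open>v = z2\<close> by blast
qed

text \<open>The quotient of R by \<open>- v2\<close> has modulus 1 and is never -1, because the arc
  avoids the fibre over \<open>v2\<close>; the principal logarithm is therefore differentiable along
  it.\<close>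

lemma critical_arc_angle:
  assumes arc: "nat_arc f P \<gamma> I" and S: "\<And>t. t \<in> I \<Longrightarrow> norm (R (\<gamma> t)) = S"
  obtains \<theta> where "\<And>t. t \<in> I \<Longrightarrow> R (\<gamma> t) = - v2 * exp (\<i> * of_real (\<theta> t))"
    "\<And>t. t \<in> I \<Longrightarrow> - pi < \<theta> t \<and> \<theta> t < pi"
    "\<And>t. t \<in> I \<Longrightarrow> \<exists>h. \<bar>h\<bar> = 2 * pi \<and> (\<theta> has_real_derivative h) (at t)"
proof -
  define q where "q t = - R (\<gamma> t) / v2" for t
  define \<theta> where "\<theta> t = Im (Ln (q t))" for t
  have reg: "\<gamma> t \<in> regset f P" if "t \<in> I" for t using arc that by (auto simp: nat_arc_def)
  have nq: "norm (q t) = 1" if "t \<in> I" for t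
    using S[OF that] norm_v pos by (simp add: q_def norm_divide)
  have q1: "q t \<noteq> -1" if "t \<in> I" for t
    using regset_notin[OF reg[OF that]] v2_nz by (auto simp: q_def field_simps)
  have q: "q t \<notin> \<real>\<^sub>\<le>\<^sub>0" if "t \<in> I" for t
  proof
    assume "q t \<in> \<real>\<^sub>\<le>\<^sub>0"
    then have "Im (q t) = 0" "Re (q t) \<le> 0" by (auto simp: complex_nonpos_Reals_iff)
    moreover from this nq[OF that] have "\<bar>Re (q t)\<bar> = 1" by (simp add: cmod_def)
    ultimately have "q t = -1" by (simp add: complex_eq_iff)
    then show False using q1[OF that] by simp
  qed
  have Ln_q: "Ln (q t) = \<i> * of_real (\<theta> t)" if "t \<in> I" for t
  proof -
    have "q t \<noteq> 0" using nq[OF that] by auto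
    then have "Re (Ln (q t)) = 0" using nq[OF that] by simp
    then show ?thesis by (simp add: complex_eq_iff \<theta>_def)
  qed
  have exp_q: "q t = exp (\<i> * of_real (\<theta> t))" if "t \<in> I" for t
    using exp_Ln[of "q t"] nq[OF that] unfolding Ln_q[OF that] by fastforce
  show thesis
  proof (rule that)
    fix t assume t: "t \<in> I"
    show "R (\<gamma> t) = - v2 * exp (\<i> * of_real (\<theta> t))"
      using exp_q[OF t] v2_nz by (simp add: q_def field_simps) (metis minus_minus)
    have "q t \<noteq> 0" using nq[OF t] by auto
    have "\<theta> t \<noteq> pi" using exp_q[OF t] q1[OF t] by auto
    then show "- pi < \<theta> t \<and> \<theta> t < pi"
      using mpi_less_Im_Ln[OF \<open>q t \<noteq> 0\<close>] Im_Ln_le_pi[OF \<open>q t \<noteq> 0\<close>] by (simp add: \<theta>_def)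
    obtain g h where gh: "(\<gamma> has_vector_derivative g) (at t)" "\<bar>h\<bar> = 2 * pi" "om (\<gamma> t) * g = \<i> * complex_of_real h"
      using arc t unfolding nat_arc_iff by blast
    have "((\<lambda>t. R (\<gamma> t)) has_vector_derivative R (\<gamma> t) * (\<i> * of_real h)) (at t)"
      using R_comp_deriv[OF gh(1) reg[OF t]] gh(3) by simp
    then have "((\<lambda>t. (- 1 / v2) * R (\<gamma> t)) has_vector_derivative (- 1 / v2) * (R (\<gamma> t) * (\<i> * of_real h))) (at t)"
      by (rule has_vector_derivative_mult_right)
    then have dq: "(q has_vector_derivative q t * (\<i> * of_real h)) (at t)"
      unfolding q_def[abs_def] by simp
    from field_vector_diff_chain_at[OF dq has_field_derivative_Ln[OF q[OF t]]]
    moreover have "q t * (\<i> * of_real h) * inverse (q t) = \<i> * of_real h"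
      using \<open>q t \<noteq> 0\<close> by (simp add: field_simps)
    ultimately have "((\<lambda>t. Ln (q t)) has_vector_derivative \<i> * of_real h) (at t)"
      unfolding o_def by metis
    from bounded_linear.has_vector_derivative[OF bounded_linear_Im this]
    have "(\<theta> has_real_derivative h) (at t)"
      unfolding \<theta>_def[abs_def] by (simp add: has_real_derivative_iff_has_vector_derivative)
    then show "\<exists>h. \<bar>h\<bar> = 2 * pi \<and> (\<theta> has_real_derivative h) (at t)" using gh(2) by blast
  qed
qed

text \<open>The angle of R is affine with slope 2 pi or -2 pi, stays on the side of
  \<open>thstar\<close> prescribed by the parity of the branch, and can only start and end at the
  angles of \<open>v1\<close> and \<open>v2\<close>. It must sweep a whole arc of the critical
  circle, which determines the length.\<close>

lemma edge_unique:
  assumes arc: "nat_arc f P \<gamma> {0<..<L}" and L: "L > 0"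
    and lim: "(\<gamma> \<longlongrightarrow> v) (at_right 0)" "(\<gamma> \<longlongrightarrow> v') (at_left L)"
    and v: "v \<in> {z1, z2}" "v' \<in> {z1, z2}"
  obtains k :: nat where "k < 4" "L = edge_len k" "v \<noteq> v'"
    "\<And>t. t \<in> {0<..<L} \<Longrightarrow> \<gamma> t \<notin> {z1, z2} \<and> V (\<gamma> t) = \<i> ^ k * of_real (norm (V (\<gamma> t)))"
proof -
  let ?I = "{0<..<L}"
  note ev = eventually_greaterThanLessThan[OF L]
  have harc: "horiz_arc f P \<gamma> ?I" by (rule nat_imp_horiz[OF arc])
  have reg: "\<gamma> t \<in> regset f P" if "t \<in> ?I" for t using arc that by (auto simp: nat_arc_def)
  have S: "norm (R (\<gamma> t)) = S" if "t \<in> ?I" for t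
    by (rule critical_level_if_limit_zero[OF harc lim(1) _ ev(1) v(1) that]) simp
  obtain k :: nat where k: "k < 4" "\<And>t. t \<in> ?I \<Longrightarrow> V (\<gamma> t) = \<i> ^ k * of_real (norm (V (\<gamma> t)))"
    using critical_arc_branch[OF harc S] by blast
  obtain \<theta> where \<theta>: "\<And>t. t \<in> ?I \<Longrightarrow> R (\<gamma> t) = - v2 * exp (\<i> * of_real (\<theta> t))"
    "\<And>t. t \<in> ?I \<Longrightarrow> - pi < \<theta> t \<and> \<theta> t < pi"
    "\<And>t. t \<in> ?I \<Longrightarrow> \<exists>h. \<bar>h\<bar> = 2 * pi \<and> (\<theta> has_real_derivative h) (at t)"
    using critical_arc_angle[OF arc S] by blast
  obtain s \<theta>0 where s: "s = 1 \<or> s = -1" and aff: "\<And>t. t \<in> ?I \<Longrightarrow> \<theta> t = \<theta>0 + s * (2 * pi) * t"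
    using affine_if_abs_deriv_const[OF L _ \<theta>(3)] pi_gt_zero by (metis mult_pos_pos zero_less_numeral)
  \<comment> \<open>The sign of the square of V is given by the parity of k, and by
    \<open>zt_angle\<close> it is also the sign of the angle relative to
    \<open>thstar\<close>.\<close>
  have side: "if even k then \<theta> t > thstar else \<theta> t < thstar" if t: "t \<in> ?I" for t
  proof -
    have c: "cos (\<theta> t / 2) > 0" using \<theta>(2)[OF t] by (intro cos_gt_zero_pi) auto
    define n where "n = (norm (V (\<gamma> t)))\<^sup>2"
    have "V (\<gamma> t) \<noteq> 0" using regset_notin[OF reg[OF t]] by (auto simp: V_def U_def)
    then have n: "n > 0" by (simp add: n_def)
    have "(V (\<gamma> t))\<^sup>2 = (\<i> ^ k)\<^sup>2 * of_real n"
      by (subst k(2)[OF t]) (simp add: power_mult_distrib n_def)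
    also have "(\<i> ^ k)\<^sup>2 = of_real (if even k then 1 else -1)"
      by (simp add: power_mult[symmetric] mult.commute[of k] power_mult)
    finally have "(V (\<gamma> t))\<^sup>2 = of_real ((if even k then 1 else -1) * n)" by simp
    moreover have "(V (\<gamma> t))\<^sup>2 = of_real (sin ((\<theta> t - thstar) / 2) / cos (\<theta> t / 2))"
      using V_sq[of "\<gamma> t"] regset_notin[OF reg[OF t]] \<theta>(1)[OF t] zt_angle[of "\<theta> t"] c by simp
    ultimately have "sin ((\<theta> t - thstar) / 2) / cos (\<theta> t / 2) = (if even k then 1 else -1) * n"
      by (metis of_real_eq_iff)
    then have sn: "sin ((\<theta> t - thstar) / 2) = (if even k then 1 else -1) * n * cos (\<theta> t / 2)"
      using c by (simp add: field_simps)
    have bd: "\<bar>(\<theta> t - thstar) / 2\<bar> < pi" using \<theta>(2)[OF t] phi_bounds by (auto simp: thstar_def)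
    show ?thesis
    proof (cases "even k")
      case True
      then have "sin ((\<theta> t - thstar) / 2) > 0" using sn n c by simp
      moreover have "sin x \<le> 0" if "x \<le> 0" "\<bar>x\<bar> < pi" for x :: real
        using sin_ge_zero[of "- x"] that by auto
      ultimately have "\<not> (\<theta> t - thstar) / 2 \<le> 0" using bd by (meson not_le)
      then show ?thesis using True by simp
    next
      case False
      then have "sin ((\<theta> t - thstar) / 2) < 0" using sn n c by simp
      then have "\<not> (\<theta> t - thstar) / 2 \<ge> 0" using bd sin_ge_zero[of "(\<theta> t - thstar) / 2"] by auto
      then show ?thesis using False by simp
    qed
  qed
  define \<theta>L where "\<theta>L = \<theta>0 + s * (2 * pi) * L"
  \<comment> \<open>Stated for a general filter so that one limit argument serves both ends.\<close>
  have end_angle: "- pi \<le> x \<and> x \<le> pi \<and> (if even k then x \<ge> thstar else x \<le> thstar) \<and>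
      (v0 = z1 \<and> x = thstar \<or> v0 = z2 \<and> (x = pi \<or> x = - pi))"
    if F: "F \<noteq> bot" "eventually (\<lambda>t. t \<in> ?I) F" "(\<gamma> \<longlongrightarrow> v0) F" "v0 \<in> {z1, z2}"
      and x: "((\<lambda>t. \<theta>0 + s * (2 * pi) * t) \<longlongrightarrow> x) F" for F x v0
  proof -
    have x: "(\<theta> \<longlongrightarrow> x) F"
      using x by (rule Lim_transform_eventually) (use F(2) aff in \<open>auto elim: eventually_mono\<close>)
    have ge: "x \<ge> y" if "\<And>t. t \<in> ?I \<Longrightarrow> \<theta> t \<ge> y" for y
      by (rule tendsto_lowerbound[OF x eventually_mono[OF F(2) that] F(1)])
    have le: "x \<le> y" if "\<And>t. t \<in> ?I \<Longrightarrow> \<theta> t \<le> y" for y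
      by (rule tendsto_upperbound[OF x eventually_mono[OF F(2) that] F(1)])
    have b: "- pi \<le> x" "x \<le> pi" by (rule ge le; use \<theta>(2) in \<open>force intro: less_imp_le\<close>)+
    have sd: "if even k then x \<ge> thstar else x \<le> thstar"
    proof (cases "even k")
      case True
      then have "thstar \<le> \<theta> t" if "t \<in> ?I" for t using side[OF that] by simp
      from ge[OF this] show ?thesis using True by simp
    next
      case False
      then have "\<theta> t \<le> thstar" if "t \<in> ?I" for t using side[OF that] by simp
      from le[OF this] show ?thesis using False by simp
    qed
    have "((\<lambda>t. R (\<gamma> t)) \<longlongrightarrow> R v0) F"
      using DERIV_isCont[OF R_deriv] z12_notin F(3,4) by (auto intro: isCont_tendsto_compose)
    moreover have "((\<lambda>t. - v2 * exp (\<i> * of_real (\<theta> t))) \<longlongrightarrow> - v2 * exp (\<i> * of_real x)) F"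
      by (intro tendsto_intros x)
    then have "((\<lambda>t. R (\<gamma> t)) \<longlongrightarrow> - v2 * exp (\<i> * of_real x)) F"
      by (rule Lim_transform_eventually) (use F(2) \<theta>(1) in \<open>auto elim: eventually_mono\<close>)
    ultimately have "R v0 = - v2 * exp (\<i> * of_real x)" using F(1) tendsto_unique by blast
    from zero_angle[OF F(4) this b] show ?thesis using b sd by blast
  qed
  have "((\<lambda>t. \<theta>0 + s * (2 * pi) * t) \<longlongrightarrow> \<theta>0 + s * (2 * pi) * 0) (at_right 0)" by (intro tendsto_intros)
  then have e0: "- pi \<le> \<theta>0 \<and> \<theta>0 \<le> pi \<and> (if even k then \<theta>0 \<ge> thstar else \<theta>0 \<le> thstar) \<and>
      (v = z1 \<and> \<theta>0 = thstar \<or> v = z2 \<and> (\<theta>0 = pi \<or> \<theta>0 = - pi))"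
    using end_angle[OF _ ev(1) lim(1) v(1)] by simp
  have "((\<lambda>t. \<theta>0 + s * (2 * pi) * t) \<longlongrightarrow> \<theta>L) (at_left L)" unfolding \<theta>L_def by (intro tendsto_intros)
  then have eL: "- pi \<le> \<theta>L \<and> \<theta>L \<le> pi \<and> (if even k then \<theta>L \<ge> thstar else \<theta>L \<le> thstar) \<and>
      (v' = z1 \<and> \<theta>L = thstar \<or> v' = z2 \<and> (\<theta>L = pi \<or> \<theta>L = - pi))"
    using end_angle[OF _ ev(2) lim(2) v(2)] by simp
  have ts: "- pi < thstar" "thstar < pi" using phi_bounds by (auto simp: thstar_def)
  have "\<theta>L - \<theta>0 = 2 * pi * L \<or> \<theta>L - \<theta>0 = - (2 * pi * L)" using s by (auto simp: \<theta>L_def)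
  moreover have "2 * pi * L > 0" using L by simp
  ultimately have diff: "\<bar>\<theta>L - \<theta>0\<bar> = 2 * pi * L" "\<theta>L \<noteq> \<theta>0" by auto
  \<comment> \<open>For each parity only two end angles are admissible, one belonging to
    \<open>z1\<close> and the other to \<open>z2\<close>. As the angle has moved, both
    occur.\<close>
  have "v \<noteq> v' \<and> \<bar>\<theta>L - \<theta>0\<bar> = (if even k then pi - thstar else thstar + pi)"
    using e0 eL diff(2) ts z1_ne_z2 by (cases "even k") auto
  then have "v \<noteq> v'" "2 * pi * L = (if even k then pi - thstar else thstar + pi)"
    using diff(1) by auto
  moreover from this(2) have "L = edge_len k"
    by (auto simp: edge_len_def thstar_def field_simps split: if_splits)
  ultimately show thesis using that k regset_notin[OF reg] by blast
qed

section \<open>Darts and edges of the critical graph\<close>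

lemma leaves_zero_direction:
  assumes "leaves_zero f P v d"
  shows "v = z1 \<and> d \<in> quarter_turns dir1 \<or> v = z2 \<and> d \<in> quarter_turns dir2"
proof -
  obtain \<gamma> e where \<gamma>: "e > 0" "horiz_arc f P \<gamma> {0<..<e}" "(\<gamma> \<longlongrightarrow> v) (at_right 0)"
      "((\<lambda>t. sgn (\<gamma> t - v)) \<longlongrightarrow> d) (at_right 0)" and v: "v \<in> {z1, z2}"
    using assms unfolding leaves_zero_def qzeros_eq by blast
  note ev = eventually_greaterThanLessThan(1)[OF \<gamma>(1)]
  have S: "norm (R (\<gamma> t)) = S" if "t \<in> {0<..<e}" for t
    by (rule critical_level_if_limit_zero[OF \<gamma>(2,3) _ ev v that]) simp
  obtain k :: nat where k: "\<And>t. t \<in> {0<..<e} \<Longrightarrow> V (\<gamma> t) = \<i> ^ k * of_real (norm (V (\<gamma> t)))"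
    using critical_arc_branch[OF \<gamma>(2) S] by blast
  have "\<gamma> t \<in> regset f P" if "t \<in> {0<..<e}" for t using \<gamma>(2) that by (auto simp: horiz_arc_def)
  then have "\<gamma> t \<notin> {z1, z2} \<and> V (\<gamma> t) = \<i> ^ k * of_real (norm (V (\<gamma> t)))" if "t \<in> {0<..<e}" for t
    using regset_notin k that by blast
  note dl = direction_limit[OF eventually_mono[OF ev this]]
  from v show ?thesis
  proof (elim insertE emptyE)
    assume "v = z1"
    then have "d = dir1 * \<i> ^ k" using tendsto_unique[OF _ \<gamma>(4)] dl(1) \<gamma>(3) by simp
    then show ?thesis using \<open>v = z1\<close> quarter_turns_power(1) by blast
  next
    assume "v = z2"
    then have "d = dir2 * (-\<i>) ^ k" using tendsto_unique[OF _ \<gamma>(4)] dl(2) \<gamma>(3) by simp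
    then show ?thesis using \<open>v = z2\<close> quarter_turns_power(2) by blast
  qed
qed

lemma rg_darts_eq: "rg_darts f P = {z1} \<times> quarter_turns dir1 \<union> {z2} \<times> quarter_turns dir2"
proof
  show "rg_darts f P \<subseteq> {z1} \<times> quarter_turns dir1 \<union> {z2} \<times> quarter_turns dir2"
    using leaves_zero_direction by (auto simp: rg_darts_def)
  \<comment> \<open>Edge k provides a dart at each end, the second one after reversing the
    parametrization.\<close>
  have "leaves_zero f P z1 (dir1 * \<i> ^ k) \<and> leaves_zero f P z2 (dir2 * (-\<i>) ^ k)" for k
  proof -
    obtain \<gamma> where \<gamma>: "nat_arc f P \<gamma> {0<..<edge_len k}"
      "(\<gamma> \<longlongrightarrow> z1) (at_right 0)" "((\<lambda>t. sgn (\<gamma> t - z1)) \<longlongrightarrow> dir1 * \<i> ^ k) (at_right 0)"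
      "(\<gamma> \<longlongrightarrow> z2) (at_left (edge_len k))"
      "((\<lambda>t. sgn (\<gamma> t - z2)) \<longlongrightarrow> dir2 * (-\<i>) ^ k) (at_left (edge_len k))"
      by (rule edge_exists)
    have "leaves_zero f P z1 (dir1 * \<i> ^ k)"
      unfolding leaves_zero_def qzeros_eq using nat_imp_horiz[OF \<gamma>(1)] \<gamma>(2,3) edge_len_bounds(1) by blast
    moreover have "leaves_zero f P z2 (dir2 * (-\<i>) ^ k)"
      unfolding leaves_zero_def qzeros_eq
      using nat_imp_horiz[OF nat_arc_reverse[OF \<gamma>(1)]] tendsto_reverse(1)[OF \<gamma>(4)] tendsto_reverse(1)[OF \<gamma>(5)]
        edge_len_bounds(1) by blast
    ultimately show ?thesis ..
  qed
  then show "{z1} \<times> quarter_turns dir1 \<union> {z2} \<times> quarter_turns dir2 \<subseteq> rg_darts f P"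
    unfolding times_quarter_turns(1)[of z1] times_quarter_turns(2)[of z2] rg_darts_def by auto
qed

lemma dir_nz: "dir1 \<noteq> 0" "dir2 \<noteq> 0"
  by (simp_all add: dir1_def dir2_def)

lemma edge_len_cong: "(even j \<longleftrightarrow> even k) \<Longrightarrow> edge_len j = edge_len k"
  by (simp add: edge_len_def)

lemma rg_edge_distinct:
  assumes "rg_edge f P x y L"
  shows "fst x \<noteq> fst y"
proof -
  obtain \<gamma> where "L > 0" "nat_arc f P \<gamma> {0<..<L}" "(\<gamma> \<longlongrightarrow> fst x) (at_right 0)" "(\<gamma> \<longlongrightarrow> fst y) (at_left L)"
    "x \<in> rg_darts f P" "y \<in> rg_darts f P"
    using assms unfolding rg_edge_def by blast
  moreover have "fst x \<in> {z1, z2}" "fst y \<in> {z1, z2}"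
    using \<open>x \<in> _\<close> \<open>y \<in> _\<close> unfolding rg_darts_eq by auto
  ultimately show ?thesis using edge_unique by metis
qed

text \<open>The initial direction fixes the power \<open>\<i> ^ k\<close>, hence the branch of V.
  The branch determines the direction of arrival and, through its parity, the length.\<close>

lemma rg_edge_z1: "rg_edge f P (z1, dir1 * \<i> ^ k) y L \<longleftrightarrow> y = (z2, dir2 * (-\<i>) ^ k) \<and> L = edge_len k"
proof
  assume e: "rg_edge f P (z1, dir1 * \<i> ^ k) y L"
  then obtain \<gamma> where \<gamma>: "L > 0" "nat_arc f P \<gamma> {0<..<L}" "(\<gamma> \<longlongrightarrow> z1) (at_right 0)"
    "((\<lambda>t. sgn (\<gamma> t - z1)) \<longlongrightarrow> dir1 * \<i> ^ k) (at_right 0)" "(\<gamma> \<longlongrightarrow> fst y) (at_left L)"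
    "((\<lambda>t. sgn (\<gamma> t - fst y)) \<longlongrightarrow> snd y) (at_left L)" "y \<in> rg_darts f P"
    unfolding rg_edge_def by auto
  have y: "fst y = z2" using rg_edge_distinct[OF e] \<gamma>(7) unfolding rg_darts_eq by auto
  obtain j :: nat where j: "L = edge_len j"
    "\<And>t. t \<in> {0<..<L} \<Longrightarrow> \<gamma> t \<notin> {z1, z2} \<and> V (\<gamma> t) = \<i> ^ j * of_real (norm (V (\<gamma> t)))"
    using edge_unique[OF \<gamma>(2,1,3,5)] y by auto
  note ev = eventually_greaterThanLessThan[OF \<gamma>(1)]
  have "dir1 * \<i> ^ k = dir1 * \<i> ^ j"
    using tendsto_unique[OF _ \<gamma>(4) direction_limit(1)[OF eventually_mono[OF ev(1) j(2)] \<gamma>(3)]] by simp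
  then have "\<i> ^ j = \<i> ^ k" using dir_nz by simp
  then have jk: "(-\<i>) ^ j = (-\<i>) ^ k" "even j \<longleftrightarrow> even k" using ii_power_eq_imp by blast+
  have "snd y = dir2 * (-\<i>) ^ j"
    using tendsto_unique[OF _ \<gamma>(6)[unfolded y] direction_limit(2)[OF eventually_mono[OF ev(2) j(2)] \<gamma>(5)[unfolded y]]] by simp
  then show "y = (z2, dir2 * (-\<i>) ^ k) \<and> L = edge_len k"
    using y j(1) jk edge_len_cong by (metis prod.collapse)
next
  assume y: "y = (z2, dir2 * (-\<i>) ^ k) \<and> L = edge_len k"
  have "(z1, dir1 * \<i> ^ k) \<in> rg_darts f P" "(z2, dir2 * (-\<i>) ^ k) \<in> rg_darts f P"
    unfolding rg_darts_eq using quarter_turns_power by blast+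
  then show "rg_edge f P (z1, dir1 * \<i> ^ k) y L"
    unfolding rg_edge_def using y edge_exists[of k] edge_len_bounds(1)[of k] by (metis fst_conv snd_conv)
qed

lemma rg_edge_z2: "rg_edge f P (z2, dir2 * (-\<i>) ^ k) y L \<longleftrightarrow> y = (z1, dir1 * \<i> ^ k) \<and> L = edge_len k"
proof
  assume e: "rg_edge f P (z2, dir2 * (-\<i>) ^ k) y L"
  have "y \<in> rg_darts f P" using e by (simp add: rg_edge_def)
  moreover have "fst y \<noteq> z2" using rg_edge_distinct[OF e] by auto
  ultimately obtain j where y: "y = (z1, dir1 * \<i> ^ j)"
    unfolding rg_darts_eq times_quarter_turns(1)[of z1] by auto
  from rg_edge_sym[OF e] have "dir2 * (-\<i>) ^ k = dir2 * (-\<i>) ^ j" "L = edge_len j"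
    unfolding y rg_edge_z1 by auto
  then have kj: "(-\<i>) ^ k = (-\<i>) ^ j" using dir_nz by simp
  have "cnj (\<i> ^ n) = (-\<i>) ^ n" for n by simp
  with kj have "\<i> ^ k = \<i> ^ j" by (metis complex_cnj_cancel_iff)
  then show "y = (z1, dir1 * \<i> ^ k) \<and> L = edge_len k"
    using y \<open>L = edge_len j\<close> ii_power_eq_imp edge_len_cong by metis
next
  assume "y = (z1, dir1 * \<i> ^ k) \<and> L = edge_len k"
  then show "rg_edge f P (z2, dir2 * (-\<i>) ^ k) y L"
    using rg_edge_sym rg_edge_z1 by blast
qed

lemma quad_ribbon: "quad_ribbon f P z1 z2 dir1 dir2 edge_len"
  unfolding quad_ribbon_def using z1_ne_z2 dir_nz rg_darts_eq rg_edge_z1 rg_edge_z2 by blast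

end

section \<open>The theorem\<close>

text \<open>Each exceptional value of mu names the finite marked point c whose residue sign agrees
  with that at infinity; the numerator is then the square of (z - c)^2 - (c - a)(c - b).\<close>

lemma qlm_double_zero_qd:
  assumes lam: "lam \<noteq> 0" "lam \<noteq> 1"
    and abc: "(a, b, c, mu) \<in> {(lam, 1, 0, 2 * lam + 2), (0, lam, 1, 2 * lam - 2), (0, 1, lam, 2 - 2 * lam)}"
  shows "double_zero_qd a b c (csqrt ((c - a) * (c - b))) (qlm lam mu) (marked lam)"
    and "two_double_zeros (qlm lam mu) (marked lam)"
proof -
  have f: "qlm lam mu z = - (1 / (4 * complex_of_real pi ^ 2)) *
      (1 / (z - a) + 1 / (z - b) - 1 / (z - c))\<^sup>2" if "z \<notin> marked lam" for z
  proof -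
    have z: "z \<noteq> 0" "z \<noteq> 1" "z \<noteq> lam" "z - 1 \<noteq> 0" "z - lam \<noteq> 0" using that by (auto simp: marked_def)
    have "1 / (z - a) + 1 / (z - b) - 1 / (z - c) = ((z - c)\<^sup>2 - (c - a) * (c - b)) / (z * (z - 1) * (z - lam))"
      using abc z by (auto simp: divide_simps) (simp_all add: algebra_simps power2_eq_square)
    moreover have "qnum lam mu z = ((z - c)\<^sup>2 - (c - a) * (c - b))\<^sup>2"
      using abc by (auto simp: qnum_def) (simp_all add: algebra_simps power2_eq_square)
    ultimately show ?thesis using qlm_eq_qnum[OF z(1-3), of mu] by (simp add: power_divide)
  qed
  show "double_zero_qd a b c (csqrt ((c - a) * (c - b))) (qlm lam mu) (marked lam)"
    using f by unfold_locales (use lam abc in \<open>auto simp: marked_def\<close>)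
  define k where "k = csqrt ((c - a) * (c - b))"
  have k: "k\<^sup>2 = (c - a) * (c - b)" "k \<noteq> 0" using lam abc by (auto simp: k_def)
  show "two_double_zeros (qlm lam mu) (marked lam)"
  proof (rule two_double_zeros_qlm[OF lam])
    show "c + k \<noteq> c - k" using k(2) by (simp add: eq_diff_eq)
    show "qnum lam mu z = ((z - (c + k)) * (z - (c - k)))\<^sup>2" for z
    proof -
      have "(z - (c + k)) * (z - (c - k)) = (z - c)\<^sup>2 - (c - a) * (c - b)"
        unfolding k(1)[symmetric] by (simp add: algebra_simps power2_eq_square)
      then show ?thesis
        using abc by (auto simp: qnum_def) (simp_all add: algebra_simps power2_eq_square)
    qed
  qed
qed

lemma strebel_two_double_zeros_imp_real:
  assumes lam: "lam \<noteq> 0" "lam \<noteq> 1" and str: "strebel_lm lam mu" and two: "two_double_zeros (qlm lam mu) (marked lam)"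
  shows "lam \<in> \<real> \<and> mu = complex_of_real (mu_of (Re lam))"
proof -
  have "mu \<in> {2 * lam + 2, 2 - 2 * lam, 2 * lam - 2}"
  proof (rule ccontr)
    assume "mu \<notin> {2 * lam + 2, 2 - 2 * lam, 2 * lam - 2}"
    then show False
      using four_simple_zeros_qlm[OF lam] two by (auto simp: four_simple_zeros_def two_double_zeros_def)
  qed
  then obtain a b c where abc: "(a, b, c, mu) \<in> {(lam, 1, 0, 2 * lam + 2), (0, lam, 1, 2 * lam - 2), (0, 1, lam, 2 - 2 * lam)}"
    by blast
  interpret double_zero_qd a b c "csqrt ((c - a) * (c - b))" "qlm lam mu" "marked lam"
    by (rule qlm_double_zero_qd(1)[OF lam abc])
  have betw: "Im ((c - a) * cnj (c - b)) = 0" "Re ((c - a) * cnj (c - b)) < 0"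
    using strebel_imp_between str unfolding strebel_lm_def by blast+
  from abc consider "a = lam" "b = 1" "c = 0" "mu = 2 * lam + 2" | "a = 0" "b = lam" "c = 1" "mu = 2 * lam - 2"
    | "a = 0" "b = 1" "c = lam" "mu = 2 - 2 * lam" by auto
  then show ?thesis
  proof cases
    case 1
    then have "Im lam = 0" "Re lam < 0" using betw by auto
    then show ?thesis using 1 by (auto simp: complex_is_Real_iff mu_of_def complex_eq_iff)
  next
    case 2
    then have "Im lam = 0" "Re lam > 1" using betw by auto
    then show ?thesis using 2 by (auto simp: complex_is_Real_iff mu_of_def complex_eq_iff)
  next
    case 3
    then have im: "Im lam = 0" using betw by (simp add: algebra_simps)
    then have "Re lam * (Re lam - 1) < 0" using 3 betw by simp
    then have "0 < Re lam" "Re lam < 1" by (auto simp: mult_less_0_iff)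
    then show ?thesis using 3 im by (auto simp: complex_is_Real_iff mu_of_def complex_eq_iff)
  qed
qed

text \<open>The cases of \<open>mu_of\<close> are the choices that make c the middle one of the
  three real marked points.\<close>

lemma qlm_collinear:
  assumes l: "l \<noteq> 0" "l \<noteq> 1"
  obtains ra rc rb where "collinear_qd ra rc rb (qlm (of_real l) (of_real (mu_of l))) (marked (of_real l))"
    and "two_double_zeros (qlm (of_real l) (of_real (mu_of l))) (marked (of_real l))"
    and "0 < l \<and> l < 1 \<Longrightarrow> ra = 0 \<and> rc = l \<and> rb = 1"
proof -
  define lam where "lam = complex_of_real l"
  have lam: "lam \<noteq> 0" "lam \<noteq> 1" using l by (auto simp: lam_def)
  define ra where "ra = min l 0"
  define rb where "rb = max l 1"
  define rc where "rc = (if l < 0 then 0 else if l < 1 then l else 1)"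
  have ord: "ra < rc" "rc < rb" using l by (auto simp: ra_def rb_def rc_def)
  have abc: "(complex_of_real ra, complex_of_real rb, complex_of_real rc, complex_of_real (mu_of l)) \<in>
     {(lam, 1, 0, 2 * lam + 2), (0, lam, 1, 2 * lam - 2), (0, 1, lam, 2 - 2 * lam)}"
    using l by (auto simp: ra_def rb_def rc_def mu_of_def lam_def)
  interpret d: double_zero_qd "of_real ra" "of_real rb" "of_real rc"
    "csqrt ((of_real rc - of_real ra) * (of_real rc - of_real rb))" "qlm lam (of_real (mu_of l))" "marked lam"
    by (rule qlm_double_zero_qd(1)[OF lam abc])
  have "collinear_qd ra rc rb (qlm lam (of_real (mu_of l))) (marked lam)"
    using ord d.P_def d.f_eq by unfold_locales
  then show thesis
    using that qlm_double_zero_qd(2)[OF lam abc] unfolding lam_def by (auto simp: ra_def rb_def rc_def)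
qed

text \<open>The metric ribbon graph depends only on phi, that is on the ratio of A to B, and up to
  renumbering not on their order. For the marked points 0, l0, 1 this ratio is l0 to 1 - l0, whence
  the choice of l0 as the larger share.\<close>

lemma ribbon_graph_qlm:
  assumes l: "l \<noteq> 0" "l \<noteq> 1"
  shows "\<exists>l0. 1/2 \<le> l0 \<and> l0 < 1 \<and>
               rg_iso (qlm (of_real l) (of_real (mu_of l))) (marked (of_real l))
                      (qlm (of_real l0) (of_real (mu_of l0))) (marked (of_real l0)) \<and>
               (let s = arcsin (2 * l0 - 1) / pi in
                  rg_two_vertices_four_edges (qlm (of_real l0) (of_real (mu_of l0))) (marked (of_real l0))
                    (\<lambda>i. if even i then 1/2 + s else 1/2 - s))"
proof -
  obtain ra rc rb where "collinear_qd ra rc rb (qlm (of_real l) (of_real (mu_of l))) (marked (of_real l))"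
    using qlm_collinear[OF l] by blast
  then interpret q: collinear_qd ra rc rb "qlm (of_real l) (of_real (mu_of l))" "marked (of_real l)" .
  define l0 where "l0 = max q.A q.B / q.S"
  have l0: "1 / 2 \<le> l0" "l0 < 1" using q.pos q.S_eq by (auto simp: l0_def field_simps)
  then have l0': "l0 \<noteq> 0" "l0 \<noteq> 1" "0 < l0 \<and> l0 < 1" by auto
  obtain ra0 rc0 rb0 where q0: "collinear_qd ra0 rc0 rb0 (qlm (of_real l0) (of_real (mu_of l0))) (marked (of_real l0))"
      and r0: "ra0 = 0 \<and> rc0 = l0 \<and> rb0 = 1"
    using qlm_collinear[OF l0'(1,2)] l0'(3) by blast
  interpret q0: collinear_qd ra0 rc0 rb0 "qlm (of_real l0) (of_real (mu_of l0))" "marked (of_real l0)"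
    by (rule q0)
  define s where "s = arcsin (2 * l0 - 1) / pi"
  \<comment> \<open>Here A = l0, B = 1 - l0 and S = 1.\<close>
  have "q0.phi = arccos (2 * l0 - 1)"
    unfolding q0.phi_def q0.A_def q0.B_def q0.S_def using r0 by simp
  then have phi0: "q0.phi = pi / 2 - pi * s" using l0 by (simp add: arccos_arcsin_eq s_def)
  have len0: "q0.edge_len = (\<lambda>i. if even i then 1/2 + s else 1/2 - s)"
    by (rule ext) (simp add: q0.edge_len_def phi0 field_simps)
  have graph: "rg_two_vertices_four_edges (qlm (of_real l0) (of_real (mu_of l0))) (marked (of_real l0))
      (\<lambda>i. if even i then 1/2 + s else 1/2 - s)"
    using quad_ribbon_two_vertices_four_edges[OF q0.quad_ribbon q0.qzeros_eq] unfolding len0 .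
  have "rg_iso (qlm (of_real l) (of_real (mu_of l))) (marked (of_real l))
      (qlm (of_real l0) (of_real (mu_of l0))) (marked (of_real l0))"
  proof (cases "q.B \<le> q.A")
    case True
    then have "2 * l0 - 1 = (q.A - q.B) / q.S" using q.pos q.S_eq by (simp add: l0_def max_def field_simps)
    then have "q.phi = q0.phi" by (simp add: q.phi_def \<open>q0.phi = arccos _\<close>)
    then have "q.edge_len = q0.edge_len"
      by (intro ext) (simp only: q.edge_len_def q0.edge_len_def)
    then show ?thesis using quad_ribbon_iso[OF q.quad_ribbon] q0.quad_ribbon by simp
  next
    case False
    \<comment> \<open>When B is the larger part, phi is reflected to pi - phi and the two lengths
      change places; shifting the numbering by one restores the pattern.\<close>
    then have "2 * l0 - 1 = - ((q.A - q.B) / q.S)" using q.pos q.S_eq by (simp add: l0_def max_def field_simps)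
    moreover have "- 1 \<le> (q.A - q.B) / q.S" "(q.A - q.B) / q.S \<le> 1" using q.pos q.S_eq by (auto simp: field_simps)
    ultimately have "q0.phi = pi - q.phi"
      unfolding q.phi_def \<open>q0.phi = arccos _\<close> by (simp only: arccos_minus)
    then have "(\<lambda>k. q.edge_len (Suc k)) = q0.edge_len"
      by (intro ext) (simp add: q.edge_len_def q0.edge_len_def diff_divide_distrib)
    then show ?thesis using quad_ribbon_iso[OF quad_ribbon_shift[OF q.quad_ribbon]] q0.quad_ribbon by simp
  qed
  then show ?thesis using l0 graph unfolding s_def Let_def by blast
qed

theorem theorem1p1:
  shows "(\<forall>lam mu. lam \<notin> {0, 1} \<and> strebel_lm lam mu \<longrightarrow>
            two_double_zeros (qlm lam mu) (marked lam) \<or> four_simple_zeros (qlm lam mu) (marked lam))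
       \<and> (\<forall>lam mu. lam \<notin> {0, 1} \<longrightarrow>
            ((strebel_lm lam mu \<and> two_double_zeros (qlm lam mu) (marked lam)) \<longleftrightarrow>
             (lam \<in> \<real> \<and> mu = complex_of_real (mu_of (Re lam)))))
       \<and> (\<forall>l::real. l \<noteq> 0 \<and> l \<noteq> 1 \<longrightarrow>
            (\<exists>l0. 1/2 \<le> l0 \<and> l0 < 1 \<and>
               rg_iso (qlm (of_real l) (of_real (mu_of l))) (marked (of_real l))
                      (qlm (of_real l0) (of_real (mu_of l0))) (marked (of_real l0)) \<and>
               (let s = arcsin (2 * l0 - 1) / pi in
                  rg_two_vertices_four_edges (qlm (of_real l0) (of_real (mu_of l0))) (marked (of_real l0))
                    (\<lambda>i. if even i then 1/2 + s else 1/2 - s))))"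
proof (intro conjI allI impI)
  fix lam mu :: complex
  assume "lam \<notin> {0, 1} \<and> strebel_lm lam mu"
  then have lam: "lam \<noteq> 0" "lam \<noteq> 1" by auto
  show "two_double_zeros (qlm lam mu) (marked lam) \<or> four_simple_zeros (qlm lam mu) (marked lam)"
  proof (cases "mu \<in> {2 * lam + 2, 2 - 2 * lam, 2 * lam - 2}")
    case True
    then obtain a b c where "(a, b, c, mu) \<in> {(lam, 1, 0, 2 * lam + 2), (0, lam, 1, 2 * lam - 2), (0, 1, lam, 2 - 2 * lam)}"
      by blast
    then show ?thesis using qlm_double_zero_qd(2)[OF lam] by blast
  next
    case False
    then show ?thesis using four_simple_zeros_qlm[OF lam] by blast
  qed
next
  fix lam mu :: complex
  assume "lam \<notin> {0, 1}"
  then have lam: "lam \<noteq> 0" "lam \<noteq> 1" by auto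
  show "(strebel_lm lam mu \<and> two_double_zeros (qlm lam mu) (marked lam)) \<longleftrightarrow>
      (lam \<in> \<real> \<and> mu = complex_of_real (mu_of (Re lam)))"
  proof
    assume "strebel_lm lam mu \<and> two_double_zeros (qlm lam mu) (marked lam)"
    then show "lam \<in> \<real> \<and> mu = complex_of_real (mu_of (Re lam))"
      using strebel_two_double_zeros_imp_real[OF lam] by blast
  next
    assume *: "lam \<in> \<real> \<and> mu = complex_of_real (mu_of (Re lam))"
    define l where "l = Re lam"
    have l: "lam = of_real l" "mu = of_real (mu_of l)" "l \<noteq> 0" "l \<noteq> 1"
      using * lam by (auto simp: l_def complex_is_Real_iff complex_eq_iff)
    obtain ra rc rb where "collinear_qd ra rc rb (qlm lam mu) (marked lam)"
      "two_double_zeros (qlm lam mu) (marked lam)"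
      using qlm_collinear[OF l(3,4)] unfolding l(1,2) by blast
    then show "strebel_lm lam mu \<and> two_double_zeros (qlm lam mu) (marked lam)"
      unfolding strebel_lm_def using collinear_qd.strebel by blast
  qed
next
  fix l :: real
  assume "l \<noteq> 0 \<and> l \<noteq> 1"
  then show "\<exists>l0. 1/2 \<le> l0 \<and> l0 < 1 \<and>
               rg_iso (qlm (of_real l) (of_real (mu_of l))) (marked (of_real l))
                      (qlm (of_real l0) (of_real (mu_of l0))) (marked (of_real l0)) \<and>
               (let s = arcsin (2 * l0 - 1) / pi in
                  rg_two_vertices_four_edges (qlm (of_real l0) (of_real (mu_of l0))) (marked (of_real l0))
                    (\<lambda>i. if even i then 1/2 + s else 1/2 - s))"
    using ribbon_graph_qlm by blast
qed

end
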